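(* Let $X$ be a set, $\mathcal H$ a Hilbert space, and $\mathcal L$ a reproducing kernel Hilbert space of $\mathcal H$-valued functions on $X$ with reproducing kernel $K:X\times X\to B(\mathcal H)$. Let $\mathcal M(K)\subseteq B(\mathcal L)$ denote the multiplier algebra, endowed with the operator algebra structure that it inherits as a subalgebra of $B(\mathcal L)$. If $K(x,x)\neq 0$ for every $x\in X$ and $\mathcal M(K)$ separates points on $X$, then $\mathcal M(K)$ is a BPW complete local dual operator algebra of functions on $X$.
   Context: A reproducing kernel Hilbert space of $\mathcal H$-valued functions on $X$ is a Hilbert space $\mathcal L$ of functions $X\to\mathcal H$ such that each evaluation map $E_x:\mathcal L\to\mathcal H$, $x\in X$, is bounded; its reproducing kernel is $K(x,y)=E_xE_y^*$. A function $f:X\to\mathbb C$ is a multiplier if $fg\in\mathcal L$ for every $g\in\mathcal L$; then $M_f:g\mapsto fg$ is a bounded operator on $\mathcal L$. $\mathcal M(K)$ is the algebra of all multipliers, identified with $\{M_f\}\subseteq B(\mathcal L)$, so $\|(f_{ij})\|=\|(M_{f_{ij}})\|_{M_n(B(\mathcal L))}$. An (abstract, unital) operator algebra is a unital algebra $\mathcal A$ with a norm on each $M_n(\mathcal A)$ satisfying the Blecher–Ruan–Sinclair (BRS) axioms: $\|LGM\|\le\|L\|\|G\|\|M\|$ for scalar matrices $L,M$; $\|G\oplus H\|=\max\{\|G\|,\|H\|\}$; $\|GH\|\le\|G\|\|H\|$; $\|1\|=1$. A dual operator algebra is an operator algebra that is, as an operator space, the dual of an operator space; equivalently, it is completely isometrically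 isomorphic, as an algebra, to a weak*-closed subalgebra of some $B(\mathcal K)$. An operator algebra of functions on $X$ is a subalgebra $\mathcal A$ of the algebra of all complex-valued functions on $X$ which separates the points of $X$ and contains the constants, is equipped with norms on all $M_n(\mathcal A)$ satisfying the BRS axioms, and has every evaluation functional $f\mapsto f(x)$ bounded. For finite $F\subseteq X$ let $I_F=\{f\in\mathcal A:f|_F=0\}$ and give $M_n(\mathcal A/I_F)=M_n(\mathcal A)/M_n(I_F)$ the quotient norm. $\mathcal A$ is local if $\|(f_{ij})\|=\sup_F\|(f_{ij}+I_F)\|$ for all $n$ and $(f_{ij})\in M_n(\mathcal A)$, the supremum being over finite $F\subseteq X$. $\mathcal A$ is BPW complete if it contains every function $f:X\to\mathbb C$ that is the pointwise limit on $X$ of a norm-bounded net in $\mathcal A$. *)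

theory Defs
  imports
    "HOL-Analysis.L2_Norm"
    "HOL-Library.Function_Algebras"
    "Jordan_Normal_Form.Matrix"
begin

section \<open>Complex vector spaces and algebras\<close>

class complex_vector = ab_group_add +
  fixes scaleC :: "complex \<Rightarrow> 'a \<Rightarrow> 'a"  (infixr "*\<^sub>C" 75)
  assumes scaleC_add_right: "c *\<^sub>C (u + v) = c *\<^sub>C u + c *\<^sub>C v"
    and scaleC_add_left: "(c + d) *\<^sub>C u = c *\<^sub>C u + d *\<^sub>C u"
    and scaleC_scaleC: "c *\<^sub>C d *\<^sub>C u = (c * d) *\<^sub>C u"
    and scaleC_one: "1 *\<^sub>C u = u"

class complex_algebra_1 = complex_vector + ring_1 +
  assumes mult_scaleC_left: "(c *\<^sub>C a) * b = c *\<^sub>C (a * b)"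
    and mult_scaleC_right: "a * (c *\<^sub>C b) = c *\<^sub>C (a * b)"

instantiation complex :: complex_algebra_1
begin

definition scaleC_complex :: "complex \<Rightarrow> complex \<Rightarrow> complex"
  where "scaleC_complex c z = c * z"

instance
  by standard (simp_all add: scaleC_complex_def algebra_simps)

end

instantiation "fun" :: (type, complex_vector) complex_vector
begin

definition scaleC_fun :: "complex \<Rightarrow> ('a \<Rightarrow> 'b) \<Rightarrow> 'a \<Rightarrow> 'b"
  where "scaleC_fun c f = (\<lambda>x. c *\<^sub>C f x)"

instance
  by standard
    (simp_all add: scaleC_fun_def fun_eq_iff scaleC_add_right scaleC_add_left scaleC_scaleC scaleC_one)

end

instance "fun" :: (type, complex_algebra_1) complex_algebra_1
  by standard (simp_all add: scaleC_fun_def fun_eq_iff mult_scaleC_left mult_scaleC_right)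

definition csubspace :: "'v::complex_vector set \<Rightarrow> bool" where
  "csubspace V \<longleftrightarrow> 0 \<in> V \<and> (\<forall>u\<in>V. \<forall>v\<in>V. u + v \<in> V) \<and> (\<forall>c. \<forall>v\<in>V. c *\<^sub>C v \<in> V)"

definition clinear_on :: "'v::complex_vector set \<Rightarrow> ('v \<Rightarrow> 'w::complex_vector) \<Rightarrow> bool" where
  "clinear_on V T \<longleftrightarrow>
    (\<forall>u\<in>V. \<forall>v\<in>V. T (u + v) = T u + T v) \<and> (\<forall>c. \<forall>v\<in>V. T (c *\<^sub>C v) = c *\<^sub>C T v)"


section \<open>Hilbert spaces\<close>

text \<open>Hilbert spaces live on a carrier set, because a reproducing kernel Hilbert space is a set
  of functions. Inner products are linear in the first argument.\<close>

definition hnorm :: "('v \<Rightarrow> 'v \<Rightarrow> complex) \<Rightarrow> 'v \<Rightarrow> real" where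
  "hnorm ip v = sqrt (Re (ip v v))"

definition hilbert_space :: "'v::complex_vector set \<Rightarrow> ('v \<Rightarrow> 'v \<Rightarrow> complex) \<Rightarrow> bool" where
  "hilbert_space V ip \<longleftrightarrow>
    csubspace V \<and>
    (\<forall>w\<in>V. clinear_on V (\<lambda>v. ip v w)) \<and>
    (\<forall>v\<in>V. \<forall>w\<in>V. ip w v = cnj (ip v w)) \<and>
    (\<forall>v\<in>V. v \<noteq> 0 \<longrightarrow> Re (ip v v) > 0) \<and>
    (\<forall>s. (\<forall>n::nat. s n \<in> V) \<and> (\<forall>e>0. \<exists>M. \<forall>m\<ge>M. \<forall>n\<ge>M. hnorm ip (s m - s n) < e)
      \<longrightarrow> (\<exists>l\<in>V. (\<lambda>n. hnorm ip (s n - l)) \<longlonglongrightarrow> 0))"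

definition hadjoint ::
  "'v set \<Rightarrow> ('v \<Rightarrow> 'v \<Rightarrow> complex) \<Rightarrow> ('w \<Rightarrow> 'w \<Rightarrow> complex) \<Rightarrow> ('v \<Rightarrow> 'w) \<Rightarrow> 'w \<Rightarrow> 'v" where
  "hadjoint V ipV ipW T w = (THE u. u \<in> V \<and> (\<forall>v\<in>V. ipW (T v) w = ipV v u))"

text \<open>The norm of an operator matrix \<^term>\<open>T\<close>, acting on columns of vectors of \<^term>\<open>V\<close>, between
  Hilbert space direct sums of copies of \<^term>\<open>V\<close>.\<close>

definition opmat_norm ::
  "'v::complex_vector set \<Rightarrow> ('v \<Rightarrow> 'v \<Rightarrow> complex) \<Rightarrow> ('v \<Rightarrow> 'v) mat \<Rightarrow> real" where
  "opmat_norm V ip T =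
    Sup {L2_set (\<lambda>i. hnorm ip (\<Sum>j<dim_col T. (T $$ (i, j)) (v j))) {..<dim_row T} | v.
      (\<forall>j<dim_col T. v j \<in> V) \<and> L2_set (\<lambda>j. hnorm ip (v j)) {..<dim_col T} \<le> 1}"

definition scalar_norm :: "complex mat \<Rightarrow> real" where
  "scalar_norm L =
    Sup {L2_set (\<lambda>i. cmod (\<Sum>j<dim_col L. L $$ (i, j) * z j)) {..<dim_row L} | z.
      L2_set (\<lambda>j. cmod (z j)) {..<dim_col L} \<le> 1}"


section \<open>Operator spaces and their duals\<close>

definition matrices :: "nat \<Rightarrow> 'v set \<Rightarrow> 'v mat set" where
  "matrices n V = {G \<in> carrier_mat n n. elements_mat G \<subseteq> V}"

definition mat1 :: "'v \<Rightarrow> 'v mat" where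
  "mat1 v = mat 1 1 (\<lambda>_. v)"

definition direct_sum :: "'v::zero mat \<Rightarrow> 'v mat \<Rightarrow> 'v mat"  (infixr "\<oplus>\<^sub>m" 65) where
  "G \<oplus>\<^sub>m H =
    four_block_mat G (0\<^sub>m (dim_row G) (dim_col H)) (0\<^sub>m (dim_row H) (dim_col G)) H"

definition scalar_sandwich ::
  "complex mat \<Rightarrow> 'v::complex_vector mat \<Rightarrow> complex mat \<Rightarrow> 'v mat" where
  "scalar_sandwich L G M =
    mat (dim_row L) (dim_col M)
      (\<lambda>(i, j). \<Sum>k<dim_row G. \<Sum>l<dim_col G. (L $$ (i, k) * M $$ (l, j)) *\<^sub>C G $$ (k, l))"

text \<open>One function \<^term>\<open>N\<close> carries the norms of all matrix levels, as matrices know their size.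
  Completeness is not required; a normed operator space and its completion have the same dual.\<close>

definition operator_space :: "'v::complex_vector set \<Rightarrow> ('v mat \<Rightarrow> real) \<Rightarrow> bool" where
  "operator_space V N \<longleftrightarrow>
    csubspace V \<and>
    (\<forall>n>0. \<forall>G\<in>matrices n V.
      N G \<ge> 0 \<and> (N G = 0 \<longleftrightarrow> G = 0\<^sub>m n n) \<and>
      (\<forall>H\<in>matrices n V. N (G + H) \<le> N G + N H) \<and>
      (\<forall>c. N (map_mat (\<lambda>v. c *\<^sub>C v) G) = cmod c * N G)) \<and>
    (\<forall>m>0. \<forall>n>0. \<forall>L\<in>carrier_mat m n. \<forall>G\<in>matrices n V. \<forall>M\<in>carrier_mat n m.
      N (scalar_sandwich L G M) \<le> scalar_norm L * N G * scalar_norm M) \<and>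
    (\<forall>m>0. \<forall>n>0. \<forall>G\<in>matrices m V. \<forall>H\<in>matrices n V. N (G \<oplus>\<^sub>m H) = max (N G) (N H))"

text \<open>Bounded functionals on \<^term>\<open>V\<close> are normalised to vanish off \<^term>\<open>V\<close>.\<close>

definition opdual :: "'v::complex_vector set \<Rightarrow> ('v mat \<Rightarrow> real) \<Rightarrow> ('v \<Rightarrow> complex) set" where
  "opdual V N =
    {\<phi>. clinear_on V \<phi> \<and> (\<exists>C. \<forall>v\<in>V. cmod (\<phi> v) \<le> C * N (mat1 v)) \<and> (\<forall>v. v \<notin> V \<longrightarrow> \<phi> v = 0)}"

text \<open>The complex matrix with entries \<open>\<phi>\<^sub>i\<^sub>j (v\<^sub>k\<^sub>l)\<close>, where row \<open>(i, k)\<close> is numbered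
  \<open>i * m + k\<close> and column \<open>(j, l)\<close> is numbered \<open>j * m + l\<close>, for \<open>m\<close> the size of the matrix
  \<open>(v\<^sub>k\<^sub>l)\<close>.\<close>

definition matrix_pairing :: "('v \<Rightarrow> complex) mat \<Rightarrow> 'v mat \<Rightarrow> complex mat" where
  "matrix_pairing \<Phi> G =
    mat (dim_row \<Phi> * dim_row G) (dim_col \<Phi> * dim_col G)
      (\<lambda>(r, s). (\<Phi> $$ (r div dim_row G, s div dim_col G)) (G $$ (r mod dim_row G, s mod dim_col G)))"

text \<open>The operator space structure of the dual: the norm on \<open>M\<^sub>n(V\<^sup>*)\<close> is that of the
  completely bounded maps \<open>V \<rightarrow> M\<^sub>n\<close>.\<close>

definition opdual_norm ::
  "'v::complex_vector set \<Rightarrow> ('v mat \<Rightarrow> real) \<Rightarrow> ('v \<Rightarrow> complex) mat \<Rightarrow> real" where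
  "opdual_norm V N \<Phi> =
    Sup {scalar_norm (matrix_pairing \<Phi> G) | m G. m > 0 \<and> G \<in> matrices m V \<and> N G \<le> 1}"

definition complete_isometric_iso ::
  "'v::complex_vector set \<Rightarrow> ('v mat \<Rightarrow> real) \<Rightarrow> 'w::complex_vector set \<Rightarrow> ('w mat \<Rightarrow> real)
    \<Rightarrow> ('v \<Rightarrow> 'w) \<Rightarrow> bool" where
  "complete_isometric_iso V NV W NW T \<longleftrightarrow>
    clinear_on V T \<and> bij_betw T V W \<and>
    (\<forall>n>0. \<forall>G\<in>matrices n V. NW (map_mat T G) = NV G)"

text \<open>The type of the predual is no restriction: a predual of \<^term>\<open>A\<close> embeds completely
  isometrically into the dual of \<^term>\<open>A\<close>, whose elements have type \<^typ>\<open>'a \<Rightarrow> complex\<close>.\<close>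

definition dual_operator_space :: "'a::complex_vector set \<Rightarrow> ('a mat \<Rightarrow> real) \<Rightarrow> bool" where
  "dual_operator_space A N \<longleftrightarrow>
    (\<exists>(V :: ('a \<Rightarrow> complex) set) NV T.
      operator_space V NV \<and> complete_isometric_iso A N (opdual V NV) (opdual_norm V NV) T)"


section \<open>Operator algebras\<close>

definition operator_algebra :: "'a::complex_algebra_1 set \<Rightarrow> ('a mat \<Rightarrow> real) \<Rightarrow> bool" where
  "operator_algebra A N \<longleftrightarrow>
    operator_space A N \<and>
    1 \<in> A \<and> (\<forall>a\<in>A. \<forall>b\<in>A. a * b \<in> A) \<and>
    (\<forall>n>0. \<forall>G\<in>matrices n A. \<forall>H\<in>matrices n A. N (G * H) \<le> N G * N H) \<and>
    N (mat1 1) = 1"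

definition dual_operator_algebra :: "'a::complex_algebra_1 set \<Rightarrow> ('a mat \<Rightarrow> real) \<Rightarrow> bool" where
  "dual_operator_algebra A N \<longleftrightarrow> operator_algebra A N \<and> dual_operator_space A N"

definition separates_points :: "('x \<Rightarrow> complex) set \<Rightarrow> bool" where
  "separates_points A \<longleftrightarrow> (\<forall>x y. x \<noteq> y \<longrightarrow> (\<exists>f\<in>A. f x \<noteq> f y))"

definition operator_algebra_of_functions ::
  "('x \<Rightarrow> complex) set \<Rightarrow> (('x \<Rightarrow> complex) mat \<Rightarrow> real) \<Rightarrow> bool" where
  "operator_algebra_of_functions A N \<longleftrightarrow>
    operator_algebra A N \<and> separates_points A \<and> (\<forall>c. (\<lambda>_. c) \<in> A) \<and>
    (\<forall>x. \<exists>C. \<forall>f\<in>A. cmod (f x) \<le> C * N (mat1 f))"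

definition vanishing_ideal :: "('x \<Rightarrow> complex) set \<Rightarrow> 'x set \<Rightarrow> ('x \<Rightarrow> complex) set" where
  "vanishing_ideal A F = {f \<in> A. \<forall>x\<in>F. f x = 0}"

definition quotient_norm :: "('v::plus mat \<Rightarrow> real) \<Rightarrow> 'v set \<Rightarrow> 'v mat \<Rightarrow> real" where
  "quotient_norm N I G = Inf {N (G + P) | P. P \<in> matrices (dim_row G) I}"

definition local_algebra ::
  "('x \<Rightarrow> complex) set \<Rightarrow> (('x \<Rightarrow> complex) mat \<Rightarrow> real) \<Rightarrow> bool" where
  "local_algebra A N \<longleftrightarrow>
    (\<forall>n>0. \<forall>G\<in>matrices n A.
      N G = Sup {quotient_norm N (vanishing_ideal A F) G | F. finite F})"

text \<open>Nets are rendered as proper filters: a net in \<^term>\<open>A\<close> is represented by the filter on the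
  functions that its tails generate.\<close>

definition BPW_complete ::
  "('x \<Rightarrow> complex) set \<Rightarrow> (('x \<Rightarrow> complex) mat \<Rightarrow> real) \<Rightarrow> bool" where
  "BPW_complete A N \<longleftrightarrow>
    (\<forall>f. (\<exists>\<F> C. \<F> \<noteq> bot \<and> (\<forall>\<^sub>F g in \<F>. g \<in> A \<and> N (mat1 g) \<le> C) \<and>
            (\<forall>x. ((\<lambda>g. g x) \<longlongrightarrow> f x) \<F>))
      \<longrightarrow> f \<in> A)"


section \<open>Reproducing kernel Hilbert spaces and multipliers\<close>

text \<open>\<^term>\<open>ipH\<close> is the inner product of the Hilbert space \<^typ>\<open>'h\<close> of values, \<^term>\<open>ipL\<close> that of the
  space \<^term>\<open>\<L>\<close> of functions.\<close>

definition rkhs ::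
  "('h::complex_vector \<Rightarrow> 'h \<Rightarrow> complex) \<Rightarrow> ('x \<Rightarrow> 'h) set
    \<Rightarrow> (('x \<Rightarrow> 'h) \<Rightarrow> ('x \<Rightarrow> 'h) \<Rightarrow> complex) \<Rightarrow> bool" where
  "rkhs ipH \<L> ipL \<longleftrightarrow>
    hilbert_space \<L> ipL \<and> (\<forall>x. \<exists>C. \<forall>g\<in>\<L>. hnorm ipH (g x) \<le> C * hnorm ipL g)"

definition reproducing_kernel ::
  "('h::complex_vector \<Rightarrow> 'h \<Rightarrow> complex) \<Rightarrow> ('x \<Rightarrow> 'h) set
    \<Rightarrow> (('x \<Rightarrow> 'h) \<Rightarrow> ('x \<Rightarrow> 'h) \<Rightarrow> complex) \<Rightarrow> 'x \<Rightarrow> 'x \<Rightarrow> 'h \<Rightarrow> 'h" where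
  "reproducing_kernel ipH \<L> ipL x y = (\<lambda>g. g x) \<circ> hadjoint \<L> ipL ipH (\<lambda>g. g y)"

definition mult_op :: "('x \<Rightarrow> complex) \<Rightarrow> ('x \<Rightarrow> 'h::complex_vector) \<Rightarrow> 'x \<Rightarrow> 'h" where
  "mult_op f g = (\<lambda>x. f x *\<^sub>C g x)"

definition multipliers :: "('x \<Rightarrow> 'h::complex_vector) set \<Rightarrow> ('x \<Rightarrow> complex) set" where
  "multipliers \<L> = {f. \<forall>g\<in>\<L>. mult_op f g \<in> \<L>}"

definition multiplier_norm ::
  "('x \<Rightarrow> 'h::complex_vector) set \<Rightarrow> (('x \<Rightarrow> 'h) \<Rightarrow> ('x \<Rightarrow> 'h) \<Rightarrow> complex)
    \<Rightarrow> ('x \<Rightarrow> complex) mat \<Rightarrow> real" where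
  "multiplier_norm \<L> ipL G = opmat_norm \<L> ipL (map_mat mult_op G)"

end

theory Submission
  imports Defs
begin

text \<open>The span of the kernel vectors \<open>E\<^sub>x\<^sup>* e\<close> is dense in \<^term>\<open>\<L>\<close>, and pairing \<open>f g\<close> with a kernel
  vector gives \<open>f(x) \<langle>g(x), e\<rangle>\<close>. So the norm of a matrix \<open>G\<close> of multipliers is the supremum of
  \<open>|\<langle>G v, w\<rangle>|\<close> over unit columns \<open>v\<close> and unit columns \<open>w\<close> of combinations of kernel vectors; each such
  number depends only on the values of \<open>G\<close> on a finite set, which gives locality. Conversely, if
  the sesquilinear expressions \<open>f(x) \<langle>g(x), e\<rangle>\<close> are bounded on the span of the kernel vectors,
  the Riesz lemma produces \<open>f g \<in> \<L>\<close>; this gives BPW completeness.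

  The predual is the span of the point evaluations, normed as a subspace of the dual operator
  space of the multiplier algebra. A bounded functional \<open>\<psi>\<close> on it is evaluation at the function
  \<open>x \<mapsto> \<psi>(ev\<^sub>x)\<close>, which is a multiplier by the same Riesz argument. The identification is completely
  isometric because compressions of multipliers to finite-dimensional subspaces, with the range
  side spanned by kernel vectors, are completely contractive matrices over the predual.\<close>

section \<open>Complex vector spaces and inner products\<close>

text \<open>A multiplier is only known to map \<open>\<L>\<close> into itself, and a norm given as a
  supremum of reals says nothing until the set is known to be bounded. So boundedness of
  multiplication is derived from uniform boundedness, and norms are mostly handled through
  statements \<open>N G \<le> C\<close> with \<open>C \<ge> 0\<close>, each equivalent to an
  estimate over all columns of vectors. The condition on the kernel enters as follows: every point x
  has some g in \<open>\<L>\<close> with g(x) nonzero. Then f(x) g(x) = (f g)(x) makes evaluation at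
  x completely bounded, and f is determined by its operator. Input columns v are arbitrary, but test
  columns w must come from kernel vectors, as only then is <f g, w> a finite combination of values
  of f. Since v and w are not orthonormal, the matrix of functionals <f v_j, w_i> need not be
  contractive. Two Gram-Schmidt families of the size of the matrix repair this; the coordinates of v
  and w move into the scalar vectors on which the pairing is tested. No completion of the predual is
  taken: a bounded functional on the span itself already feeds the Riesz argument.\<close>

lemma scaleC_zero_right [simp]: "c *\<^sub>C (0::'v::complex_vector) = 0"
  using scaleC_add_right[of c 0 "0::'v"] by simp

lemma scaleC_zero_left [simp]: "0 *\<^sub>C (v::'v::complex_vector) = 0"
  using scaleC_add_left[of 0 0 v] by simp

lemma scaleC_minus_left: "(- c) *\<^sub>C (v::'v::complex_vector) = - (c *\<^sub>C v)"
  using scaleC_add_left[of "- c" c v] by (simp add: eq_neg_iff_add_eq_0)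

lemma scaleC_sum_right: "c *\<^sub>C (\<Sum>i\<in>I. (f i :: 'v::complex_vector)) = (\<Sum>i\<in>I. c *\<^sub>C f i)"
  by (induction I rule: infinite_finite_induct) (simp_all add: scaleC_add_right)

lemma scaleC_sum_left: "(\<Sum>i\<in>I. c i) *\<^sub>C (v :: 'v::complex_vector) = (\<Sum>i\<in>I. c i *\<^sub>C v)"
  by (induction I rule: infinite_finite_induct) (simp_all add: scaleC_add_left)

lemma csubspace_0: "csubspace V \<Longrightarrow> 0 \<in> V"
  and csubspace_add: "csubspace V \<Longrightarrow> u \<in> V \<Longrightarrow> v \<in> V \<Longrightarrow> u + v \<in> V"
  and csubspace_scale: "csubspace V \<Longrightarrow> v \<in> V \<Longrightarrow> c *\<^sub>C v \<in> V"
  by (auto simp: csubspace_def)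

lemma csubspace_minus: "csubspace V \<Longrightarrow> v \<in> V \<Longrightarrow> - v \<in> V"
  using csubspace_scale[of V v "-1"] by (simp add: scaleC_minus_left scaleC_one)

lemma csubspace_diff: "csubspace V \<Longrightarrow> u \<in> V \<Longrightarrow> v \<in> V \<Longrightarrow> u - v \<in> V"
  using csubspace_add[of V u "- v"] by (simp add: csubspace_minus)

lemma csubspace_sum: "csubspace V \<Longrightarrow> (\<And>i. i \<in> I \<Longrightarrow> f i \<in> V) \<Longrightarrow> (\<Sum>i\<in>I. f i) \<in> V"
  by (induction I rule: infinite_finite_induct) (auto simp: csubspace_0 csubspace_add)

lemma clinear_on_0: "csubspace V \<Longrightarrow> clinear_on V T \<Longrightarrow> T 0 = 0"
  using scaleC_zero_left by (metis clinear_on_def csubspace_0)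

lemma clinear_on_sum:
  assumes "csubspace V" "clinear_on V T" "\<And>i. i \<in> I \<Longrightarrow> f i \<in> V"
  shows "T (\<Sum>i\<in>I. f i) = (\<Sum>i\<in>I. T (f i))"
  using assms(3)
proof (induction I rule: infinite_finite_induct)
  case (insert i I)
  then have "(\<Sum>i\<in>I. f i) \<in> V" using assms(1) by (intro csubspace_sum) auto
  then show ?case using insert assms(2) by (simp add: clinear_on_def)
qed (use assms clinear_on_0 in auto)

lemma L2_set_power2: "(L2_set f S)\<^sup>2 = (\<Sum>i\<in>S. (f i)\<^sup>2)"
  by (simp add: L2_set_def sum_nonneg)

lemma L2_set_zero [simp]: "L2_set (\<lambda>i. 0) S = 0"
  by (simp add: L2_set_def)

section \<open>Inner product geometry on a carrier set\<close>

locale inner_space =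
  fixes V :: "'v::complex_vector set" and ip :: "'v \<Rightarrow> 'v \<Rightarrow> complex"
  assumes subspace: "csubspace V"
    and ip_clinear: "w \<in> V \<Longrightarrow> clinear_on V (\<lambda>v. ip v w)"
    and ip_cnj: "v \<in> V \<Longrightarrow> w \<in> V \<Longrightarrow> ip w v = cnj (ip v w)"
    and ip_pos: "v \<in> V \<Longrightarrow> v \<noteq> 0 \<Longrightarrow> Re (ip v v) > 0"
begin

abbreviation nrm :: "'v \<Rightarrow> real" where "nrm \<equiv> hnorm ip"

lemmas zero_mem [simp] = csubspace_0[OF subspace]
  and add_mem [simp] = csubspace_add[OF subspace]
  and scale_mem [simp] = csubspace_scale[OF subspace]
  and minus_mem [simp] = csubspace_minus[OF subspace]
  and diff_mem [simp] = csubspace_diff[OF subspace]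
  and sum_mem = csubspace_sum[OF subspace]

lemma ip_add_left: "u \<in> V \<Longrightarrow> v \<in> V \<Longrightarrow> w \<in> V \<Longrightarrow> ip (u + v) w = ip u w + ip v w"
  using ip_clinear[of w] by (simp add: clinear_on_def)

lemma ip_scale_left: "v \<in> V \<Longrightarrow> w \<in> V \<Longrightarrow> ip (c *\<^sub>C v) w = c * ip v w"
  using ip_clinear[of w] by (simp add: clinear_on_def scaleC_complex_def)

lemma ip_zero_left [simp]: "w \<in> V \<Longrightarrow> ip 0 w = 0"
  using ip_scale_left[of 0 w 0] by simp

lemma ip_minus_left: "v \<in> V \<Longrightarrow> w \<in> V \<Longrightarrow> ip (- v) w = - ip v w"
  using ip_scale_left[of v w "-1"] by (simp add: scaleC_minus_left scaleC_one)

lemma ip_diff_left: "u \<in> V \<Longrightarrow> v \<in> V \<Longrightarrow> w \<in> V \<Longrightarrow> ip (u - v) w = ip u w - ip v w"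
  using ip_add_left[of u "- v" w] by (simp add: ip_minus_left)

lemma ip_sum_left:
  "w \<in> V \<Longrightarrow> (\<And>i. i \<in> I \<Longrightarrow> f i \<in> V) \<Longrightarrow> ip (\<Sum>i\<in>I. f i) w = (\<Sum>i\<in>I. ip (f i) w)"
  by (rule clinear_on_sum[OF subspace ip_clinear])

lemma ip_add_right: "u \<in> V \<Longrightarrow> v \<in> V \<Longrightarrow> w \<in> V \<Longrightarrow> ip w (u + v) = ip w u + ip w v"
  using ip_cnj[of "u + v" w] ip_cnj[of u w] ip_cnj[of v w] by (simp add: ip_add_left)

lemma ip_scale_right: "v \<in> V \<Longrightarrow> w \<in> V \<Longrightarrow> ip w (c *\<^sub>C v) = cnj c * ip w v"
  using ip_cnj[of "c *\<^sub>C v" w] ip_cnj[of v w] by (simp add: ip_scale_left)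

lemma ip_zero_right [simp]: "w \<in> V \<Longrightarrow> ip w 0 = 0"
  using ip_cnj[of 0 w] by simp

lemma ip_minus_right: "v \<in> V \<Longrightarrow> w \<in> V \<Longrightarrow> ip w (- v) = - ip w v"
  using ip_cnj[of "- v" w] ip_cnj[of v w] by (simp add: ip_minus_left)

lemma ip_diff_right: "u \<in> V \<Longrightarrow> v \<in> V \<Longrightarrow> w \<in> V \<Longrightarrow> ip w (u - v) = ip w u - ip w v"
  using ip_add_right[of u "- v" w] by (simp add: ip_minus_right)

lemma ip_sum_right:
  assumes "w \<in> V" "\<And>i. i \<in> I \<Longrightarrow> f i \<in> V"
  shows "ip w (\<Sum>i\<in>I. f i) = (\<Sum>i\<in>I. ip w (f i))"
proof -
  have "ip w (\<Sum>i\<in>I. f i) = cnj (ip (\<Sum>i\<in>I. f i) w)"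
    using assms by (intro ip_cnj sum_mem) auto
  also have "\<dots> = (\<Sum>i\<in>I. cnj (ip (f i) w))" using assms by (simp add: ip_sum_left)
  also have "\<dots> = (\<Sum>i\<in>I. ip w (f i))" using assms by (intro sum.cong refl ip_cnj[symmetric]) auto
  finally show ?thesis .
qed

lemma ip_self_nonneg: "v \<in> V \<Longrightarrow> Re (ip v v) \<ge> 0"
  using ip_pos[of v] by (cases "v = 0") auto

lemma nrm_nonneg [simp]: "v \<in> V \<Longrightarrow> nrm v \<ge> 0"
  by (simp add: hnorm_def ip_self_nonneg)

lemma nrm_power2: "v \<in> V \<Longrightarrow> (nrm v)\<^sup>2 = Re (ip v v)"
  by (simp add: hnorm_def ip_self_nonneg)

lemma ip_self: "v \<in> V \<Longrightarrow> ip v v = of_real ((nrm v)\<^sup>2)"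
  using ip_cnj[of v v] by (simp add: nrm_power2 complex_eq_iff)

lemma nrm_zero [simp]: "nrm 0 = 0"
  by (simp add: hnorm_def)

lemma nrm_eq_0: "v \<in> V \<Longrightarrow> nrm v = 0 \<longleftrightarrow> v = 0"
  using ip_pos[of v] nrm_power2[of v] by (cases "v = 0") auto

lemma nrm_scale: "v \<in> V \<Longrightarrow> nrm (c *\<^sub>C v) = cmod c * nrm v"
proof -
  assume v: "v \<in> V"
  have "ip (c *\<^sub>C v) (c *\<^sub>C v) = (c * cnj c) * ip v v"
    using v by (simp add: ip_scale_left ip_scale_right)
  also have "\<dots> = of_real ((cmod c)\<^sup>2 * (nrm v)\<^sup>2)"
    using v complex_norm_square[of c] by (simp only: ip_self of_real_mult)
  finally show ?thesis using v by (simp add: hnorm_def[of ip "c *\<^sub>C v"] real_sqrt_mult)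
qed

lemma nrm_minus: "v \<in> V \<Longrightarrow> nrm (- v) = nrm v"
  using nrm_scale[of v "-1"] by (simp add: scaleC_minus_left scaleC_one)

lemma nrm_add_power2:
  "u \<in> V \<Longrightarrow> v \<in> V \<Longrightarrow> (nrm (u + v))\<^sup>2 = (nrm u)\<^sup>2 + 2 * Re (ip u v) + (nrm v)\<^sup>2"
  using ip_cnj[of u v] by (simp add: nrm_power2 ip_add_left ip_add_right)

lemma nrm_diff_power2:
  "u \<in> V \<Longrightarrow> v \<in> V \<Longrightarrow> (nrm (u - v))\<^sup>2 = (nrm u)\<^sup>2 - 2 * Re (ip u v) + (nrm v)\<^sup>2"
  using nrm_add_power2[of u "- v"] by (simp add: ip_minus_right nrm_minus)

lemma cauchy_schwarz: assumes u: "u \<in> V" and v: "v \<in> V" shows "cmod (ip u v) \<le> nrm u * nrm v"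
proof (cases "v = 0")
  case False
  then have pos: "nrm v > 0" using nrm_nonneg[OF v] nrm_eq_0[OF v] by linarith
  \<comment> \<open>The coefficient of the projection of \<open>u\<close> onto \<open>v\<close>; the
    squared norm of the remainder is nonnegative, and this is the inequality.\<close>
  define c where "c = ip u v / of_real ((nrm v)\<^sup>2)"
  have "cnj c * ip u v = of_real ((cmod (ip u v))\<^sup>2 / (nrm v)\<^sup>2)"
    using complex_norm_square[of "ip u v"] by (simp add: c_def mult.commute)
  then have 1: "Re (ip u (c *\<^sub>C v)) = (cmod (ip u v))\<^sup>2 / (nrm v)\<^sup>2"
    using u v by (simp only: ip_scale_right Re_complex_of_real)
  have 2: "(nrm (c *\<^sub>C v))\<^sup>2 = (cmod (ip u v))\<^sup>2 / (nrm v)\<^sup>2"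
  proof -
    have "cmod c = cmod (ip u v) / (nrm v)\<^sup>2"
      using pos by (simp only: c_def norm_divide norm_of_real) simp
    then show ?thesis using v pos by (simp add: nrm_scale power2_eq_square)
  qed
  have "0 \<le> (nrm (u - c *\<^sub>C v))\<^sup>2" by simp
  also have "\<dots> = (nrm u)\<^sup>2 - (cmod (ip u v))\<^sup>2 / (nrm v)\<^sup>2"
    using nrm_diff_power2[OF u scale_mem[OF v, of c]] 1 2 by simp
  finally have "(cmod (ip u v))\<^sup>2 \<le> (nrm u * nrm v)\<^sup>2"
    using pos by (simp add: pos_divide_le_eq power_mult_distrib)
  then show ?thesis by (rule power2_le_imp_le) (use u v in simp)
qed (use u in simp)

lemma nrm_triangle: assumes "u \<in> V" "v \<in> V" shows "nrm (u + v) \<le> nrm u + nrm v"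
proof (rule power2_le_imp_le)
  have "Re (ip u v) \<le> nrm u * nrm v"
    using cauchy_schwarz[OF assms] complex_Re_le_cmod order_trans by blast
  then show "(nrm (u + v))\<^sup>2 \<le> (nrm u + nrm v)\<^sup>2"
    using assms by (simp add: nrm_add_power2 power2_sum)
qed (use assms in simp)

lemma nrm_diff_triangle: "u \<in> V \<Longrightarrow> v \<in> V \<Longrightarrow> nrm (u - v) \<le> nrm u + nrm v"
  using nrm_triangle[of u "- v"] by (simp add: nrm_minus)

lemma nrm_sum_le: "(\<And>i. i \<in> I \<Longrightarrow> f i \<in> V) \<Longrightarrow> nrm (\<Sum>i\<in>I. f i) \<le> (\<Sum>i\<in>I. nrm (f i))"
proof (induction I rule: infinite_finite_induct)
  case (insert i I)
  then have "nrm (f i + (\<Sum>i\<in>I. f i)) \<le> nrm (f i) + nrm (\<Sum>i\<in>I. f i)"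
    by (intro nrm_triangle sum_mem) auto
  then show ?case using insert by force
qed auto

lemma L2_nrm_triangle:
  assumes "\<And>i. i \<in> I \<Longrightarrow> u i \<in> V" "\<And>i. i \<in> I \<Longrightarrow> v i \<in> V"
  shows "L2_set (\<lambda>i. nrm (u i + v i)) I \<le> L2_set (\<lambda>i. nrm (u i)) I + L2_set (\<lambda>i. nrm (v i)) I"
  using assms by (intro order_trans[OF _ L2_set_triangle_ineq] L2_set_mono) (auto intro: nrm_triangle)

text \<open>Allowing zero vectors keeps the number of vectors in the Gram--Schmidt process fixed.\<close>

definition ortho_family :: "nat \<Rightarrow> (nat \<Rightarrow> 'v) \<Rightarrow> bool" where
  "ortho_family n q \<longleftrightarrow> (\<forall>l<n. q l \<in> V \<and> (q l = 0 \<or> nrm (q l) = 1)) \<and>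
    (\<forall>l<n. \<forall>m<n. l \<noteq> m \<longrightarrow> ip (q l) (q m) = 0)"

text \<open>The factor \<open>(nrm (q m))\<^sup>2\<close> is 1 for a unit vector and 0 for a zero
  vector, so both kinds of members are treated at once.\<close>

lemma ortho_family_ip_sum:
  assumes q: "ortho_family n q" and m: "m < n"
  shows "ip (\<Sum>l<n. c l *\<^sub>C q l) (q m) = c m * of_real ((nrm (q m))\<^sup>2)"
proof -
  have qV: "\<And>l. l < n \<Longrightarrow> q l \<in> V" using q by (simp add: ortho_family_def)
  have "ip (\<Sum>l<n. c l *\<^sub>C q l) (q m) = (\<Sum>l<n. c l * ip (q l) (q m))"
    using qV m by (subst ip_sum_left) (auto simp: ip_scale_left)
  also have "\<dots> = (\<Sum>l<n. if l = m then c m * ip (q m) (q m) else 0)"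
    using q m by (intro sum.cong) (auto simp: ortho_family_def)
  finally show ?thesis using q m by (simp add: ortho_family_def ip_self)
qed

lemma ortho_family_nrm_sum:
  assumes q: "ortho_family n q"
  shows "(nrm (\<Sum>l<n. c l *\<^sub>C q l))\<^sup>2 = (\<Sum>l<n. (cmod (c l) * nrm (q l))\<^sup>2)"
proof -
  let ?s = "\<Sum>l<n. c l *\<^sub>C q l"
  have s: "?s \<in> V" using q by (intro sum_mem) (auto simp: ortho_family_def)
  have "ip ?s ?s = (\<Sum>m<n. cnj (c m) * ip ?s (q m))"
    using q s by (subst ip_sum_right) (auto simp: ortho_family_def ip_scale_right)
  also have "\<dots> = (\<Sum>m<n. of_real ((cmod (c m) * nrm (q m))\<^sup>2))"
  proof (intro sum.cong refl)
    fix m assume "m \<in> {..<n}"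
    then show "cnj (c m) * ip ?s (q m) = of_real ((cmod (c m) * nrm (q m))\<^sup>2)"
      using q complex_norm_square[of "c m"]
      by (simp only: ortho_family_ip_sum lessThan_iff power_mult_distrib of_real_mult) simp
  qed
  also have "\<dots> = of_real (\<Sum>m<n. (cmod (c m) * nrm (q m))\<^sup>2)" by simp
  finally show ?thesis using s by (simp only: nrm_power2 Re_complex_of_real)
qed

text \<open>Equality can fail because coefficients at zero members of the family are lost.\<close>

lemma ortho_family_nrm_sum_le:
  assumes q: "ortho_family n q"
  shows "nrm (\<Sum>l<n. c l *\<^sub>C q l) \<le> L2_set (\<lambda>l. cmod (c l)) {..<n}"
proof (rule power2_le_imp_le)
  show "(nrm (\<Sum>l<n. c l *\<^sub>C q l))\<^sup>2 \<le> (L2_set (\<lambda>l. cmod (c l)) {..<n})\<^sup>2"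
    unfolding ortho_family_nrm_sum[OF q] L2_set_power2
    using q by (intro sum_mono) (auto simp: ortho_family_def)
qed simp

lemma bessel:
  assumes q: "ortho_family n q" and u: "u \<in> V"
  shows "L2_set (\<lambda>l. cmod (ip u (q l))) {..<n} \<le> nrm u"
proof (rule power2_le_imp_le)
  let ?s = "\<Sum>l<n. ip u (q l) *\<^sub>C q l" and ?B = "\<Sum>l<n. (cmod (ip u (q l)))\<^sup>2"
  have s: "?s \<in> V" using q by (intro sum_mem) (auto simp: ortho_family_def)
  have "ip u ?s = (\<Sum>l<n. cnj (ip u (q l)) * ip u (q l))"
    using q u by (subst ip_sum_right) (auto simp: ortho_family_def ip_scale_right)
  also have "\<dots> = of_real ?B" unfolding of_real_sum
    by (intro sum.cong refl) (metis complex_norm_square mult.commute)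
  finally have "Re (ip u ?s) = ?B" by (simp only: Re_complex_of_real)
  moreover have "(nrm ?s)\<^sup>2 \<le> ?B"
    using power_mono[OF ortho_family_nrm_sum_le[OF q, of "\<lambda>l. ip u (q l)"], of 2] s
    by (simp add: L2_set_power2)
  moreover have "0 \<le> (nrm (u - ?s))\<^sup>2" by simp
  ultimately show "(L2_set (\<lambda>l. cmod (ip u (q l))) {..<n})\<^sup>2 \<le> (nrm u)\<^sup>2"
    unfolding nrm_diff_power2[OF u s] L2_set_power2 by linarith
qed (use u in simp)

text \<open>The subspace \<open>S\<close> is a parameter so that vectors from the span of the kernel
  vectors yield a family inside that span; functionals built from such a family lie in the
  predual.\<close>

lemma gram_schmidt:
  assumes S: "csubspace S" "S \<subseteq> V" and v: "\<And>j. j < n \<Longrightarrow> v j \<in> S"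
  shows "\<exists>q. ortho_family n q \<and> (\<forall>l<n. q l \<in> S) \<and> (\<forall>j<n. v j = (\<Sum>l<n. ip (v j) (q l) *\<^sub>C q l))"
  using v
proof (induction n)
  case 0
  then show ?case by (simp add: ortho_family_def)
next
  case (Suc n)
  then obtain q where q: "ortho_family n q" "\<forall>l<n. q l \<in> S"
      "\<forall>j<n. v j = (\<Sum>l<n. ip (v j) (q l) *\<^sub>C q l)"
    by (meson less_Suc_eq)
  have vV: "\<And>j. j < Suc n \<Longrightarrow> v j \<in> V" using S Suc.prems by blast
  have qV: "\<And>l. l < n \<Longrightarrow> q l \<in> V" using q S by blast
  define s where "s = (\<Sum>l<n. ip (v n) (q l) *\<^sub>C q l)"
  define u where "u = v n - s"
  \<comment> \<open>The default 0 is taken when \<open>v n\<close> already lies in the span of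
    \<open>q\<close>.\<close>
  define e where "e = (if u = 0 then 0 else complex_of_real (1 / nrm u) *\<^sub>C u)"
  have sS: "s \<in> S" unfolding s_def using q S by (intro csubspace_sum csubspace_scale) auto
  have uS: "u \<in> S" unfolding u_def using sS Suc.prems S by (intro csubspace_diff) auto
  have eS: "e \<in> S" unfolding e_def using uS S by (simp add: csubspace_0 csubspace_scale)
  have uV: "u \<in> V" and eV: "e \<in> V" and sV: "s \<in> V" using uS eS sS S by auto
  have uq: "ip u (q m) = 0" if "m < n" for m
    using ortho_family_ip_sum[OF q(1) that, of "\<lambda>l. ip (v n) (q l)"] vV[of n] sV qV[OF that] that q(1)
    by (auto simp: u_def ip_diff_left s_def[symmetric] ortho_family_def)
  have eq: "ip e (q m) = 0" if "m < n" for m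
    using uq[OF that] qV[OF that] uV by (simp add: e_def ip_scale_left)
  have qe: "ip (q m) e = 0" if "m < n" for m
    using eq[OF that] ip_cnj[OF eV qV[OF that]] by simp
  have e1: "e = 0 \<or> nrm e = 1"
    using uV nrm_eq_0[OF uV] nrm_nonneg[OF uV] by (simp add: e_def nrm_scale norm_divide)
  define q' where "q' = q(n := e)"
  have "ortho_family (Suc n) q'"
    using q(1) eV e1 eq qe by (auto simp: ortho_family_def q'_def less_Suc_eq)
  moreover have "q' l \<in> S" if "l < Suc n" for l
    using that q(2) eS by (auto simp: q'_def less_Suc_eq)
  moreover have "v j = (\<Sum>l<Suc n. ip (v j) (q' l) *\<^sub>C q' l)" if j: "j < Suc n" for j
  proof (cases "j = n")
    case False
    then have jn: "j < n" using j by simp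
    have "ip (v j) e = ip (\<Sum>l<n. ip (v j) (q l) *\<^sub>C q l) e" using q(3) jn by metis
    also have "\<dots> = 0" using qV eV qe by (subst ip_sum_left) (auto simp: ip_scale_left)
    finally show ?thesis using q(3) jn by (simp add: q'_def)
  next
    case True
    have su: "ip s e = 0" unfolding s_def using qV eV qe by (subst ip_sum_left) (auto simp: ip_scale_left)
    \<comment> \<open>\<open>e\<close> is orthogonal to \<open>s\<close>, so the last coefficient
      sees only the residual \<open>u\<close>, which \<open>e\<close> reproduces with coefficient
      \<open>nrm u\<close>.\<close>
    have "ip (v n) e *\<^sub>C e = ip u e *\<^sub>C e"
      using su sV eV vV[of n] by (simp add: u_def ip_diff_left)
    also have "\<dots> = u"
    proof (cases "u = 0")
      case False
      then have "nrm u \<noteq> 0" using nrm_eq_0[OF uV] by simp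
      then show ?thesis using False uV
        by (simp add: e_def ip_scale_right ip_self scaleC_scaleC power2_eq_square scaleC_one)
    qed (simp add: e_def)
    finally show ?thesis using True by (simp add: q'_def u_def s_def)
  qed
  ultimately have "ortho_family (Suc n) q' \<and> (\<forall>l<Suc n. q' l \<in> S) \<and>
      (\<forall>j<Suc n. v j = (\<Sum>l<Suc n. ip (v j) (q' l) *\<^sub>C q' l))" by simp
  then show ?case by - (rule exI[of _ q'])
qed

text \<open>Parseval for vectors of the span: the expansion gives one inequality and Bessel the
  other, so zero members of the family do no harm.\<close>

lemma gram_schmidt_nrm:
  assumes q: "ortho_family n q" and v: "v = (\<Sum>l<n. ip v (q l) *\<^sub>C q l)"
  shows "nrm v = L2_set (\<lambda>l. cmod (ip v (q l))) {..<n}"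
proof (rule antisym)
  have "nrm (\<Sum>l<n. ip v (q l) *\<^sub>C q l) \<le> L2_set (\<lambda>l. cmod (ip v (q l))) {..<n}"
    by (rule ortho_family_nrm_sum_le[OF q])
  \<comment> \<open>\<open>back_subst\<close> replaces one outer occurrence only; rewriting with
    \<open>v\<close> would loop, as \<open>v\<close> occurs in its own expansion.\<close>
  then show "nrm v \<le> L2_set (\<lambda>l. cmod (ip v (q l))) {..<n}"
    by (rule back_subst[where P = "\<lambda>u. nrm u \<le> _"]) (rule v[symmetric])
  have "(\<Sum>l<n. ip v (q l) *\<^sub>C q l) \<in> V" using q by (intro sum_mem) (simp add: ortho_family_def)
  then have "v \<in> V" by (rule back_subst[where P = "\<lambda>u. u \<in> V"]) (rule v[symmetric])
  then show "L2_set (\<lambda>l. cmod (ip v (q l))) {..<n} \<le> nrm v" using bessel[OF q] by simp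
qed

end

section \<open>Hilbert spaces\<close>

locale hilbert = inner_space V ip
  for V :: "'v::complex_vector set" and ip :: "'v \<Rightarrow> 'v \<Rightarrow> complex" +
  assumes complete: "(\<And>n::nat. s n \<in> V) \<Longrightarrow>
    (\<And>e. e > 0 \<Longrightarrow> \<exists>M. \<forall>m\<ge>M. \<forall>n\<ge>M. hnorm ip (s m - s n) < e) \<Longrightarrow>
    \<exists>l\<in>V. (\<lambda>n. hnorm ip (s n - l)) \<longlonglongrightarrow> 0"

lemma hilbert_space_imp_inner_space: "hilbert_space V ip \<Longrightarrow> inner_space V ip"
  unfolding hilbert_space_def by unfold_locales blast+

lemma hilbert_space_imp_hilbert: "hilbert_space V ip \<Longrightarrow> hilbert V ip"
  unfolding hilbert_def hilbert_axioms_def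
  by (intro conjI allI impI hilbert_space_imp_inner_space) (unfold hilbert_space_def, blast+)

context hilbert
begin

text \<open>The representing vector is the limit of a minimising sequence of
  \<open>\<parallel>w\<parallel>\<^sup>2 - 2 Re \<Lambda>(w)\<close> on \<^term>\<open>S\<close>, so it lies in the closure of \<^term>\<open>S\<close>.\<close>

lemma riesz_subspace:
  fixes \<Lambda> :: "'v \<Rightarrow> complex"
  assumes S: "csubspace S" "S \<subseteq> V" and lin: "clinear_on S \<Lambda>"
    and bd: "\<And>w. w \<in> S \<Longrightarrow> cmod (\<Lambda> w) \<le> C * nrm w"
  obtains h where "h \<in> V" "\<And>w. w \<in> S \<Longrightarrow> \<Lambda> w = ip w h" "\<And>e. e > 0 \<Longrightarrow> \<exists>w\<in>S. nrm (w - h) < e"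
proof -
  have add: "\<Lambda> (u + v) = \<Lambda> u + \<Lambda> v" if "u \<in> S" "v \<in> S" for u v
    using lin that by (simp add: clinear_on_def)
  have scale: "\<Lambda> (c *\<^sub>C v) = c * \<Lambda> v" if "v \<in> S" for c v
    using lin that by (simp add: clinear_on_def scaleC_complex_def)
  have SV: "w \<in> V" if "w \<in> S" for w using S that by auto
  define J where "J w = (nrm w)\<^sup>2 - 2 * Re (\<Lambda> w)" for w
  define \<mu> where "\<mu> = Inf (J ` S)"
  have "J w \<ge> - C\<^sup>2" if "w \<in> S" for w
  proof -
    have "Re (\<Lambda> w) \<le> C * nrm w" using bd[OF that] complex_Re_le_cmod order_trans by blast
    moreover have "0 \<le> (nrm w - C)\<^sup>2" by simp
    ultimately show ?thesis by (simp add: J_def power2_diff mult.commute)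
  qed
  then have bdd: "bdd_below (J ` S)" by (auto simp: bdd_below_def)
  have ne: "J ` S \<noteq> {}" using csubspace_0[OF S(1)] by auto
  have \<mu>: "\<mu> \<le> J w" if "w \<in> S" for w unfolding \<mu>_def using bdd that by (intro cInf_lower) auto
  have "\<exists>w\<in>S. J w < \<mu> + 1 / Suc n" for n
    using cInf_lessD[OF ne, of "\<mu> + 1 / Suc n"] by (auto simp: \<mu>_def)
  then obtain s where s: "\<And>n::nat. s n \<in> S" "\<And>n. J (s n) < \<mu> + 1 / Suc n" by metis
  \<comment> \<open>Parallelogram law: the midpoint lies in \<open>S\<close>, so \<open>J\<close> is
    at least \<mu> there, and two near-minimisers must be close to each other.\<close>
  have par: "(nrm (a - b))\<^sup>2 \<le> 2 * (J a - \<mu>) + 2 * (J b - \<mu>)" if ab: "a \<in> S" "b \<in> S" for a b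
  proof -
    let ?m = "(1/2) *\<^sub>C (a + b)"
    have m: "?m \<in> S" using ab S by (simp add: csubspace_add csubspace_scale)
    have "J ?m = (nrm (a + b))\<^sup>2 / 4 - Re (\<Lambda> a) - Re (\<Lambda> b)"
      using ab SV S by (simp add: J_def nrm_scale scale add csubspace_add power_divide norm_divide
        add_divide_distrib)
    then have "4 * \<mu> \<le> (nrm (a + b))\<^sup>2 - 4 * Re (\<Lambda> a) - 4 * Re (\<Lambda> b)" using \<mu>[OF m] by simp
    then show ?thesis
      using nrm_add_power2[OF SV[OF ab(1)] SV[OF ab(2)]] nrm_diff_power2[OF SV[OF ab(1)] SV[OF ab(2)]]
      by (simp add: J_def)
  qed
  have lim0: "(\<lambda>n. 1 / real (Suc n)) \<longlonglongrightarrow> 0" using lim_inverse_n' LIMSEQ_Suc by fastforce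
  have "\<exists>M. \<forall>m\<ge>M. \<forall>n\<ge>M. nrm (s m - s n) < e" if e: "e > 0" for e
  proof -
    have "e\<^sup>2 / 4 > 0" using e by simp
    then obtain M where M: "inverse (real (Suc M)) < e\<^sup>2 / 4" using reals_Archimedean by blast
    have small: "J (s m) - \<mu> < e\<^sup>2 / 4" if "m \<ge> M" for m
    proof -
      have "1 / real (Suc m) \<le> 1 / real (Suc M)" using that by (simp add: frac_le)
      then show ?thesis using s(2)[of m] M by (simp add: inverse_eq_divide)
    qed
    have "nrm (s m - s n) < e" if "m \<ge> M" "n \<ge> M" for m n
    proof (rule power2_less_imp_less)
      show "(nrm (s m - s n))\<^sup>2 < e\<^sup>2"
        using par[OF s(1) s(1), of m n] small[OF that(1)] small[OF that(2)] by simp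
    qed (use e in simp)
    then show ?thesis by blast
  qed
  then obtain h where h: "h \<in> V" and lim: "(\<lambda>n. nrm (s n - h)) \<longlonglongrightarrow> 0"
    using complete[of s] s(1) SV by blast
  have re: "Re (\<Lambda> w) = Re (ip w h)" if w: "w \<in> S" for w
  proof -
    define d where "d = Re (ip w h) - Re (\<Lambda> w)"
    \<comment> \<open>First variation: \<open>s n\<close> minimises \<open>J\<close> on
      \<open>S\<close> up to 1/(n+1), so adding a multiple of \<open>w\<close> lowers
      \<open>J\<close> by no more than that; then n tends to infinity.\<close>
    have ge: "0 \<le> 2 * t * d + t\<^sup>2 * (nrm w)\<^sup>2" for t :: real
    proof -
      have "(\<lambda>n. ip w (s n - h)) \<longlonglongrightarrow> 0"
      proof (rule tendsto_0_le[OF lim])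
        show "\<forall>\<^sub>F n in sequentially. norm (ip w (s n - h)) \<le> norm (nrm (s n - h)) * nrm w"
          using cauchy_schwarz[OF SV[OF w] diff_mem[OF SV[OF s(1)] h]] SV[OF s(1)] h
          by (simp add: mult.commute)
      qed
      then have "(\<lambda>n. ip w (s n - h) + ip w h) \<longlonglongrightarrow> 0 + ip w h" by (intro tendsto_intros)
      then have wl: "(\<lambda>n. ip w (s n)) \<longlonglongrightarrow> ip w h"
        using SV[OF w] SV[OF s(1)] h by (simp add: ip_diff_right)
      have "- (1 / real (Suc n)) \<le> 2 * t * (Re (ip w (s n)) - Re (\<Lambda> w)) + t\<^sup>2 * (nrm w)\<^sup>2" for n
      proof -
        have tw: "of_real t *\<^sub>C w \<in> S" using w S by (simp add: csubspace_scale)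
        have "\<mu> \<le> J (s n + of_real t *\<^sub>C w)" using tw s(1) S by (intro \<mu>) (simp add: csubspace_add)
        moreover have "J (s n + of_real t *\<^sub>C w) =
            J (s n) + 2 * t * (Re (ip w (s n)) - Re (\<Lambda> w)) + t\<^sup>2 * (nrm w)\<^sup>2"
          using SV[OF w] SV[OF s(1)] w tw s(1) ip_cnj[OF SV[OF w] SV[OF s(1)], of n]
          by (simp add: J_def nrm_add_power2 add scale ip_scale_right nrm_scale power_mult_distrib
            algebra_simps)
        ultimately show ?thesis using s(2)[of n] by simp
      qed
      moreover have "(\<lambda>n. 2 * t * (Re (ip w (s n)) - Re (\<Lambda> w)) + t\<^sup>2 * (nrm w)\<^sup>2)
          \<longlonglongrightarrow> 2 * t * d + t\<^sup>2 * (nrm w)\<^sup>2" unfolding d_def by (intro tendsto_intros wl)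
      ultimately show ?thesis
        using LIMSEQ_le[OF tendsto_minus[OF lim0]] by (metis (no_types, lifting) minus_zero)
    qed
    have "d = 0"
    proof (rule ccontr)
      assume d: "d \<noteq> 0"
      \<comment> \<open>The +1 covers w = 0. For this \<open>t\<close> the quadratic expression in
        \<open>ge\<close> is at most \<open>t * d\<close>, which is negative.\<close>
      define t where "t = - d / ((nrm w)\<^sup>2 + 1)"
      have p: "(nrm w)\<^sup>2 + 1 > 0" by (simp add: add_nonneg_pos)
      have "t\<^sup>2 * (nrm w)\<^sup>2 \<le> t\<^sup>2 * ((nrm w)\<^sup>2 + 1)" by (intro mult_left_mono) auto
      also have "\<dots> = - t * d"
        using p by (simp add: t_def power2_eq_square)
      finally have "0 \<le> t * d" using ge[of t] by simp
      then have "0 \<le> - (d * d) / ((nrm w)\<^sup>2 + 1)" by (simp add: t_def)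
      then have "d * d \<le> 0" using p by (simp add: pos_divide_le_eq)
      then show False using d by (metis not_le not_real_square_gt_zero)
    qed
    then show ?thesis by (simp add: d_def)
  qed
  have "\<Lambda> w = ip w h" if w: "w \<in> S" for w
  proof (rule complex_eqI)
    \<comment> \<open>The real part at \<open>\<i> *\<^sub>C w\<close> is minus the imaginary part
      at \<open>w\<close>.\<close>
    have "\<i> *\<^sub>C w \<in> S" using w S by (simp add: csubspace_scale)
    then show "Im (\<Lambda> w) = Im (ip w h)"
      using re[of "\<i> *\<^sub>C w"] w SV[OF w] h by (simp add: scale ip_scale_left)
  qed (rule re[OF w])
  moreover have "\<exists>w\<in>S. nrm (w - h) < e" if "e > 0" for e
  proof -
    have "\<forall>\<^sub>F n in sequentially. nrm (s n - h) < e" using lim that by (rule order_tendstoD)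
    then show ?thesis using s(1) by (auto simp: eventually_sequentially)
  qed
  ultimately show ?thesis using that h by blast
qed

text \<open>The gliding hump proof of the uniform boundedness principle.\<close>

lemma uniform_boundedness:
  fixes Q :: "('v \<Rightarrow> real) set"
  assumes tri: "\<And>q u v. q \<in> Q \<Longrightarrow> u \<in> V \<Longrightarrow> v \<in> V \<Longrightarrow> q (u + v) \<le> q u + q v"
    and hom: "\<And>q c v. q \<in> Q \<Longrightarrow> v \<in> V \<Longrightarrow> q (c *\<^sub>C v) = cmod c * q v"
    and bd: "\<And>q. q \<in> Q \<Longrightarrow> \<exists>C. \<forall>v\<in>V. q v \<le> C * nrm v"
    and pw: "\<And>v. v \<in> V \<Longrightarrow> \<exists>C. \<forall>q\<in>Q. q v \<le> C"
  shows "\<exists>C. \<forall>q\<in>Q. \<forall>v\<in>V. q v \<le> C * nrm v"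
proof (rule ccontr)
  assume unb: "\<nexists>C. \<forall>q\<in>Q. \<forall>v\<in>V. q v \<le> C * nrm v"
  \<comment> \<open>The growth 4^n outweighs the shrinking (1/3)^n, and the factor 2/3 exceeds 1/2,
    the share of hump n that all later humps together can cancel.\<close>
  have "\<exists>q u B. q \<in> Q \<and> u \<in> V \<and> nrm u \<le> (1/3)^n \<and> (\<forall>v\<in>V. q v \<le> B * nrm v) \<and>
      2/3 * (1/3)^n * B \<le> q u \<and> 4^n \<le> B" for n :: nat
  proof -
    obtain q v0 where q: "q \<in> Q" and v0: "v0 \<in> V" "q v0 > 4^n * nrm v0"
      using unb by (meson not_le)
    \<comment> \<open>The best constant for \<open>q\<close>, so that some vector of the unit ball
      attains more than 2/3 of it.\<close>
    define B where "B = Sup {q v |v. v \<in> V \<and> nrm v \<le> 1}"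
    obtain C where C: "\<forall>v\<in>V. q v \<le> C * nrm v" using bd[OF q] by blast
    have q0: "q 0 = 0" using hom[OF q, of 0 0] by simp
    have bdd: "bdd_above {q v |v. v \<in> V \<and> nrm v \<le> 1}"
    proof (rule bdd_aboveI)
      fix x assume "x \<in> {q v |v. v \<in> V \<and> nrm v \<le> 1}"
      then obtain v where v: "v \<in> V" "nrm v \<le> 1" "x = q v" by blast
      then have "x \<le> C * nrm v" using C by auto
      also have "\<dots> \<le> \<bar>C\<bar> * 1" using v by (intro mult_mono) auto
      finally show "x \<le> \<bar>C\<bar>" by simp
    qed
    have B: "q v \<le> B * nrm v" if v: "v \<in> V" for v
    proof (cases "v = 0")
      case False
      then have p: "nrm v > 0" using nrm_eq_0[OF v] nrm_nonneg[OF v] by linarith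
      let ?w = "complex_of_real (1 / nrm v) *\<^sub>C v"
      have "q ?w \<le> B" unfolding B_def
        using v p by (intro cSup_upper[OF _ bdd]) (auto simp: nrm_scale norm_divide intro!: exI[of _ ?w])
      then show ?thesis using p v by (simp add: hom[OF q] norm_divide field_simps)
    qed (simp add: q0)
    have B4: "4^n < B"
    proof -
      have "4^n * nrm v0 < B * nrm v0" using v0 B[of v0] by linarith
      then show ?thesis using nrm_nonneg[OF v0(1)] by (rule mult_right_less_imp_less)
    qed
    then have Bp: "B > 0" using zero_le_power[of "4::real" n] by linarith
    then have "2/3 * B < B" by simp
    then obtain v where v: "v \<in> V" "nrm v \<le> 1" "2/3 * B < q v"
      using less_cSup_iff[OF _ bdd, of "2/3 * B"] unfolding B_def[symmetric]
      by (force intro!: exI[of _ 0])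
    let ?u = "complex_of_real ((1/3)^n) *\<^sub>C v"
    have "2/3 * (1/3)^n * B \<le> (1/3)^n * q v" using v(3) by simp
    then have "?u \<in> V \<and> nrm ?u \<le> (1/3)^n \<and> 2/3 * (1/3)^n * B \<le> q ?u"
      using v by (simp add: nrm_scale hom[OF q] norm_divide norm_power power_one_over divide_right_mono)
    then show ?thesis using q B B4 by (intro exI[of _ q] exI[of _ ?u] exI[of _ B]) auto
  qed
  then obtain q u B where q: "\<And>n::nat. q n \<in> Q" and u: "\<And>n. u n \<in> V" "\<And>n. nrm (u n) \<le> (1/3)^n"
    and B: "\<And>n v. v \<in> V \<Longrightarrow> q n v \<le> B n * nrm v" "\<And>n. 2/3 * (1/3)^n * B n \<le> q n (u n)" "\<And>n. 4^n \<le> B n"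
    by metis
  \<comment> \<open>The sign of each hump is chosen: by the triangle inequality \<open>q n\<close>
    is at least \<open>q n (u n)\<close> at one of \<open>x n + u n\<close> and
    \<open>x n - u n\<close>.\<close>
  define x where "x = rec_nat 0 (\<lambda>n y. if q n (u n) \<le> q n (y + u n) then y + u n else y - u n)"
  have x0: "x 0 = 0" and xS: "x (Suc n) = (if q n (u n) \<le> q n (x n + u n) then x n + u n else x n - u n)" for n
    by (simp_all add: x_def)
  have xV: "x n \<in> V" for n by (induction n) (auto simp: x0 xS u)
  have qx: "q n (u n) \<le> q n (x (Suc n))" for n
  proof (cases "q n (u n) \<le> q n (x n + u n)")
    case False
    have "2 * q n (u n) = q n (2 *\<^sub>C u n)" using hom[OF q u(1)] by simp
    also have "2 *\<^sub>C u n = (x n + u n) + (-1) *\<^sub>C (x n - u n)"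
      using scaleC_add_left[of 1 1 "u n"] by (simp add: scaleC_minus_left scaleC_one)
    also have "q n \<dots> \<le> q n (x n + u n) + q n ((-1) *\<^sub>C (x n - u n))"
      using q u xV by (intro tri) auto
    also have "\<dots> = q n (x n + u n) + q n (x n - u n)" using hom[OF q, of "x n - u n"] u xV by simp
    finally show ?thesis using False by (simp add: xS)
  qed (simp add: xS)
  have step: "nrm (x (Suc n) - x n) \<le> (1/3)^n" for n
    using u by (auto simp: xS nrm_minus)
  \<comment> \<open>The right side is the geometric sum of (1/3)^i over k \<le> i < m, kept exact
    for the induction.\<close>
  have tail: "nrm (x m - x k) \<le> 3/2 * ((1/3)^k - (1/3)^m)" if "k \<le> m" for m k
    using that
  proof (induction m rule: dec_induct)
    case (step m)
    have "nrm (x (Suc m) - x k) \<le> nrm (x (Suc m) - x m) + nrm (x m - x k)"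
      using nrm_triangle[of "x (Suc m) - x m" "x m - x k"] xV by simp
    then show ?case using step \<open>\<And>n. nrm (x (Suc n) - x n) \<le> (1/3)^n\<close>[of m] by simp
  qed simp
  have tail': "nrm (x m - x k) \<le> 3/2 * (1/3)^k" if "k \<le> m" for m k
    using tail[OF that] by (rule order_trans) simp
  have "\<exists>M. \<forall>m\<ge>M. \<forall>n\<ge>M. nrm (x m - x n) < e" if e: "e > 0" for e
  proof -
    obtain M where M: "(1/3::real)^M < e / 3" using real_arch_pow_inv[of "e/3" "1/3"] e by auto
    have "nrm (x m - x n) < e" if "m \<ge> M" "n \<ge> M" for m n
    proof -
      have "nrm (x m - x n) \<le> nrm (x m - x M) + nrm (x n - x M)"
        using nrm_diff_triangle[of "x m - x M" "x n - x M"] xV by simp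
      then show ?thesis using tail'[OF that(1)] tail'[OF that(2)] M by simp
    qed
    then show ?thesis by blast
  qed
  then obtain l where l: "l \<in> V" and lim: "(\<lambda>n. nrm (x n - l)) \<longlonglongrightarrow> 0" using complete[of x] xV by blast
  have xl: "nrm (x k - l) \<le> 3/2 * (1/3)^k" for k
  proof (rule LIMSEQ_le_const)
    show "(\<lambda>m. 3/2 * (1/3)^k + nrm (x m - l)) \<longlonglongrightarrow> 3/2 * (1/3)^k"
      using tendsto_add[OF tendsto_const lim] by simp
    have "nrm (x k - l) \<le> 3/2 * (1/3)^k + nrm (x m - l)" if "m \<ge> k" for m
      using nrm_diff_triangle[of "x m - l" "x m - x k"] tail'[OF that] xV l by simp
    then show "\<exists>N. \<forall>n\<ge>N. nrm (x k - l) \<le> 3/2 * (1/3)^k + nrm (x n - l)" by blast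
  qed
  obtain C where C: "\<forall>q\<in>Q. q l \<le> C" using pw[OF l] by blast
  \<comment> \<open>1/6 = 2/3 - 1/2 in units of \<open>(1/3)^n * B n\<close>: the hump contributes
    2/3, and the distance from \<open>x (Suc n)\<close> to the limit costs 3/2 * 1/3 = 1/2.\<close>
  have "1/6 * (4/3)^n \<le> C" for n
  proof -
    have Bn: "0 \<le> B n" using B(3)[of n] zero_le_power[of "4::real" n] by linarith
    have "q n (x (Suc n)) \<le> q n l + q n (x (Suc n) - l)"
      using tri[OF q l diff_mem[OF xV l]] by simp
    moreover have "q n (x (Suc n) - l) \<le> B n * (1/2 * (1/3)^n)"
      using B(1)[OF diff_mem[OF xV l], of n "Suc n"] mult_left_mono[OF xl[of "Suc n"] Bn] by simp
    ultimately have "1/6 * (1/3)^n * B n \<le> q n l" using qx[of n] B(2)[of n]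
      by (simp add: mult.assoc mult.commute[of "B n"])
    moreover have "1/6 * (1/3)^n * 4^n \<le> 1/6 * (1/3)^n * B n" using B(3)[of n] by simp
    moreover have "(1/3::real)^n * 4^n = (4/3)^n" by (simp add: power_mult_distrib[symmetric])
    ultimately show ?thesis using C q[of n] by force
  qed
  moreover obtain n where "6 * C < (4/3::real)^n" using real_arch_pow[of "4/3"] by auto
  ultimately show False by (metis (no_types, opaque_lifting) mult.commute mult_1 not_le times_divide_eq_left
    pos_divide_le_eq zero_less_numeral)
qed

end

section \<open>Norms of operator matrices\<close>

lemma sum_lessThan_add:
  "(\<Sum>j<m + n. f j) = (\<Sum>j<m. f j) + (\<Sum>j<n. f (m + j))" for m n :: nat
    and f :: "nat \<Rightarrow> 'b::comm_monoid_add"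
  by (induction n) (auto simp: add.assoc)

text \<open>The index \<open>i * p + k\<close> is the numbering of rows and columns in
  \<open>matrix_pairing\<close>.\<close>

lemma sum_lessThan_mult:
  "(\<Sum>r<n * p. f r) = (\<Sum>i<n. \<Sum>k<p. f (i * p + k))" for n p :: nat
    and f :: "nat \<Rightarrow> 'b::comm_monoid_add"
  by (induction n) (simp_all add: sum_lessThan_add add.commute[of p])

lemma L2_set_prod: "L2_set f (A \<times> B) = L2_set (\<lambda>i. L2_set (\<lambda>k. f (i, k)) B) A"
  by (simp add: L2_set_def sum_nonneg sum.cartesian_product)

lemma L2_set_swap: "L2_set (\<lambda>i. L2_set (f i) B) A = L2_set (\<lambda>k. L2_set (\<lambda>i. f i k) A) B"
  unfolding L2_set_def by (simp add: sum_nonneg) (rule sum.swap)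

lemma L2_set_scale: "c \<ge> 0 \<Longrightarrow> L2_set (\<lambda>i. c * f i) A = c * L2_set f A"
  by (rule L2_set_right_distrib[symmetric])

text \<open>A relation instead of a supremum makes sense before boundedness is known. The parameter
  \<open>\<rho>\<close>, by which an entry acts on vectors, lets one theory serve multipliers,
  complex scalars, and functionals paired with a fixed matrix.\<close>

definition op_bound ::
  "'v::comm_monoid_add set \<Rightarrow> ('v \<Rightarrow> 'v \<Rightarrow> complex) \<Rightarrow> ('a \<Rightarrow> 'v \<Rightarrow> 'v) \<Rightarrow> 'a mat \<Rightarrow> real \<Rightarrow> bool" where
  "op_bound V ip \<rho> G C \<longleftrightarrow> (\<forall>v. (\<forall>j<dim_col G. v j \<in> V) \<longrightarrow>
    L2_set (\<lambda>i. hnorm ip (\<Sum>j<dim_col G. \<rho> (G $$ (i, j)) (v j))) {..<dim_row G}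
      \<le> C * L2_set (\<lambda>j. hnorm ip (v j)) {..<dim_col G})"

definition ip_complex :: "complex \<Rightarrow> complex \<Rightarrow> complex" where
  "ip_complex z w = z * cnj w"

definition acts_linearly ::
  "'a::complex_vector set \<Rightarrow> 'v::complex_vector set \<Rightarrow> ('a \<Rightarrow> 'v \<Rightarrow> 'v) \<Rightarrow> bool" where
  "acts_linearly A V \<rho> \<longleftrightarrow> (\<forall>a\<in>A. clinear_on V (\<rho> a) \<and> (\<forall>v\<in>V. \<rho> a v \<in> V)) \<and>
    (\<forall>v\<in>V. clinear_on A (\<lambda>a. \<rho> a v))"

lemma op_boundD:
  assumes "op_bound V ip \<rho> G C" "\<And>j. j < dim_col G \<Longrightarrow> v j \<in> V"
  shows "L2_set (\<lambda>i. hnorm ip (\<Sum>j<dim_col G. \<rho> (G $$ (i, j)) (v j))) {..<dim_row G}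
      \<le> C * L2_set (\<lambda>j. hnorm ip (v j)) {..<dim_col G}"
  using assms by (simp add: op_bound_def)

lemma op_bound_mono: "op_bound V ip \<rho> G C \<Longrightarrow> C \<le> D \<Longrightarrow> op_bound V ip \<rho> G D"
  unfolding op_bound_def by (meson L2_set_nonneg mult_right_mono order_trans)

lemma elements_mat_subsetD:
  "elements_mat G \<subseteq> A \<Longrightarrow> i < dim_row G \<Longrightarrow> j < dim_col G \<Longrightarrow> G $$ (i, j) \<in> A"
  by (meson elements_matI carrier_matI subsetD)

lemma matrices_entry: "G \<in> matrices n A \<Longrightarrow> i < n \<Longrightarrow> j < n \<Longrightarrow> G $$ (i, j) \<in> A"
  unfolding matrices_def using elements_mat_subsetD[of G A i j] by auto

lemma matrices_carrier: "G \<in> matrices n A \<Longrightarrow> G \<in> carrier_mat n n"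
  by (simp add: matrices_def)

lemma matricesI: "G \<in> carrier_mat n n \<Longrightarrow> (\<And>i j. i < n \<Longrightarrow> j < n \<Longrightarrow> G $$ (i, j) \<in> A) \<Longrightarrow> G \<in> matrices n A"
  unfolding matrices_def elements_mat_def by auto

locale action = inner_space V ip
  for V :: "'v::complex_vector set" and ip :: "'v \<Rightarrow> 'v \<Rightarrow> complex" +
  fixes A :: "'a::complex_vector set" and \<rho> :: "'a \<Rightarrow> 'v \<Rightarrow> 'v"
  assumes A_subspace: "csubspace A"
    and acts_linearly: "acts_linearly A V \<rho>"
begin

lemma act_mem [simp]: "a \<in> A \<Longrightarrow> v \<in> V \<Longrightarrow> \<rho> a v \<in> V"
  and act_add_left: "a \<in> A \<Longrightarrow> b \<in> A \<Longrightarrow> v \<in> V \<Longrightarrow> \<rho> (a + b) v = \<rho> a v + \<rho> b v"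
  and act_scale_left: "a \<in> A \<Longrightarrow> v \<in> V \<Longrightarrow> \<rho> (c *\<^sub>C a) v = c *\<^sub>C \<rho> a v"
  and act_scale_right: "a \<in> A \<Longrightarrow> v \<in> V \<Longrightarrow> \<rho> a (c *\<^sub>C v) = c *\<^sub>C \<rho> a v"
  using acts_linearly by (auto simp: acts_linearly_def clinear_on_def)

lemma act_clinear: "a \<in> A \<Longrightarrow> clinear_on V (\<rho> a)"
  and act_clinear_left: "v \<in> V \<Longrightarrow> clinear_on A (\<lambda>a. \<rho> a v)"
  using acts_linearly by (auto simp: acts_linearly_def)

lemma act_zero_left [simp]: "v \<in> V \<Longrightarrow> \<rho> 0 v = 0"
  and act_zero_right [simp]: "a \<in> A \<Longrightarrow> \<rho> a 0 = 0"
  using clinear_on_0[OF A_subspace act_clinear_left] clinear_on_0[OF subspace act_clinear] by auto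

lemma act_sum_right: "a \<in> A \<Longrightarrow> (\<And>i. i \<in> I \<Longrightarrow> f i \<in> V) \<Longrightarrow> \<rho> a (\<Sum>i\<in>I. f i) = (\<Sum>i\<in>I. \<rho> a (f i))"
  by (rule clinear_on_sum[OF subspace act_clinear])

lemma act_sum_left: "v \<in> V \<Longrightarrow> (\<And>i. i \<in> I \<Longrightarrow> f i \<in> A) \<Longrightarrow> \<rho> (\<Sum>i\<in>I. f i) v = (\<Sum>i\<in>I. \<rho> (f i) v)"
  by (rule clinear_on_sum[OF A_subspace act_clinear_left])

abbreviation bnd :: "'a mat \<Rightarrow> real \<Rightarrow> bool" where "bnd \<equiv> op_bound V ip \<rho>"

definition unit_values :: "'a mat \<Rightarrow> real set" where
  "unit_values G = {L2_set (\<lambda>i. nrm (\<Sum>j<dim_col G. \<rho> (G $$ (i, j)) (v j))) {..<dim_row G} | v.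
    (\<forall>j<dim_col G. v j \<in> V) \<and> L2_set (\<lambda>j. nrm (v j)) {..<dim_col G} \<le> 1}"

lemma opmat_norm_eq_Sup: "opmat_norm V ip (map_mat \<rho> G) = Sup (unit_values G)"
  unfolding opmat_norm_def unit_values_def
  by (intro arg_cong[of _ _ Sup] Collect_cong ex_cong1 conj_cong arg_cong2[of _ _ _ _ "(=)"] refl L2_set_cong)
    simp_all

lemma unit_values_bdd_above: assumes D: "bnd G D" shows "bdd_above (unit_values G)"
proof (rule bdd_aboveI)
  fix x assume "x \<in> unit_values G"
  then obtain v where v: "\<forall>j<dim_col G. v j \<in> V" "L2_set (\<lambda>j. nrm (v j)) {..<dim_col G} \<le> 1"
    "x = L2_set (\<lambda>i. nrm (\<Sum>j<dim_col G. \<rho> (G $$ (i, j)) (v j))) {..<dim_row G}"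
    unfolding unit_values_def by blast
  have "x \<le> D * L2_set (\<lambda>j. nrm (v j)) {..<dim_col G}"
    using op_boundD[OF D, of v] v by simp
  also have "\<dots> \<le> \<bar>D\<bar> * 1" using v by (intro mult_mono) auto
  finally show "x \<le> \<bar>D\<bar>" by simp
qed

lemma unit_values_0:
  "L2_set (\<lambda>i. nrm (\<Sum>j<dim_col G. \<rho> (G $$ (i, j)) 0)) {..<dim_row G} \<in> unit_values G"
  unfolding unit_values_def by (force intro!: exI[of _ "\<lambda>_. 0"])

lemma opmat_norm_nonneg: "bnd G D \<Longrightarrow> opmat_norm V ip (map_mat \<rho> G) \<ge> 0"
  unfolding opmat_norm_eq_Sup
  by (rule order_trans[OF L2_set_nonneg cSup_upper[OF unit_values_0 unit_values_bdd_above]])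

text \<open>Homogeneity reduces arbitrary columns to the unit ball. Some bound \<open>D\<close> has
  to be supplied to make the supremum a genuine one.\<close>

lemma opmat_norm_le_iff:
  assumes G: "elements_mat G \<subseteq> A" and D: "bnd G D" and C: "C \<ge> 0"
  shows "opmat_norm V ip (map_mat \<rho> G) \<le> C \<longleftrightarrow> bnd G C"
proof -
  define E where "E v i = (\<Sum>j<dim_col G. \<rho> (G $$ (i, j)) (v j))" for v i
  have X: "unit_values G = {L2_set (\<lambda>i. nrm (E v i)) {..<dim_row G} | v.
      (\<forall>j<dim_col G. v j \<in> V) \<and> L2_set (\<lambda>j. nrm (v j)) {..<dim_col G} \<le> 1}"
    by (simp add: unit_values_def E_def)
  note GA = elements_mat_subsetD[OF G]
  have "(\<forall>x\<in>unit_values G. x \<le> C) \<longleftrightarrow> bnd G C"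
  proof
    assume le: "\<forall>x\<in>unit_values G. x \<le> C"
    show "bnd G C" unfolding op_bound_def
    proof (intro allI impI)
      fix v assume v: "\<forall>j<dim_col G. v j \<in> V"
      let ?r = "L2_set (\<lambda>j. nrm (v j)) {..<dim_col G}"
      have E: "E v i \<in> V" if "i < dim_row G" for i
        unfolding E_def using v GA that by (intro sum_mem act_mem) auto
      have "L2_set (\<lambda>i. nrm (E v i)) {..<dim_row G} \<le> C * ?r"
      \<comment> \<open>A column of norm 0 cannot be normalised; it consists of zero
        vectors.\<close>
      proof (cases "?r = 0")
        case True
        then have "v j = 0" if "j < dim_col G" for j
          using that v nrm_eq_0 by (simp add: L2_set_eq_0_iff)
        then have "E v i = 0" if "i < dim_row G" for i
          unfolding E_def using that GA by (intro sum.neutral) auto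
        then have "L2_set (\<lambda>i. nrm (E v i)) {..<dim_row G} = L2_set (\<lambda>i. 0) {..<dim_row G}"
          by (intro L2_set_cong) auto
        then show ?thesis using True by simp
      next
        case False
        then have r: "?r > 0" using L2_set_nonneg[of "\<lambda>j. nrm (v j)" "{..<dim_col G}"] by linarith
        let ?c = "complex_of_real (1 / ?r)"
        let ?w = "\<lambda>j. ?c *\<^sub>C v j"
        have c: "cmod ?c = 1 / ?r" using r by (simp only: norm_of_real) simp
        have "L2_set (\<lambda>j. nrm (?w j)) {..<dim_col G} = L2_set (\<lambda>j. 1 / ?r * nrm (v j)) {..<dim_col G}"
          using v by (intro L2_set_cong refl) (simp only: nrm_scale c lessThan_iff)
        also have "\<dots> = 1" using r by (subst L2_set_scale) auto
        finally have w1: "L2_set (\<lambda>j. nrm (?w j)) {..<dim_col G} = 1" .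
        have "E ?w i = ?c *\<^sub>C E v i" if "i < dim_row G" for i
          unfolding E_def scaleC_sum_right using that v GA
          by (intro sum.cong refl act_scale_right) auto
        then have "L2_set (\<lambda>i. nrm (E ?w i)) {..<dim_row G} = L2_set (\<lambda>i. 1 / ?r * nrm (E v i)) {..<dim_row G}"
          using E by (intro L2_set_cong refl) (simp only: nrm_scale c lessThan_iff)
        also have "\<dots> = 1 / ?r * L2_set (\<lambda>i. nrm (E v i)) {..<dim_row G}"
          using r by (subst L2_set_scale) auto
        finally have "1 / ?r * L2_set (\<lambda>i. nrm (E v i)) {..<dim_row G} =
            L2_set (\<lambda>i. nrm (E ?w i)) {..<dim_row G}" ..
        also have "\<dots> \<le> C"
          using le w1 v unfolding X by (auto intro!: exI[of _ ?w])
        finally show ?thesis using r by (simp add: pos_divide_le_eq)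
      qed
      then show "L2_set (\<lambda>i. nrm (\<Sum>j<dim_col G. \<rho> (G $$ (i, j)) (v j))) {..<dim_row G} \<le> C * ?r"
        by (simp add: E_def)
    qed
  next
    assume b: "bnd G C"
    show "\<forall>x\<in>unit_values G. x \<le> C"
    proof
      fix x assume "x \<in> unit_values G"
      then obtain v where v: "\<forall>j<dim_col G. v j \<in> V" "L2_set (\<lambda>j. nrm (v j)) {..<dim_col G} \<le> 1"
        "x = L2_set (\<lambda>i. nrm (E v i)) {..<dim_row G}" unfolding X by blast
      have "x \<le> C * L2_set (\<lambda>j. nrm (v j)) {..<dim_col G}"
        using op_boundD[OF b, of v] v by (simp add: E_def)
      also have "\<dots> \<le> C * 1" using v C by (intro mult_left_mono) auto
      finally show "x \<le> C" by simp
    qed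
  qed
  then show ?thesis unfolding opmat_norm_eq_Sup
    using cSup_le_iff[OF _ unit_values_bdd_above[OF D]] unit_values_0 by blast
qed


section \<open>Sums, multiples and entrywise estimates of operator matrices\<close>

lemma bnd_add:
  assumes G: "G \<in> matrices n A" and H: "H \<in> matrices n A" and C: "bnd G C" and D: "bnd H D"
  shows "bnd (G + H) (C + D)"
  unfolding op_bound_def
proof (intro allI impI)
  note GH = matrices_carrier[OF G] matrices_carrier[OF H]
  fix v assume "\<forall>j<dim_col (G + H). v j \<in> V"
  then have v: "v j \<in> V" if "j < n" for j using that GH by auto
  have eq: "(\<Sum>j<n. \<rho> ((G + H) $$ (i, j)) (v j)) =
      (\<Sum>j<n. \<rho> (G $$ (i, j)) (v j)) + (\<Sum>j<n. \<rho> (H $$ (i, j)) (v j))" if "i < n" for i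
    unfolding sum.distrib[symmetric] using that GH v matrices_entry[OF G] matrices_entry[OF H]
    by (intro sum.cong refl) (simp add: act_add_left)
  have "L2_set (\<lambda>i. nrm (\<Sum>j<n. \<rho> ((G + H) $$ (i, j)) (v j))) {..<n} =
    L2_set (\<lambda>i. nrm ((\<Sum>j<n. \<rho> (G $$ (i, j)) (v j)) + (\<Sum>j<n. \<rho> (H $$ (i, j)) (v j)))) {..<n}"
    by (intro L2_set_cong refl) (simp add: eq)
  also have "\<dots> \<le> L2_set (\<lambda>i. nrm (\<Sum>j<n. \<rho> (G $$ (i, j)) (v j))) {..<n} +
      L2_set (\<lambda>i. nrm (\<Sum>j<n. \<rho> (H $$ (i, j)) (v j))) {..<n}"
    using v matrices_entry[OF G] matrices_entry[OF H]
    by (intro L2_nrm_triangle sum_mem act_mem) auto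
  also have "\<dots> \<le> C * L2_set (\<lambda>j. nrm (v j)) {..<n} + D * L2_set (\<lambda>j. nrm (v j)) {..<n}"
    using op_boundD[OF C, of v] op_boundD[OF D, of v] GH v by (intro add_mono) auto
  finally show "L2_set (\<lambda>i. nrm (\<Sum>j<dim_col (G + H). \<rho> ((G + H) $$ (i, j)) (v j))) {..<dim_row (G + H)}
      \<le> (C + D) * L2_set (\<lambda>j. nrm (v j)) {..<dim_col (G + H)}"
    using GH by (simp add: distrib_right)
qed

lemma bnd_scale:
  assumes G: "G \<in> matrices n A" and C: "bnd G C"
  shows "bnd (map_mat (\<lambda>a. c *\<^sub>C a) G) (cmod c * C)"
  unfolding op_bound_def
proof (intro allI impI)
  note Gc = matrices_carrier[OF G]
  fix v assume "\<forall>j<dim_col (map_mat (\<lambda>a. c *\<^sub>C a) G). v j \<in> V"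
  then have v: "v j \<in> V" if "j < n" for j using that Gc by auto
  have eq: "nrm (\<Sum>j<n. \<rho> (map_mat (\<lambda>a. c *\<^sub>C a) G $$ (i, j)) (v j)) = cmod c * nrm (\<Sum>j<n. \<rho> (G $$ (i, j)) (v j))"
    if "i < n" for i
  proof -
    have "(\<Sum>j<n. \<rho> (map_mat (\<lambda>a. c *\<^sub>C a) G $$ (i, j)) (v j)) = c *\<^sub>C (\<Sum>j<n. \<rho> (G $$ (i, j)) (v j))"
      unfolding scaleC_sum_right using that v matrices_entry[OF G] Gc
      by (intro sum.cong refl) (simp add: act_scale_left)
    moreover have "(\<Sum>j<n. \<rho> (G $$ (i, j)) (v j)) \<in> V"
      using that v matrices_entry[OF G] by (intro sum_mem) auto
    ultimately show ?thesis by (simp add: nrm_scale)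
  qed
  have "L2_set (\<lambda>i. nrm (\<Sum>j<n. \<rho> (map_mat (\<lambda>a. c *\<^sub>C a) G $$ (i, j)) (v j))) {..<n} =
      cmod c * L2_set (\<lambda>i. nrm (\<Sum>j<n. \<rho> (G $$ (i, j)) (v j))) {..<n}"
    using eq by (subst L2_set_scale[symmetric]) (auto intro!: L2_set_cong)
  also have "\<dots> \<le> cmod c * (C * L2_set (\<lambda>j. nrm (v j)) {..<n})"
    using op_boundD[OF C, of v] Gc v by (intro mult_left_mono) auto
  finally show "L2_set (\<lambda>i. nrm (\<Sum>j<dim_col (map_mat (\<lambda>a. c *\<^sub>C a) G).
        \<rho> (map_mat (\<lambda>a. c *\<^sub>C a) G $$ (i, j)) (v j))) {..<dim_row (map_mat (\<lambda>a. c *\<^sub>C a) G)}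
      \<le> cmod c * C * L2_set (\<lambda>j. nrm (v j)) {..<dim_col (map_mat (\<lambda>a. c *\<^sub>C a) G)}"
    using Gc by (simp add: mult.assoc)
qed

text \<open>A crude bound, whose purpose is to show that matrices with bounded entries have finite
  norm.\<close>

lemma bnd_entrywise:
  assumes G: "G \<in> matrices n A"
    and c: "\<And>i j v. i < n \<Longrightarrow> j < n \<Longrightarrow> v \<in> V \<Longrightarrow> nrm (\<rho> (G $$ (i, j)) v) \<le> c i j * nrm v"
    and c0: "\<And>i j. c i j \<ge> 0"
  shows "bnd G (\<Sum>i<n. \<Sum>j<n. c i j)"
  unfolding op_bound_def
proof (intro allI impI)
  note Gc = matrices_carrier[OF G]
  fix v assume "\<forall>j<dim_col G. v j \<in> V"
  then have v: "v j \<in> V" if "j < n" for j using that Gc by auto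
  let ?r = "L2_set (\<lambda>j. nrm (v j)) {..<n}"
  have "L2_set (\<lambda>i. nrm (\<Sum>j<n. \<rho> (G $$ (i, j)) (v j))) {..<n} \<le> (\<Sum>i<n. nrm (\<Sum>j<n. \<rho> (G $$ (i, j)) (v j)))"
    using v matrices_entry[OF G] by (intro L2_set_le_sum nrm_nonneg sum_mem) auto
  also have "\<dots> \<le> (\<Sum>i<n. \<Sum>j<n. c i j * ?r)"
  proof (intro sum_mono order_trans[OF nrm_sum_le])
    fix i j assume ij: "i \<in> {..<n}" "j \<in> {..<n}"
    have "nrm (\<rho> (G $$ (i, j)) (v j)) \<le> c i j * nrm (v j)" using c ij v by simp
    also have "\<dots> \<le> c i j * ?r"
      using ij v c0 by (intro mult_left_mono member_le_L2_set) auto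
    finally show "nrm (\<rho> (G $$ (i, j)) (v j)) \<le> c i j * ?r" .
  qed (use v matrices_entry[OF G] in auto)
  finally show "L2_set (\<lambda>i. nrm (\<Sum>j<dim_col G. \<rho> (G $$ (i, j)) (v j))) {..<dim_row G}
      \<le> (\<Sum>i<n. \<Sum>j<n. c i j) * L2_set (\<lambda>j. nrm (v j)) {..<dim_col G}"
    using Gc by (simp add: sum_distrib_right)
qed

end

section \<open>Scalar matrices as operator matrices over the complex numbers\<close>

interpretation complex_ip: inner_space UNIV ip_complex
proof
  fix z :: complex assume "z \<noteq> 0"
  then show "Re (ip_complex z z) > 0"
    by (simp add: ip_complex_def complex_norm_square[symmetric] flip: of_real_power)
qed (auto simp: csubspace_def clinear_on_def ip_complex_def scaleC_complex_def algebra_simps)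

lemma hnorm_ip_complex [simp]: "hnorm ip_complex z = cmod z"
  by (simp add: hnorm_def ip_complex_def complex_norm_square[symmetric] flip: of_real_power)

interpretation complex_action: action UNIV ip_complex UNIV "(*)"
  by unfold_locales
    (auto simp: csubspace_def acts_linearly_def clinear_on_def scaleC_complex_def algebra_simps)

lemma scalar_norm_eq: "scalar_norm L = opmat_norm UNIV ip_complex (map_mat (*) L)"
  unfolding scalar_norm_def opmat_norm_def
  by (intro arg_cong[of _ _ Sup] Collect_cong ex_cong1 conj_cong arg_cong2[of _ _ _ _ "(=)"] refl L2_set_cong)
    simp_all

abbreviation scalar_bound :: "complex mat \<Rightarrow> real \<Rightarrow> bool" where
  "scalar_bound \<equiv> op_bound UNIV ip_complex (*)"

lemma scalar_bound_iff: "scalar_bound L C \<longleftrightarrow>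
  (\<forall>z. L2_set (\<lambda>i. cmod (\<Sum>j<dim_col L. L $$ (i, j) * z j)) {..<dim_row L}
      \<le> C * L2_set (\<lambda>j. cmod (z j)) {..<dim_col L})"
  by (simp add: op_bound_def)

lemma scalar_bound_ex: "scalar_bound L (\<Sum>i<dim_row L. \<Sum>j<dim_col L. cmod (L $$ (i, j)))"
  unfolding scalar_bound_iff
proof
  fix z
  let ?r = "L2_set (\<lambda>j. cmod (z j)) {..<dim_col L}"
  have "L2_set (\<lambda>i. cmod (\<Sum>j<dim_col L. L $$ (i, j) * z j)) {..<dim_row L}
      \<le> (\<Sum>i<dim_row L. cmod (\<Sum>j<dim_col L. L $$ (i, j) * z j))" by (rule L2_set_le_sum) simp
  also have "\<dots> \<le> (\<Sum>i<dim_row L. \<Sum>j<dim_col L. cmod (L $$ (i, j)) * ?r)"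
    by (intro sum_mono sum_norm_le) (auto simp: norm_mult intro!: mult_left_mono member_le_L2_set)
  finally show "L2_set (\<lambda>i. cmod (\<Sum>j<dim_col L. L $$ (i, j) * z j)) {..<dim_row L}
    \<le> (\<Sum>i<dim_row L. \<Sum>j<dim_col L. cmod (L $$ (i, j))) * ?r" by (simp add: sum_distrib_right)
qed

lemma scalar_norm_le_iff: "C \<ge> 0 \<Longrightarrow> scalar_norm L \<le> C \<longleftrightarrow> scalar_bound L C"
  unfolding scalar_norm_eq by (rule complex_action.opmat_norm_le_iff[OF _ scalar_bound_ex]) auto

lemma scalar_norm_nonneg: "scalar_norm L \<ge> 0"
  unfolding scalar_norm_eq by (rule complex_action.opmat_norm_nonneg[OF scalar_bound_ex])

lemma scalar_bound_scalar_norm: "scalar_bound L (scalar_norm L)"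
  using scalar_norm_le_iff scalar_norm_nonneg by blast

text \<open>Coordinates with respect to a Gram--Schmidt basis reduce the action of a scalar matrix on
  vectors to its action on scalars.\<close>

lemma (in inner_space) scalar_matrix_bound:
  assumes L: "scalar_bound L C" and v: "\<And>j. j < dim_col L \<Longrightarrow> v j \<in> V"
  shows "L2_set (\<lambda>i. nrm (\<Sum>j<dim_col L. L $$ (i, j) *\<^sub>C v j)) {..<dim_row L}
    \<le> C * L2_set (\<lambda>j. nrm (v j)) {..<dim_col L}"
proof (cases "dim_col L = 0")
  case False
  let ?n = "dim_col L" and ?m = "dim_row L"
  obtain q where q: "ortho_family ?n q" "\<forall>j<?n. v j = (\<Sum>l<?n. ip (v j) (q l) *\<^sub>C q l)"
    using gram_schmidt[OF subspace order_refl, of ?n v] v by blast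
  \<comment> \<open>A first column exists in this case, and testing \<open>L\<close> on the first
    unit vector shows that \<open>C\<close> is nonnegative.\<close>
  have C0: "C \<ge> 0"
  proof -
    have "0 \<le> C * L2_set (\<lambda>j. cmod (if j = 0 then 1 else 0)) {..<?n}"
      using L unfolding scalar_bound_iff by (meson L2_set_nonneg order_trans)
    moreover have "L2_set (\<lambda>j. cmod (if j = 0 then 1 else 0)) {..<?n} = 1"
    proof -
      have "L2_set (\<lambda>j. cmod (if j = 0 then 1 else 0)) {..<?n} =
          sqrt (\<Sum>j<?n. if j = 0 then 1 else 0)" unfolding L2_set_def
        by (intro arg_cong[of _ _ sqrt] sum.cong) auto
      then show ?thesis using False by simp
    qed
    ultimately show ?thesis by simp
  qed
  have "nrm (\<Sum>j<?n. L $$ (i, j) *\<^sub>C v j) \<le> L2_set (\<lambda>l. cmod (\<Sum>j<?n. L $$ (i, j) * ip (v j) (q l))) {..<?n}" for i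
  proof -
    have "(\<Sum>j<?n. L $$ (i, j) *\<^sub>C v j) = (\<Sum>j<?n. L $$ (i, j) *\<^sub>C (\<Sum>l<?n. ip (v j) (q l) *\<^sub>C q l))"
      using q(2) by (intro sum.cong refl arg_cong[of _ _ "\<lambda>u. _ *\<^sub>C u"]) auto
    also have "\<dots> = (\<Sum>l<?n. (\<Sum>j<?n. L $$ (i, j) * ip (v j) (q l)) *\<^sub>C q l)"
      unfolding scaleC_sum_right scaleC_sum_left scaleC_scaleC by (rule sum.swap)
    finally show ?thesis using ortho_family_nrm_sum_le[OF q(1)] by simp
  qed
  then have "L2_set (\<lambda>i. nrm (\<Sum>j<?n. L $$ (i, j) *\<^sub>C v j)) {..<?m}
      \<le> L2_set (\<lambda>i. L2_set (\<lambda>l. cmod (\<Sum>j<?n. L $$ (i, j) * ip (v j) (q l))) {..<?n}) {..<?m}"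
    using v by (intro L2_set_mono) (auto intro!: nrm_nonneg sum_mem)
  also have "\<dots> = L2_set (\<lambda>l. L2_set (\<lambda>i. cmod (\<Sum>j<?n. L $$ (i, j) * ip (v j) (q l))) {..<?m}) {..<?n}"
    by (rule L2_set_swap)
  \<comment> \<open>For each \<open>l\<close> the scalar bound is applied to the list of l-th
    coordinates of the \<open>v j\<close>; exchanging the two L2 norms then reassembles the
    vectors.\<close>
  also have "\<dots> \<le> L2_set (\<lambda>l. C * L2_set (\<lambda>j. cmod (ip (v j) (q l))) {..<?n}) {..<?n}"
    using L unfolding scalar_bound_iff by (intro L2_set_mono) auto
  also have "\<dots> = C * L2_set (\<lambda>j. L2_set (\<lambda>l. cmod (ip (v j) (q l))) {..<?n}) {..<?n}"
    by (simp add: L2_set_scale[OF C0] L2_set_swap[of "\<lambda>l j. cmod (ip (v j) (q l))"])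
  also have "\<dots> = C * L2_set (\<lambda>j. nrm (v j)) {..<?n}"
    using gram_schmidt_nrm[OF q(1)] q(2) by (intro arg_cong[of _ _ "(*) C"] L2_set_cong) auto
  finally show ?thesis .
qed (simp add: L2_set_def)

lemma L2_set_lessThan_add_power2:
  "(L2_set f {..<m + n})\<^sup>2 = (L2_set f {..<m})\<^sup>2 + (L2_set (\<lambda>j. f (m + j)) {..<n})\<^sup>2" for m n :: nat
  by (simp add: L2_set_power2 sum_lessThan_add)

lemma matrices_add: "csubspace A \<Longrightarrow> G \<in> matrices n A \<Longrightarrow> H \<in> matrices n A \<Longrightarrow> G + H \<in> matrices n A"
  using matrices_carrier[of G n A] matrices_carrier[of H n A]
  by (intro matricesI) (auto intro!: csubspace_add matrices_entry)

lemma matrices_map: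
  "G \<in> matrices n A \<Longrightarrow> (\<And>a. a \<in> A \<Longrightarrow> f a \<in> B) \<Longrightarrow> map_mat f G \<in> matrices n B"
  using matrices_carrier[of G n A] by (intro matricesI) (auto intro!: matrices_entry)

lemma matrices_scale:
  "csubspace A \<Longrightarrow> G \<in> matrices n A \<Longrightarrow> map_mat (\<lambda>a. c *\<^sub>C a) G \<in> matrices n A"
  by (rule matrices_map) (auto intro: csubspace_scale)

lemma matrices_zero: "csubspace A \<Longrightarrow> 0\<^sub>m n n \<in> matrices n A"
  by (intro matricesI) (auto intro: csubspace_0)

lemma direct_sum_index:
  assumes "G \<in> carrier_mat m m" "H \<in> carrier_mat n n" "i < m + n" "j < m + n"
  shows "(G \<oplus>\<^sub>m H) $$ (i, j) = (if i < m \<and> j < m then G $$ (i, j)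
    else if \<not> i < m \<and> \<not> j < m then H $$ (i - m, j - m) else 0)"
  using assms by (auto simp: direct_sum_def)

lemma direct_sum_carrier:
  "G \<in> carrier_mat m m \<Longrightarrow> H \<in> carrier_mat n n \<Longrightarrow> G \<oplus>\<^sub>m H \<in> carrier_mat (m + n) (m + n)"
  by (auto simp: direct_sum_def)

lemma matrices_direct_sum:
  assumes "csubspace A" "G \<in> matrices m A" "H \<in> matrices n A"
  shows "G \<oplus>\<^sub>m H \<in> matrices (m + n) A"
  using assms matrices_carrier
  by (intro matricesI direct_sum_carrier)
    (auto simp: direct_sum_index[OF matrices_carrier matrices_carrier] csubspace_0 intro!: matrices_entry)

lemma scalar_sandwich_carrier:
  "L \<in> carrier_mat m n \<Longrightarrow> M \<in> carrier_mat n' m' \<Longrightarrow> scalar_sandwich L G M \<in> carrier_mat m m'"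
  by (auto simp: scalar_sandwich_def)

lemma matrices_sandwich:
  assumes "csubspace A" "L \<in> carrier_mat m n" "G \<in> matrices n A" "M \<in> carrier_mat n m"
  shows "scalar_sandwich L G M \<in> matrices m A"
  using assms matrices_carrier[OF assms(3)]
  by (intro matricesI scalar_sandwich_carrier)
    (auto simp: scalar_sandwich_def intro!: csubspace_sum csubspace_scale matrices_entry)

context action
begin

text \<open>The sandwich is a composition: \<open>M\<close> acts first, then \<open>G\<close>, then
  \<open>L\<close>. On columns of vectors the scalar matrices keep their scalar bounds.\<close>

lemma bnd_sandwich:
  assumes L: "L \<in> carrier_mat m n" "scalar_bound L a" and G: "G \<in> matrices n A" "bnd G C"
    and M: "M \<in> carrier_mat n m" "scalar_bound M b" and nn: "a \<ge> 0" "C \<ge> 0"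
  shows "bnd (scalar_sandwich L G M) (a * C * b)"
  unfolding op_bound_def
proof (intro allI impI)
  note Gc = matrices_carrier[OF G(1)]
  fix v assume "\<forall>j<dim_col (scalar_sandwich L G M). v j \<in> V"
  then have v: "v j \<in> V" if "j < m" for j using that L M by (auto simp: scalar_sandwich_def)
  define w where "w l = (\<Sum>j<m. M $$ (l, j) *\<^sub>C v j)" for l
  define u where "u k = (\<Sum>l<n. \<rho> (G $$ (k, l)) (w l))" for k
  have wV: "w l \<in> V" for l unfolding w_def using v by (intro sum_mem scale_mem) auto
  have uV: "u k \<in> V" if "k < n" for k
    unfolding u_def using wV matrices_entry[OF G(1)] that by (intro sum_mem act_mem) auto
  have eq: "(\<Sum>j<m. \<rho> (scalar_sandwich L G M $$ (i, j)) (v j)) = (\<Sum>k<n. L $$ (i, k) *\<^sub>C u k)"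
    if i: "i < m" for i
  proof -
    have "\<rho> (scalar_sandwich L G M $$ (i, j)) (v j) =
        (\<Sum>k<n. \<Sum>l<n. (L $$ (i, k) * M $$ (l, j)) *\<^sub>C \<rho> (G $$ (k, l)) (v j))" if j: "j < m" for j
    proof -
      have "scalar_sandwich L G M $$ (i, j) =
          (\<Sum>k<n. \<Sum>l<n. (L $$ (i, k) * M $$ (l, j)) *\<^sub>C G $$ (k, l))"
        using i j L M Gc by (simp add: scalar_sandwich_def)
      moreover have "(\<Sum>l<n. (L $$ (i, k) * M $$ (l, j)) *\<^sub>C G $$ (k, l)) \<in> A" if "k < n" for k
        using that A_subspace matrices_entry[OF G(1)] by (intro csubspace_sum csubspace_scale) auto
      ultimately have "\<rho> (scalar_sandwich L G M $$ (i, j)) (v j) =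
          (\<Sum>k<n. \<rho> (\<Sum>l<n. (L $$ (i, k) * M $$ (l, j)) *\<^sub>C G $$ (k, l)) (v j))"
        using v[OF j] by (simp only:) (intro act_sum_left; simp)
      also have "\<dots> = (\<Sum>k<n. \<Sum>l<n. \<rho> ((L $$ (i, k) * M $$ (l, j)) *\<^sub>C G $$ (k, l)) (v j))"
        using v[OF j] A_subspace matrices_entry[OF G(1)]
        by (intro sum.cong refl act_sum_left csubspace_scale) auto
      also have "\<dots> = (\<Sum>k<n. \<Sum>l<n. (L $$ (i, k) * M $$ (l, j)) *\<^sub>C \<rho> (G $$ (k, l)) (v j))"
        using v[OF j] matrices_entry[OF G(1)] by (intro sum.cong refl act_scale_left) auto
      finally show ?thesis .
    qed
    then have "(\<Sum>j<m. \<rho> (scalar_sandwich L G M $$ (i, j)) (v j)) =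
        (\<Sum>j<m. \<Sum>k<n. \<Sum>l<n. (L $$ (i, k) * M $$ (l, j)) *\<^sub>C \<rho> (G $$ (k, l)) (v j))" by simp
    also have "\<dots> = (\<Sum>k<n. \<Sum>j<m. \<Sum>l<n. (L $$ (i, k) * M $$ (l, j)) *\<^sub>C \<rho> (G $$ (k, l)) (v j))"
      by (rule sum.swap)
    also have "\<dots> = (\<Sum>k<n. \<Sum>l<n. \<Sum>j<m. (L $$ (i, k) * M $$ (l, j)) *\<^sub>C \<rho> (G $$ (k, l)) (v j))"
      by (intro sum.cong refl sum.swap)
    also have "\<dots> = (\<Sum>k<n. L $$ (i, k) *\<^sub>C u k)"
    proof (intro sum.cong refl)
      fix k assume k: "k \<in> {..<n}"
      have "\<rho> (G $$ (k, l)) (w l) = (\<Sum>j<m. M $$ (l, j) *\<^sub>C \<rho> (G $$ (k, l)) (v j))" if "l < n" for l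
        unfolding w_def using k that v matrices_entry[OF G(1)]
        by (subst act_sum_right) (auto simp: act_scale_right)
      then show "(\<Sum>l<n. \<Sum>j<m. (L $$ (i, k) * M $$ (l, j)) *\<^sub>C \<rho> (G $$ (k, l)) (v j)) = L $$ (i, k) *\<^sub>C u k"
        by (simp add: u_def scaleC_sum_right scaleC_scaleC)
    qed
    finally show ?thesis .
  qed
  have "L2_set (\<lambda>i. nrm (\<Sum>j<m. \<rho> (scalar_sandwich L G M $$ (i, j)) (v j))) {..<m} =
      L2_set (\<lambda>i. nrm (\<Sum>k<n. L $$ (i, k) *\<^sub>C u k)) {..<m}"
    by (intro L2_set_cong refl) (simp add: eq)
  also have "\<dots> \<le> a * L2_set (\<lambda>k. nrm (u k)) {..<n}"
    using scalar_matrix_bound[OF L(2), of u] L(1) uV by simp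
  also have "\<dots> \<le> a * (C * L2_set (\<lambda>l. nrm (w l)) {..<n})"
    using op_boundD[OF G(2), of w] Gc wV nn unfolding u_def by (intro mult_left_mono) auto
  also have "\<dots> \<le> a * (C * (b * L2_set (\<lambda>j. nrm (v j)) {..<m}))"
    using scalar_matrix_bound[OF M(2), of v] M(1) v nn unfolding w_def by (intro mult_left_mono) auto
  finally show "L2_set (\<lambda>i. nrm (\<Sum>j<dim_col (scalar_sandwich L G M).
        \<rho> (scalar_sandwich L G M $$ (i, j)) (v j))) {..<dim_row (scalar_sandwich L G M)}
      \<le> a * C * b * L2_set (\<lambda>j. nrm (v j)) {..<dim_col (scalar_sandwich L G M)}"
    using scalar_sandwich_carrier[OF L(1) M(1), of G] by (simp add: mult.assoc)
qed

text \<open>Squared norms add over the two blocks; conversely, a column for one block is padded with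
  zeros. Being an equivalence for each \<open>C\<close>, it yields the maximum of the norms without
  touching suprema.\<close>

lemma bnd_direct_sum_iff:
  assumes G: "G \<in> matrices m A" and H: "H \<in> matrices n A" and C: "C \<ge> 0"
  shows "bnd (G \<oplus>\<^sub>m H) C \<longleftrightarrow> bnd G C \<and> bnd H C"
proof -
  let ?T = "\<lambda>K k v i. \<Sum>j<k. \<rho> (K $$ (i, j)) (v j)"
  let ?r = "\<lambda>k v. L2_set (\<lambda>i. nrm (v i)) {..<k}"
  note c = matrices_carrier[OF G] matrices_carrier[OF H]
  have dims: "dim_row (G \<oplus>\<^sub>m H) = m + n" "dim_col (G \<oplus>\<^sub>m H) = m + n"
    "dim_row G = m" "dim_col G = m" "dim_row H = n" "dim_col H = n"
    using c direct_sum_carrier[OF c] by auto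
  have T1: "?T (G \<oplus>\<^sub>m H) (m + n) v i = ?T G m v i" if "i < m" "\<And>j. j < m + n \<Longrightarrow> v j \<in> V" for v i
    using that c by (simp add: sum_lessThan_add direct_sum_index)
  have T2: "?T (G \<oplus>\<^sub>m H) (m + n) v (m + i) = ?T H n (\<lambda>j. v (m + j)) i"
    if "i < n" "\<And>j. j < m + n \<Longrightarrow> v j \<in> V" for v i
    using that c by (simp add: sum_lessThan_add direct_sum_index)
  have split: "(?r (m + n) (?T (G \<oplus>\<^sub>m H) (m + n) v))\<^sup>2 =
      (?r m (?T G m v))\<^sup>2 + (?r n (?T H n (\<lambda>j. v (m + j))))\<^sup>2" if "\<And>j. j < m + n \<Longrightarrow> v j \<in> V" for v
    unfolding L2_set_lessThan_add_power2 using that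
    by (intro arg_cong2[of _ _ _ _ "(+)"] arg_cong[of _ _ "\<lambda>x. x\<^sup>2"] L2_set_cong refl)
      (simp_all only: T1 T2 lessThan_iff)
  show ?thesis
  proof (intro iffI conjI)
    assume b: "bnd G C \<and> bnd H C"
    show "bnd (G \<oplus>\<^sub>m H) C" unfolding op_bound_def dims
    proof (intro allI impI)
      fix v assume v: "\<forall>j<m + n. v j \<in> V"
      have "?r m (?T G m v) \<le> C * ?r m v" "?r n (?T H n (\<lambda>j. v (m + j))) \<le> C * ?r n (\<lambda>j. v (m + j))"
        using b v op_boundD[of V ip \<rho> G C v] op_boundD[of V ip \<rho> H C "\<lambda>j. v (m + j)"] by (auto simp: dims)
      then have "(?r m (?T G m v))\<^sup>2 + (?r n (?T H n (\<lambda>j. v (m + j))))\<^sup>2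
          \<le> (C * ?r m v)\<^sup>2 + (C * ?r n (\<lambda>j. v (m + j)))\<^sup>2"
        by (intro add_mono power_mono) auto
      also have "\<dots> = (C * ?r (m + n) v)\<^sup>2"
        by (simp add: power_mult_distrib L2_set_lessThan_add_power2 distrib_left)
      finally have "(?r (m + n) (?T (G \<oplus>\<^sub>m H) (m + n) v))\<^sup>2 \<le> (C * ?r (m + n) v)\<^sup>2"
        using v by (simp only: split)
      then show "?r (m + n) (?T (G \<oplus>\<^sub>m H) (m + n) v) \<le> C * ?r (m + n) v"
        by (rule power2_le_imp_le) (use C in simp)
    qed
  next
    assume b: "bnd (G \<oplus>\<^sub>m H) C"
    have b': "?r m (?T G m v) \<le> C * ?r (m + n) v \<and> ?r n (?T H n (\<lambda>j. v (m + j))) \<le> C * ?r (m + n) v"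
      if v: "\<And>j. j < m + n \<Longrightarrow> v j \<in> V" for v
    proof -
      have "(?r (m + n) (?T (G \<oplus>\<^sub>m H) (m + n) v))\<^sup>2 \<le> (C * ?r (m + n) v)\<^sup>2"
        using op_boundD[OF b, of v] v by (intro power_mono) (auto simp: dims)
      then have "(?r m (?T G m v))\<^sup>2 + (?r n (?T H n (\<lambda>j. v (m + j))))\<^sup>2 \<le> (C * ?r (m + n) v)\<^sup>2"
        using v by (simp only: split)
      then have "(?r m (?T G m v))\<^sup>2 \<le> (C * ?r (m + n) v)\<^sup>2"
        "(?r n (?T H n (\<lambda>j. v (m + j))))\<^sup>2 \<le> (C * ?r (m + n) v)\<^sup>2"
        by (auto intro: order_trans[rotated])
      then show ?thesis using C by (intro conjI; elim power2_le_imp_le) simp_all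
    qed
    show "bnd G C" unfolding op_bound_def dims
    proof (intro allI impI)
      fix v assume v: "\<forall>j<m. v j \<in> V"
      define w where "w j = (if j < m then v j else 0)" for j
      have "?r m (?T G m w) \<le> C * ?r (m + n) w" using b'[of w] v by (auto simp: w_def)
      moreover have "?r (m + n) w = ?r m v"
        by (simp add: L2_set_def sum_lessThan_add w_def)
      ultimately show "?r m (?T G m v) \<le> C * ?r m v" by (simp add: w_def)
    qed
    show "bnd H C" unfolding op_bound_def dims
    proof (intro allI impI)
      fix v assume v: "\<forall>j<n. v j \<in> V"
      define w where "w j = (if j < m then 0 else v (j - m))" for j
      have "?r n (?T H n (\<lambda>j. w (m + j))) \<le> C * ?r (m + n) w" using b'[of w] v by (auto simp: w_def)
      moreover have "?r (m + n) w = ?r n v"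
        by (simp add: L2_set_def sum_lessThan_add w_def)
      ultimately show "?r n (?T H n v) \<le> C * ?r n v" by (simp add: w_def)
    qed
  qed
qed

lemma bnd_entry:
  assumes G: "G \<in> matrices n A" and C: "bnd G C" and ij: "i < n" "j < n" and v: "v \<in> V"
  shows "nrm (\<rho> (G $$ (i, j)) v) \<le> C * nrm v"
proof -
  note Gc = matrices_carrier[OF G]
  define w where "w l = (if l = j then v else 0)" for l
  have w: "w l \<in> V" for l using v by (simp add: w_def)
  have "(\<Sum>l<n. \<rho> (G $$ (k, l)) (w l)) = \<rho> (G $$ (k, j)) v" if "k < n" for k
  proof -
    have "(\<Sum>l<n. \<rho> (G $$ (k, l)) (w l)) = (\<Sum>l<n. if l = j then \<rho> (G $$ (k, j)) v else 0)"
      using that matrices_entry[OF G] by (intro sum.cong) (auto simp: w_def)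
    then show ?thesis using ij by simp
  qed
  then have "nrm (\<rho> (G $$ (i, j)) v) = nrm (\<Sum>l<n. \<rho> (G $$ (i, l)) (w l))" using ij by simp
  also have "\<dots> \<le> L2_set (\<lambda>i. nrm (\<Sum>l<n. \<rho> (G $$ (i, l)) (w l))) {..<n}"
    using ij w matrices_entry[OF G]
    by (intro member_le_L2_set[where f = "\<lambda>i. nrm (\<Sum>l<n. \<rho> (G $$ (i, l)) (w l))"]) auto
  also have "\<dots> \<le> C * L2_set (\<lambda>l. nrm (w l)) {..<n}"
    using op_boundD[OF C, of w] w Gc by simp
  also have "L2_set (\<lambda>l. nrm (w l)) {..<n} = nrm v"
  proof -
    have "L2_set (\<lambda>l. nrm (w l)) {..<n} = sqrt (\<Sum>l<n. if l = j then (nrm v)\<^sup>2 else 0)"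
      unfolding L2_set_def by (intro arg_cong[of _ _ sqrt] sum.cong) (auto simp: w_def)
    then show ?thesis using ij v by simp
  qed
  finally show ?thesis .
qed

lemma bnd_zero: "bnd (0\<^sub>m n n) 0"
proof -
  have "L2_set (\<lambda>i. nrm (\<Sum>j<n. \<rho> (0\<^sub>m n n $$ (i, j)) (v j))) {..<n} = L2_set (\<lambda>i. 0) {..<n}"
    if "\<forall>j<n. v j \<in> V" for v using that by (intro L2_set_cong) auto
  then show ?thesis by (simp add: op_bound_def)
qed

end

text \<open>An upper bound of \<open>N G\<close> is a common bound for all actions, so the axioms
  can be checked in each action separately, and \<open>faithful\<close> supplies definiteness. A
  single action covers the multiplier norm; a family indexed by the unit balls of all matrix levels
  covers dual norms.\<close>

lemma operator_space_of_actions: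
  fixes W :: "'i \<Rightarrow> 'v::complex_vector set" and A :: "'a::complex_vector set"
  assumes A: "csubspace A" and act: "\<And>i. i \<in> I \<Longrightarrow> action (W i) (ip i) A (\<rho> i)"
    and nn: "\<And>n G. n > 0 \<Longrightarrow> G \<in> matrices n A \<Longrightarrow> N G \<ge> 0"
    and le: "\<And>n G C. n > 0 \<Longrightarrow> G \<in> matrices n A \<Longrightarrow> C \<ge> 0 \<Longrightarrow>
      N G \<le> C \<longleftrightarrow> (\<forall>i\<in>I. op_bound (W i) (ip i) (\<rho> i) G C)"
    and faithful: "\<And>a. a \<in> A \<Longrightarrow> (\<And>i v. i \<in> I \<Longrightarrow> v \<in> W i \<Longrightarrow> \<rho> i a v = 0) \<Longrightarrow> a = 0"
  shows "operator_space A N"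
proof -
  have b: "op_bound (W i) (ip i) (\<rho> i) G (N G)" if "n > 0" "G \<in> matrices n A" "i \<in> I" for n G i
    using le[OF that(1,2) nn[OF that(1,2)]] that(3) by simp
  have zero: "N G = 0 \<longleftrightarrow> G = 0\<^sub>m n n" if n: "n > 0" and G: "G \<in> matrices n A" for n G
  proof
    assume N0: "N G = 0"
    have "G $$ (k, l) = 0" if kl: "k < n" "l < n" for k l
    proof (rule faithful)
      fix i v assume i: "i \<in> I" and v: "v \<in> W i"
      interpret action "W i" "ip i" A "\<rho> i" using act[OF i] .
      have "nrm (\<rho> i (G $$ (k, l)) v) \<le> 0"
        using bnd_entry[OF G b[OF n G i] kl v] N0 by simp
      moreover have m: "\<rho> i (G $$ (k, l)) v \<in> W i" using matrices_entry[OF G kl] v by simp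
      ultimately show "\<rho> i (G $$ (k, l)) v = 0" using nrm_eq_0[OF m] nrm_nonneg[OF m] by simp
    qed (rule matrices_entry[OF G kl])
    then show "G = 0\<^sub>m n n" using matrices_carrier[OF G] by (intro eq_matI) auto
  next
    assume "G = 0\<^sub>m n n"
    then have "N G \<le> 0" using le[OF n G] act action.bnd_zero by fastforce
    then show "N G = 0" using nn[OF n G] by simp
  qed
  have scale_le: "N (map_mat (\<lambda>a. c *\<^sub>C a) G) \<le> cmod c * N G"
    if n: "n > 0" and G: "G \<in> matrices n A" for n G c
    using le[OF n matrices_scale[OF A G], of "cmod c * N G" c] nn[OF n G]
      action.bnd_scale[OF act G b[OF n G]] by auto
  have scale: "N (map_mat (\<lambda>a. c *\<^sub>C a) G) = cmod c * N G"
    if n: "n > 0" and G: "G \<in> matrices n A" for n G c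
  proof (cases "c = 0")
    case True
    have "N (map_mat (\<lambda>a. c *\<^sub>C a) G) \<le> 0" using scale_le[OF n G, of c] True by simp
    then show ?thesis using nn[OF n matrices_scale[OF A G], of c] True by simp
  next
    case False
    \<comment> \<open>The reverse inequality is the one already proved, for the factor 1/c and the
      scaled matrix.\<close>
    have "map_mat (\<lambda>a. (1 / c) *\<^sub>C a) (map_mat (\<lambda>a. c *\<^sub>C a) G) = G"
      using False by (intro eq_matI) (auto simp: scaleC_scaleC scaleC_one)
    then have "N G \<le> cmod (1 / c) * N (map_mat (\<lambda>a. c *\<^sub>C a) G)"
      using scale_le[OF n matrices_scale[OF A G], of "1 / c" c] by simp
    then have "cmod c * N G \<le> N (map_mat (\<lambda>a. c *\<^sub>C a) G)"
      using False by (simp add: norm_divide field_simps)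
    then show ?thesis using scale_le[OF n G, of c] by simp
  qed
  have tri: "N (G + H) \<le> N G + N H" if n: "n > 0" and G: "G \<in> matrices n A" and H: "H \<in> matrices n A" for n G H
    using le[OF n matrices_add[OF A G H], of "N G + N H"] nn[OF n G] nn[OF n H]
      action.bnd_add[OF act G H b[OF n G] b[OF n H]] by auto
  have sand: "N (scalar_sandwich L G M) \<le> scalar_norm L * N G * scalar_norm M"
    if m: "m > 0" and n: "n > 0" and L: "L \<in> carrier_mat m n" and G: "G \<in> matrices n A"
      and M: "M \<in> carrier_mat n m" for m n L G M
    using le[OF m matrices_sandwich[OF A L G M], of "scalar_norm L * N G * scalar_norm M"] nn[OF n G]
      scalar_norm_nonneg[of L] scalar_norm_nonneg[of M]
      action.bnd_sandwich[OF act L scalar_bound_scalar_norm G b[OF n G] M scalar_bound_scalar_norm]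
    by auto
  have sum: "N (G \<oplus>\<^sub>m H) = max (N G) (N H)"
    if m: "m > 0" and n: "n > 0" and G: "G \<in> matrices m A" and H: "H \<in> matrices n A" for m n G H
  proof -
    have GH: "G \<oplus>\<^sub>m H \<in> matrices (m + n) A" by (rule matrices_direct_sum[OF A G H])
    have mn: "m + n > 0" using m by simp
    \<comment> \<open>Two nonnegative numbers with the same nonnegative upper bounds are
      equal.\<close>
    have "N (G \<oplus>\<^sub>m H) \<le> C \<longleftrightarrow> max (N G) (N H) \<le> C" if C: "C \<ge> 0" for C
      using le[OF mn GH C] le[OF m G C] le[OF n H C] action.bnd_direct_sum_iff[OF act G H C] by auto
    then show ?thesis using nn[OF mn GH] nn[OF m G] by (intro antisym) force+
  qed
  show ?thesis unfolding operator_space_def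
    by (intro conjI allI impI ballI; (rule A nn zero tri scale sand sum; assumption))
qed

section \<open>Duals of operator spaces\<close>

lemma sum_fun_apply: "(\<Sum>j\<in>J. f j) k = (\<Sum>j\<in>J. f j k)"
  by (induction J rule: infinite_finite_induct) auto

lemma L2_set_lessThan_mult:
  "L2_set f {..<n * p} = L2_set (\<lambda>i. L2_set (\<lambda>k. f (i * p + k)) {..<p}) {..<n}" for n p :: nat
  by (simp add: L2_set_def sum_nonneg sum_lessThan_mult)

text \<open>The bound on the pairing matrix, tested on doubly indexed vectors: an estimate on a
  tensor product without the flattening by \<open>div\<close> and \<open>mod\<close>.\<close>

definition pairing_bound :: "('a \<Rightarrow> complex) mat \<Rightarrow> 'a mat \<Rightarrow> real \<Rightarrow> bool" where
  "pairing_bound \<Phi> G C \<longleftrightarrow> (\<forall>z :: nat \<Rightarrow> nat \<Rightarrow> complex.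
    L2_set (\<lambda>i. L2_set (\<lambda>k. cmod (\<Sum>j<dim_col \<Phi>. \<Sum>l<dim_col G. (\<Phi> $$ (i, j)) (G $$ (k, l)) * z j l))
        {..<dim_row G}) {..<dim_row \<Phi>}
      \<le> C * L2_set (\<lambda>j. L2_set (\<lambda>l. cmod (z j l)) {..<dim_col G}) {..<dim_col \<Phi>})"

lemma scalar_norm_pairing_le_iff:
  assumes C: "C \<ge> 0"
  shows "scalar_norm (matrix_pairing \<Phi> G) \<le> C \<longleftrightarrow> pairing_bound \<Phi> G C"
proof -
  let ?n = "dim_row \<Phi>" and ?m = "dim_col \<Phi>" and ?p = "dim_row G" and ?q = "dim_col G"
  let ?lhs = "\<lambda>z :: nat \<Rightarrow> nat \<Rightarrow> complex.
    L2_set (\<lambda>i. L2_set (\<lambda>k. cmod (\<Sum>j<?m. \<Sum>l<?q. (\<Phi> $$ (i, j)) (G $$ (k, l)) * z j l)) {..<?p}) {..<?n}"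
  let ?rhs = "\<lambda>z :: nat \<Rightarrow> nat \<Rightarrow> complex. L2_set (\<lambda>j. L2_set (\<lambda>l. cmod (z j l)) {..<?q}) {..<?m}"
  have dims: "dim_row (matrix_pairing \<Phi> G) = ?n * ?p" "dim_col (matrix_pairing \<Phi> G) = ?m * ?q"
    by (simp_all add: matrix_pairing_def)
  have idx: "i * p + k < n * p" if "i < n" "k < p" for i k n p :: nat
  proof -
    have "i * p + k < Suc i * p" using that by simp
    also have "\<dots> \<le> n * p" using that by (intro mult_le_mono1) simp
    finally show ?thesis .
  qed
  have entry: "matrix_pairing \<Phi> G $$ (i * ?p + k, j * ?q + l) = (\<Phi> $$ (i, j)) (G $$ (k, l))"
    if "i < ?n" "k < ?p" "j < ?m" "l < ?q" for i j k l
    using that idx[of i ?n k ?p] idx[of j ?m l ?q] by (simp add: matrix_pairing_def)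
  have lhs: "L2_set (\<lambda>i. cmod (\<Sum>j<?m * ?q. matrix_pairing \<Phi> G $$ (i, j) * z j)) {..<?n * ?p} =
      ?lhs (\<lambda>j l. z (j * ?q + l))" for z
    unfolding L2_set_lessThan_mult sum_lessThan_mult
    by (intro L2_set_cong refl arg_cong[of _ _ cmod] sum.cong) (simp add: entry)
  have rhs: "L2_set (\<lambda>j. cmod (z j)) {..<?m * ?q} = ?rhs (\<lambda>j l. z (j * ?q + l))" for z
    by (rule L2_set_lessThan_mult)
  have "scalar_norm (matrix_pairing \<Phi> G) \<le> C \<longleftrightarrow>
      (\<forall>z. ?lhs (\<lambda>j l. z (j * ?q + l)) \<le> C * ?rhs (\<lambda>j l. z (j * ?q + l)))"
    unfolding scalar_norm_le_iff[OF C] scalar_bound_iff dims lhs rhs ..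
  also have "\<dots> \<longleftrightarrow> (\<forall>z. ?lhs z \<le> C * ?rhs z)"
  proof (intro iffI allI)
    fix z :: "nat \<Rightarrow> nat \<Rightarrow> complex"
    assume *: "\<forall>z. ?lhs (\<lambda>j l. z (j * ?q + l)) \<le> C * ?rhs (\<lambda>j l. z (j * ?q + l))"
    \<comment> \<open>The flattening of \<open>z\<close>. Values with second index beyond
      \<open>?q\<close> are dropped, and no sum reaches them.\<close>
    define z' where "z' r = z (r div ?q) (r mod ?q)" for r
    have z': "z' (j * ?q + l) = z j l" if "l < ?q" for j l using that by (simp add: z'_def)
    have "?lhs (\<lambda>j l. z' (j * ?q + l)) = ?lhs z"
      by (intro L2_set_cong refl arg_cong[of _ _ cmod] sum.cong) (simp add: z')
    moreover have "?rhs (\<lambda>j l. z' (j * ?q + l)) = ?rhs z"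
      by (intro L2_set_cong refl) (simp add: z')
    ultimately show "?lhs z \<le> C * ?rhs z" using *[rule_format, of z'] by (simp only:)
  next
    fix z :: "nat \<Rightarrow> complex"
    assume "\<forall>z. ?lhs z \<le> C * ?rhs z"
    then show "?lhs (\<lambda>j l. z (j * ?q + l)) \<le> C * ?rhs (\<lambda>j l. z (j * ?q + l))" by (rule spec)
  qed
  finally show ?thesis by (simp only: pairing_bound_def)
qed

text \<open>Exchanging the two tensor factors preserves all L2 norms. With \<open>T\<close> sending
  an element to its evaluation functional, pairings of functionals on a predual become pairings of
  its elements with the original matrix.\<close>

lemma pairing_bound_flip:
  assumes "\<And>i j k l. i < dim_row G \<Longrightarrow> j < dim_col G \<Longrightarrow> k < dim_row \<Phi> \<Longrightarrow> l < dim_col \<Phi> \<Longrightarrow>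
    T (G $$ (i, j)) (\<Phi> $$ (k, l)) = (\<Phi> $$ (k, l)) (G $$ (i, j))"
  shows "pairing_bound (map_mat T G) \<Phi> C \<longleftrightarrow> pairing_bound \<Phi> G C"
proof -
  let ?n = "dim_row \<Phi>" and ?m = "dim_col \<Phi>" and ?p = "dim_row G" and ?q = "dim_col G"
  have l: "L2_set (\<lambda>i. L2_set (\<lambda>k. cmod (\<Sum>j<?q. \<Sum>l<?m. (map_mat T G $$ (i, j)) (\<Phi> $$ (k, l)) * z j l)) {..<?n}) {..<?p} =
    L2_set (\<lambda>i. L2_set (\<lambda>k. cmod (\<Sum>j<?m. \<Sum>l<?q. (\<Phi> $$ (i, j)) (G $$ (k, l)) * z l j)) {..<?p}) {..<?n}" for z
  proof -
    have "(\<Sum>j<?q. \<Sum>l<?m. (map_mat T G $$ (i, j)) (\<Phi> $$ (k, l)) * z j l) =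
        (\<Sum>j<?m. \<Sum>l<?q. (\<Phi> $$ (k, j)) (G $$ (i, l)) * z l j)" if "i < ?p" "k < ?n" for i k
      by (subst sum.swap) (use that assms in \<open>intro sum.cong refl, simp\<close>)
    then have "L2_set (\<lambda>i. L2_set (\<lambda>k. cmod (\<Sum>j<?q. \<Sum>l<?m. (map_mat T G $$ (i, j)) (\<Phi> $$ (k, l)) * z j l)) {..<?n}) {..<?p} =
      L2_set (\<lambda>i. L2_set (\<lambda>k. cmod (\<Sum>j<?m. \<Sum>l<?q. (\<Phi> $$ (k, j)) (G $$ (i, l)) * z l j)) {..<?n}) {..<?p}"
      by (intro L2_set_cong refl arg_cong[of _ _ cmod]) simp
    then show ?thesis by (simp only: L2_set_swap[of _ _ "{..<?n}"])
  qed
  have r: "L2_set (\<lambda>j. L2_set (\<lambda>l. cmod (z j l)) {..<?m}) {..<?q} =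
      L2_set (\<lambda>j. L2_set (\<lambda>l. cmod (z l j)) {..<?q}) {..<?m}" for z
    by (rule L2_set_swap)
  let ?P = "\<lambda>z :: nat \<Rightarrow> nat \<Rightarrow> complex.
    L2_set (\<lambda>i. L2_set (\<lambda>k. cmod (\<Sum>j<?m. \<Sum>l<?q. (\<Phi> $$ (i, j)) (G $$ (k, l)) * z j l)) {..<?p}) {..<?n}
      \<le> C * L2_set (\<lambda>j. L2_set (\<lambda>l. cmod (z j l)) {..<?q}) {..<?m}"
  have "(\<forall>z. ?P (\<lambda>j l. z l j)) \<longleftrightarrow> (\<forall>z. ?P z)"
  proof (intro iffI allI)
    fix z assume "\<forall>z. ?P (\<lambda>j l. z l j)"
    then show "?P z" by (rule spec[where x = "\<lambda>l j. z j l"])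
  next
    fix z assume "\<forall>z. ?P z"
    then show "?P (\<lambda>j l. z l j)" by (rule spec)
  qed
  then show ?thesis unfolding pairing_bound_def index_map_mat l r .
qed

lemma pairing_bound_mono: "pairing_bound \<Phi> G C \<Longrightarrow> C \<le> D \<Longrightarrow> pairing_bound \<Phi> G D"
  unfolding pairing_bound_def by (meson L2_set_nonneg mult_right_mono order_trans)

text \<open>For fixed \<open>G\<close>, a functional \<open>\<phi>\<close> acts on \<open>\<complex>\<^sup>p\<close> by the matrix \<open>\<phi>(G\<^sub>k\<^sub>l)\<close>. In this way the dual norm
  is a supremum of operator norms, so that the operator space axioms carry over.\<close>

definition cvec :: "nat \<Rightarrow> (nat \<Rightarrow> complex) set" where
  "cvec p = {z. \<forall>k\<ge>p. z k = 0}"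

definition ip_vec :: "nat \<Rightarrow> (nat \<Rightarrow> complex) \<Rightarrow> (nat \<Rightarrow> complex) \<Rightarrow> complex" where
  "ip_vec p z w = (\<Sum>k<p. z k * cnj (w k))"

definition pair_act :: "nat \<Rightarrow> 'a mat \<Rightarrow> ('a \<Rightarrow> complex) \<Rightarrow> (nat \<Rightarrow> complex) \<Rightarrow> nat \<Rightarrow> complex" where
  "pair_act p G \<phi> z = (\<lambda>k. if k < p then \<Sum>l<p. \<phi> (G $$ (k, l)) * z l else 0)"

lemma hnorm_ip_vec: "hnorm (ip_vec p) z = L2_set (\<lambda>k. cmod (z k)) {..<p}"
proof -
  have "ip_vec p z z = of_real (\<Sum>k<p. (cmod (z k))\<^sup>2)"
    unfolding ip_vec_def of_real_sum by (intro sum.cong refl) (rule complex_norm_square[symmetric, simplified of_real_power[symmetric]])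
  then show ?thesis by (simp only: hnorm_def L2_set_def Re_complex_of_real)
qed

lemma inner_space_cvec: "inner_space (cvec p) (ip_vec p)"
proof
  fix z assume z: "z \<in> cvec p" "z \<noteq> 0"
  then obtain k where k: "z k \<noteq> 0" by (auto simp: fun_eq_iff)
  then have "k < p" using z by (auto simp: cvec_def not_le[symmetric])
  then have "L2_set (\<lambda>k. cmod (z k)) {..<p} \<noteq> 0" using k by (auto simp: L2_set_eq_0_iff)
  then have "hnorm (ip_vec p) z > 0"
    using L2_set_nonneg[of "\<lambda>k. cmod (z k)" "{..<p}"] unfolding hnorm_ip_vec by linarith
  then show "Re (ip_vec p z z) > 0" by (simp add: hnorm_def)
qed (auto simp: csubspace_def cvec_def clinear_on_def ip_vec_def scaleC_fun_def scaleC_complex_def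
  algebra_simps sum.distrib sum_distrib_left)

lemma action_pair_act: "csubspace V \<Longrightarrow> action (cvec p) (ip_vec p) V (pair_act p G)"
  by (intro action.intro inner_space_cvec action_axioms.intro)
    (auto simp: acts_linearly_def clinear_on_def cvec_def pair_act_def fun_eq_iff scaleC_fun_def
      scaleC_complex_def algebra_simps sum.distrib sum_distrib_left)

lemma op_bound_pair_act_iff:
  assumes G: "G \<in> carrier_mat p p"
  shows "op_bound (cvec p) (ip_vec p) (pair_act p G) \<Phi> C \<longleftrightarrow> pairing_bound \<Phi> G C"
proof -
  let ?n = "dim_row \<Phi>" and ?m = "dim_col \<Phi>"
  let ?lhs = "\<lambda>z :: nat \<Rightarrow> nat \<Rightarrow> complex.
    L2_set (\<lambda>i. L2_set (\<lambda>k. cmod (\<Sum>j<?m. \<Sum>l<p. (\<Phi> $$ (i, j)) (G $$ (k, l)) * z j l)) {..<p}) {..<?n}"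
  let ?rhs = "\<lambda>z :: nat \<Rightarrow> nat \<Rightarrow> complex. L2_set (\<lambda>j. L2_set (\<lambda>l. cmod (z j l)) {..<p}) {..<?m}"
  have l: "L2_set (\<lambda>i. hnorm (ip_vec p) (\<Sum>j<?m. pair_act p G (\<Phi> $$ (i, j)) (z j))) {..<?n} = ?lhs z" for z
    unfolding hnorm_ip_vec
    by (intro L2_set_cong refl arg_cong[of _ _ cmod]) (simp add: sum_fun_apply pair_act_def)
  have "op_bound (cvec p) (ip_vec p) (pair_act p G) \<Phi> C \<longleftrightarrow>
      (\<forall>z. (\<forall>j<?m. z j \<in> cvec p) \<longrightarrow> ?lhs z \<le> C * ?rhs z)"
    unfolding op_bound_def l by (simp only: hnorm_ip_vec)
  also have "\<dots> \<longleftrightarrow> (\<forall>z. ?lhs z \<le> C * ?rhs z)"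
  proof (intro iffI allI impI)
    fix z :: "nat \<Rightarrow> nat \<Rightarrow> complex"
    assume *: "\<forall>z. (\<forall>j<?m. z j \<in> cvec p) \<longrightarrow> ?lhs z \<le> C * ?rhs z"
    define z' where "z' j l = (if l < p then z j l else 0)" for j l
    have "?lhs z' = ?lhs z" "?rhs z' = ?rhs z"
      by (intro L2_set_cong refl arg_cong[of _ _ cmod] sum.cong; simp add: z'_def)+
    moreover have "\<forall>j<?m. z' j \<in> cvec p" by (simp add: z'_def cvec_def)
    ultimately show "?lhs z \<le> C * ?rhs z" using *[rule_format, of z'] by simp
  qed blast
  finally show ?thesis using G by (simp add: pairing_bound_def)
qed

text \<open>The zero matrix makes the set of pairing norms nonempty and \<open>D\<close> bounds it,
  so its supremum is a genuine one.\<close>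

lemma opdual_norm_props:
  assumes zero: "0\<^sub>m 1 1 \<in> matrices 1 A" "N (0\<^sub>m 1 1) \<le> 1" and D: "D \<ge> 0"
    and bd: "\<And>m G. m > 0 \<Longrightarrow> G \<in> matrices m A \<Longrightarrow> N G \<le> 1 \<Longrightarrow> pairing_bound \<Phi> G D"
  shows opdual_norm_nonneg: "opdual_norm A N \<Phi> \<ge> 0"
    and opdual_norm_le_iff: "C \<ge> 0 \<Longrightarrow> opdual_norm A N \<Phi> \<le> C \<longleftrightarrow>
      (\<forall>m>0. \<forall>G\<in>matrices m A. N G \<le> 1 \<longrightarrow> pairing_bound \<Phi> G C)"
proof -
  let ?X = "{scalar_norm (matrix_pairing \<Phi> G) | m G. m > 0 \<and> G \<in> matrices m A \<and> N G \<le> 1}"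
  have bdd: "bdd_above ?X"
    using bd scalar_norm_pairing_le_iff[OF D] by (intro bdd_aboveI[of _ D]) blast
  have mem: "scalar_norm (matrix_pairing \<Phi> (0\<^sub>m 1 1)) \<in> ?X" using zero by (auto intro!: exI[of _ "1::nat"] exI[of _ "0\<^sub>m 1 1"])
  show "opdual_norm A N \<Phi> \<ge> 0" unfolding opdual_norm_def
    by (rule order_trans[OF scalar_norm_nonneg cSup_upper[OF mem bdd]])
  assume C: "C \<ge> 0"
  have "opdual_norm A N \<Phi> \<le> C \<longleftrightarrow> (\<forall>x\<in>?X. x \<le> C)"
    unfolding opdual_norm_def using mem by (intro cSup_le_iff[OF _ bdd]) blast
  also have "\<dots> \<longleftrightarrow> (\<forall>m>0. \<forall>G\<in>matrices m A. N G \<le> 1 \<longrightarrow> pairing_bound \<Phi> G C)"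
    unfolding scalar_norm_pairing_le_iff[OF C, symmetric] by blast
  finally show "opdual_norm A N \<Phi> \<le> C \<longleftrightarrow>
      (\<forall>m>0. \<forall>G\<in>matrices m A. N G \<le> 1 \<longrightarrow> pairing_bound \<Phi> G C)" .
qed

section \<open>Preduals as spaces of completely bounded functionals\<close>

lemma operator_space_unit_zero: assumes "operator_space A N" shows "N (0\<^sub>m 1 1) \<le> 1"
proof -
  have "csubspace A" using assms by (simp add: operator_space_def)
  from matrices_zero[OF this, of 1] have "N (0\<^sub>m 1 1) = 0"
    using assms unfolding operator_space_def by auto
  then show ?thesis by simp
qed

text \<open>\<open>V\<close> is a candidate predual inside the dual of \<open>A\<close>, normalised
  off \<open>A\<close> as in \<open>opdual\<close>. In \<open>V_cb\<close> one constant serves all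
  matrix levels, which makes the dual norm finite on matrices over \<open>V\<close>.\<close>

locale functional_space =
  fixes A :: "'a::complex_vector set" and N :: "'a mat \<Rightarrow> real" and V :: "('a \<Rightarrow> complex) set"
  assumes opspace: "operator_space A N" and V_subspace: "csubspace V"
    and V_clinear: "\<phi> \<in> V \<Longrightarrow> clinear_on A \<phi>"
    and V_off: "\<phi> \<in> V \<Longrightarrow> a \<notin> A \<Longrightarrow> \<phi> a = 0"
    and V_cb: "\<phi> \<in> V \<Longrightarrow> \<exists>c\<ge>0. \<forall>p>0. \<forall>G\<in>matrices p A. N G \<le> 1 \<longrightarrow> (\<forall>z.
      L2_set (\<lambda>k. cmod (\<Sum>l<p. \<phi> (G $$ (k, l)) * z l)) {..<p} \<le> c * L2_set (\<lambda>l. cmod (z l)) {..<p})"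
begin

lemma A_subspace: "csubspace A"
  using opspace by (simp add: operator_space_def)

lemma N_nonneg: "n > 0 \<Longrightarrow> G \<in> matrices n A \<Longrightarrow> N G \<ge> 0"
  and N_eq_0: "n > 0 \<Longrightarrow> G \<in> matrices n A \<Longrightarrow> N G = 0 \<longleftrightarrow> G = 0\<^sub>m n n"
  and N_scale: "n > 0 \<Longrightarrow> G \<in> matrices n A \<Longrightarrow> N (map_mat (\<lambda>v. c *\<^sub>C v) G) = cmod c * N G"
  using opspace by (auto simp: operator_space_def)

lemma N_unit_zero: "N (0\<^sub>m 1 1) \<le> 1"
  by (rule operator_space_unit_zero[OF opspace])

lemma mat1_matrices: "a \<in> A \<Longrightarrow> mat1 a \<in> matrices 1 A"
  by (intro matricesI) (auto simp: mat1_def)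

definition dual_norm :: "('a \<Rightarrow> complex) mat \<Rightarrow> real" where
  "dual_norm = opdual_norm A N"

lemma pairing_bound_ex:
  assumes \<Phi>: "\<Phi> \<in> matrices n V"
  shows "\<exists>D\<ge>0. \<forall>p>0. \<forall>G\<in>matrices p A. N G \<le> 1 \<longrightarrow> pairing_bound \<Phi> G D"
proof -
  have "\<forall>\<phi>\<in>V. \<exists>c\<ge>0. \<forall>p>0. \<forall>G\<in>matrices p A. N G \<le> 1 \<longrightarrow> (\<forall>z.
      L2_set (\<lambda>k. cmod (\<Sum>l<p. \<phi> (G $$ (k, l)) * z l)) {..<p} \<le> c * L2_set (\<lambda>l. cmod (z l)) {..<p})"
    by (intro ballI V_cb)
  from bchoice[OF this] obtain c where c: "\<And>\<phi>. \<phi> \<in> V \<Longrightarrow> c \<phi> \<ge> 0"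
    "\<And>\<phi> p G z. \<phi> \<in> V \<Longrightarrow> p > 0 \<Longrightarrow> G \<in> matrices p A \<Longrightarrow> N G \<le> 1 \<Longrightarrow>
      L2_set (\<lambda>k. cmod (\<Sum>l<p. \<phi> (G $$ (k, l)) * z l)) {..<p} \<le> c \<phi> * L2_set (\<lambda>l. cmod (z l)) {..<p}"
    by blast
  \<comment> \<open>The default 0 outside the range serves \<open>bnd_entrywise\<close>, which asks
    for nonnegative constants at all indices.\<close>
  let ?d = "\<lambda>i j. if i < n \<and> j < n then c (\<Phi> $$ (i, j)) else 0"
  have "pairing_bound \<Phi> G (\<Sum>i<n. \<Sum>j<n. ?d i j)" if p: "p > 0" and G: "G \<in> matrices p A" "N G \<le> 1" for p G
  proof -
    interpret action "cvec p" "ip_vec p" V "pair_act p G" by (rule action_pair_act[OF V_subspace])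
    have "op_bound (cvec p) (ip_vec p) (pair_act p G) \<Phi> (\<Sum>i<n. \<Sum>j<n. ?d i j)"
    proof (rule bnd_entrywise[OF \<Phi>])
      fix i j v assume ij: "i < n" "j < n"
      have "L2_set (\<lambda>k. cmod (pair_act p G (\<Phi> $$ (i, j)) v k)) {..<p} =
          L2_set (\<lambda>k. cmod (\<Sum>l<p. (\<Phi> $$ (i, j)) (G $$ (k, l)) * v l)) {..<p}"
        by (intro L2_set_cong refl) (simp add: pair_act_def)
      then show "hnorm (ip_vec p) (pair_act p G (\<Phi> $$ (i, j)) v) \<le> ?d i j * hnorm (ip_vec p) v"
        using c(2)[OF matrices_entry[OF \<Phi> ij] p G, of v] ij by (simp add: hnorm_ip_vec)
    qed (use c matrices_entry[OF \<Phi>] in simp)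
    then show ?thesis using op_bound_pair_act_iff[OF matrices_carrier[OF G(1)]] by simp
  qed
  moreover have "(\<Sum>i<n. \<Sum>j<n. ?d i j) \<ge> 0" using c matrices_entry[OF \<Phi>] by (intro sum_nonneg) simp
  ultimately show ?thesis by blast
qed

lemma dual_norm_nonneg: "\<Phi> \<in> matrices n V \<Longrightarrow> dual_norm \<Phi> \<ge> 0"
  using pairing_bound_ex[of \<Phi> n] opdual_norm_nonneg[where A = A and N = N, OF matrices_zero[OF A_subspace] N_unit_zero]
  unfolding dual_norm_def by metis

lemma dual_norm_le_iff:
  assumes "\<Phi> \<in> matrices n V" "C \<ge> 0"
  shows "dual_norm \<Phi> \<le> C \<longleftrightarrow> (\<forall>p>0. \<forall>G\<in>matrices p A. N G \<le> 1 \<longrightarrow> pairing_bound \<Phi> G C)"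
proof -
  obtain D where D: "D \<ge> 0" "\<And>p G. p > 0 \<Longrightarrow> G \<in> matrices p A \<Longrightarrow> N G \<le> 1 \<Longrightarrow> pairing_bound \<Phi> G D"
    using pairing_bound_ex[OF assms(1)] by blast
  show ?thesis unfolding dual_norm_def
    by (rule opdual_norm_le_iff[where A = A and N = N, OF matrices_zero[OF A_subspace] N_unit_zero D assms(2)])
qed

lemma operator_space_dual_norm: "operator_space V dual_norm"
proof -
  let ?I = "{(p, G). p > 0 \<and> G \<in> matrices p A \<and> N G \<le> 1}"
  show ?thesis
  proof (rule operator_space_of_actions[where I = ?I and W = "\<lambda>i. cvec (fst i)"
      and ip = "\<lambda>i. ip_vec (fst i)" and \<rho> = "\<lambda>i. pair_act (fst i) (snd i)"])
    show "csubspace V" by (rule V_subspace)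
    show "action (cvec (fst i)) (ip_vec (fst i)) V (pair_act (fst i) (snd i))" for i :: "nat \<times> 'a mat"
      by (rule action_pair_act[OF V_subspace])
    show "0 \<le> dual_norm G" if "G \<in> matrices n V" for n G by (rule dual_norm_nonneg[OF that])
    show "dual_norm \<Phi> \<le> C \<longleftrightarrow> (\<forall>i\<in>?I. op_bound (cvec (fst i)) (ip_vec (fst i)) (pair_act (fst i) (snd i)) \<Phi> C)"
      if "\<Phi> \<in> matrices n V" "C \<ge> 0" for n \<Phi> C
    proof -
      have "op_bound (cvec p) (ip_vec p) (pair_act p G) \<Phi> C \<longleftrightarrow> pairing_bound \<Phi> G C"
        if "G \<in> matrices p A" for p G using op_bound_pair_act_iff[OF matrices_carrier[OF that]] .
      then show ?thesis using dual_norm_le_iff[OF that] by auto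
    qed
    fix \<phi> assume \<phi>: "\<phi> \<in> V"
      and z: "\<And>i v. i \<in> ?I \<Longrightarrow> v \<in> cvec (fst i) \<Longrightarrow> pair_act (fst i) (snd i) \<phi> v = 0"
    have "\<phi> a = 0" if a: "a \<in> A" for a
    proof -
      let ?r = "N (mat1 a)"
      have r: "?r \<ge> 0" by (rule N_nonneg[OF _ mat1_matrices[OF a]]) simp
      \<comment> \<open>Scaling moves \<open>a\<close> into the unit ball; the +1 avoids dividing by
        a zero norm.\<close>
      let ?c = "complex_of_real (1 / (?r + 1))"
      have m: "map_mat (\<lambda>v. ?c *\<^sub>C v) (mat1 a) \<in> matrices 1 A"
        by (rule matrices_scale[OF A_subspace mat1_matrices[OF a]])
      have "cmod ?c = 1 / (?r + 1)" using r by (simp only: norm_of_real) simp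
      then have "N (map_mat (\<lambda>v. ?c *\<^sub>C v) (mat1 a)) \<le> 1"
        using r by (subst N_scale[OF _ mat1_matrices[OF a]]) (simp_all add: divide_le_eq)
      then have "pair_act 1 (map_mat (\<lambda>v. ?c *\<^sub>C v) (mat1 a)) \<phi> (\<lambda>k. if k = 0 then 1 else 0) 0 = 0"
        using z[of "(1, map_mat (\<lambda>v. ?c *\<^sub>C v) (mat1 a))" "\<lambda>k. if k = 0 then 1 else 0"] m
        by (simp add: cvec_def)
      then have "\<phi> (?c *\<^sub>C a) = 0" by (simp add: pair_act_def mat1_def)
      then have "?c * \<phi> a = 0" using V_clinear[OF \<phi>] a by (simp add: clinear_on_def scaleC_complex_def)
      moreover have "?c \<noteq> 0" using r by (simp only: of_real_eq_0_iff) simp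
      ultimately show ?thesis by simp
    qed
    then show "\<phi> = 0" using V_off[OF \<phi>] by (auto simp: fun_eq_iff)
  qed
qed

text \<open>The dual norm tests unit balls only, and scaling \<open>G\<close> by the inverse of its
  norm gives the rest. A matrix of norm 0 is zero, and functionals vanish on its entries.\<close>

lemma pairing_bound_dual_norm:
  assumes \<Phi>: "\<Phi> \<in> matrices n V" and p: "p > 0" and G: "G \<in> matrices p A"
  shows "pairing_bound \<Phi> G (dual_norm \<Phi> * N G)"
proof (cases "N G = 0")
  case True
  then have G0: "G = 0\<^sub>m p p" using N_eq_0[OF p G] by simp
  have "(\<Phi> $$ (i, j)) 0 = 0" if "i < n" "j < n" for i j
    using clinear_on_0[OF A_subspace V_clinear[OF matrices_entry[OF \<Phi> that]]] .
  then show ?thesis using matrices_carrier[OF \<Phi>] True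
    by (auto simp: pairing_bound_def G0 L2_set_def)
next
  case False
  let ?r = "N G"
  have r: "?r > 0" using N_nonneg[OF p G] False by simp
  let ?c = "complex_of_real (1 / ?r)"
  let ?H = "map_mat (\<lambda>v. ?c *\<^sub>C v) G"
  have H: "?H \<in> matrices p A" by (rule matrices_scale[OF A_subspace G])
  have c: "cmod ?c = 1 / ?r" using r by (simp only: norm_of_real) simp
  have "N ?H \<le> 1" using r N_scale[OF p G, of ?c] by (simp only: c) simp
  then have "pairing_bound \<Phi> ?H (dual_norm \<Phi>)"
    using dual_norm_le_iff[OF \<Phi> dual_norm_nonneg[OF \<Phi>]] p H by simp
  note * = this[unfolded pairing_bound_def, rule_format]
  have d: "dim_row G = p" "dim_col G = p" "dim_row \<Phi> = n" "dim_col \<Phi> = n"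
    using matrices_carrier[OF G] matrices_carrier[OF \<Phi>] by auto
  show ?thesis unfolding pairing_bound_def d
  proof
    fix z :: "nat \<Rightarrow> nat \<Rightarrow> complex"
    let ?S = "\<lambda>i k. \<Sum>j<n. \<Sum>l<p. (\<Phi> $$ (i, j)) (G $$ (k, l)) * z j l"
    have "(\<Sum>j<n. \<Sum>l<p. (\<Phi> $$ (i, j)) (?H $$ (k, l)) * z j l) = ?c * ?S i k" if "i < n" "k < p" for i k
      unfolding sum_distrib_left
    proof (intro sum.cong refl)
      fix j l assume "j \<in> {..<n}" "l \<in> {..<p}"
      then have "(\<Phi> $$ (i, j)) (?H $$ (k, l)) = ?c * (\<Phi> $$ (i, j)) (G $$ (k, l))"
        using V_clinear[OF matrices_entry[OF \<Phi>, of i j]] that matrices_entry[OF G, of k l] d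
        by (simp add: clinear_on_def scaleC_complex_def)
      then show "(\<Phi> $$ (i, j)) (?H $$ (k, l)) * z j l = ?c * ((\<Phi> $$ (i, j)) (G $$ (k, l)) * z j l)"
        by simp
    qed
    then have "L2_set (\<lambda>i. L2_set (\<lambda>k. cmod (\<Sum>j<n. \<Sum>l<p. (\<Phi> $$ (i, j)) (?H $$ (k, l)) * z j l)) {..<p}) {..<n}
      = L2_set (\<lambda>i. L2_set (\<lambda>k. 1 / ?r * cmod (?S i k)) {..<p}) {..<n}"
      by (intro L2_set_cong refl) (simp only: norm_mult c lessThan_iff)
    also have "\<dots> = 1 / ?r * L2_set (\<lambda>i. L2_set (\<lambda>k. cmod (?S i k)) {..<p}) {..<n}"
      using r by (simp only: L2_set_scale[of "1 / ?r"] divide_nonneg_nonneg zero_le_one less_imp_le)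
    finally have "1 / ?r * L2_set (\<lambda>i. L2_set (\<lambda>k. cmod (?S i k)) {..<p}) {..<n}
        \<le> dual_norm \<Phi> * L2_set (\<lambda>j. L2_set (\<lambda>l. cmod (z j l)) {..<p}) {..<n}"
      using *[of z] d by (simp only: index_map_mat)
    then show "L2_set (\<lambda>i. L2_set (\<lambda>k. cmod (?S i k)) {..<p}) {..<n}
        \<le> dual_norm \<Phi> * ?r * L2_set (\<lambda>j. L2_set (\<lambda>l. cmod (z j l)) {..<p}) {..<n}"
      using r by (simp add: pos_divide_le_eq mult_ac)
  qed
qed

lemma pairing_bound_unit:
  assumes \<Phi>: "\<Phi> \<in> matrices n V" "dual_norm \<Phi> \<le> 1" and p: "p > 0" and G: "G \<in> matrices p A"
  shows "pairing_bound \<Phi> G (N G)"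
  using pairing_bound_dual_norm[OF \<Phi>(1) p G]
  by (rule pairing_bound_mono) (use N_nonneg[OF p G] \<Phi>(2) mult_right_mono[of "dual_norm \<Phi>" 1] in simp)

text \<open>The canonical map into the dual of \<open>V\<close>, with the value 0 off
  \<open>V\<close> that \<open>opdual\<close> prescribes.\<close>

definition eval_map :: "'a \<Rightarrow> ('a \<Rightarrow> complex) \<Rightarrow> complex" where
  "eval_map a = (\<lambda>\<phi>. if \<phi> \<in> V then \<phi> a else 0)"

lemma eval_map_pairing_iff:
  assumes "\<Phi> \<in> matrices n V" "G \<in> matrices p A"
  shows "pairing_bound (map_mat eval_map G) \<Phi> C \<longleftrightarrow> pairing_bound \<Phi> G C"
  using assms matrices_carrier[OF assms(1)] matrices_entry[OF assms(1)]
  by (intro pairing_bound_flip) (auto simp: eval_map_def)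

lemma dual_norm_unit_zero: "dual_norm (0\<^sub>m 1 1) \<le> 1"
  by (rule operator_space_unit_zero[OF operator_space_dual_norm])

lemma dual_norm_eval_map_le_iff:
  assumes p: "p > 0" and G: "G \<in> matrices p A" and C: "C \<ge> 0"
  shows "opdual_norm V dual_norm (map_mat eval_map G) \<le> C \<longleftrightarrow>
    (\<forall>n>0. \<forall>\<Phi>\<in>matrices n V. dual_norm \<Phi> \<le> 1 \<longrightarrow> pairing_bound \<Phi> G C)"
  using opdual_norm_le_iff[where A = V and N = dual_norm, OF matrices_zero[OF V_subspace] dual_norm_unit_zero N_nonneg[OF p G] _ C,
      of "map_mat eval_map G"] pairing_bound_unit[OF _ _ p G]
  by (simp add: eval_map_pairing_iff[OF _ G])

lemma dual_norm_eval_map_le: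
  "p > 0 \<Longrightarrow> G \<in> matrices p A \<Longrightarrow> opdual_norm V dual_norm (map_mat eval_map G) \<le> N G"
  using dual_norm_eval_map_le_iff[of p G "N G"] N_nonneg[of p G] pairing_bound_unit by blast

lemma dual_norm_eval_map_nonneg:
  assumes p: "p > 0" and G: "G \<in> matrices p A"
  shows "opdual_norm V dual_norm (map_mat eval_map G) \<ge> 0"
  using opdual_norm_nonneg[where A = V and N = dual_norm, OF matrices_zero[OF V_subspace] dual_norm_unit_zero N_nonneg[OF p G],
      of "map_mat eval_map G"] pairing_bound_unit[OF _ _ p G]
  by (simp add: eval_map_pairing_iff[OF _ G])

lemma functional_bound:
  assumes \<phi>: "\<phi> \<in> V" and a: "a \<in> A"
  shows "cmod (\<phi> a) \<le> N (mat1 a) * dual_norm (mat1 \<phi>)"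
proof -
  have m: "mat1 \<phi> \<in> matrices 1 V" using \<phi> by (intro matricesI) (auto simp: mat1_def)
  have "pairing_bound (mat1 \<phi>) (mat1 a) (dual_norm (mat1 \<phi>) * N (mat1 a))"
    by (rule pairing_bound_dual_norm[OF m _ mat1_matrices[OF a]]) simp
  from this[unfolded pairing_bound_def, rule_format, of "\<lambda>_ _. 1"] show ?thesis
    by (simp add: mat1_def L2_set_def mult.commute)
qed

text \<open>The canonical map into the dual of \<open>V\<close> is completely contractive by the
  very definition of the norm on \<open>V\<close>. So complete isometry amounts to
  \<open>norming\<close>; \<open>separating\<close> gives injectivity and \<open>surj\<close>
  surjectivity.\<close>

lemma dual_operator_spaceI:
  assumes norming: "\<And>p G C. p > 0 \<Longrightarrow> G \<in> matrices p A \<Longrightarrow> C \<ge> 0 \<Longrightarrow>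
      (\<And>n \<Phi>. n > 0 \<Longrightarrow> \<Phi> \<in> matrices n V \<Longrightarrow> dual_norm \<Phi> \<le> 1 \<Longrightarrow> pairing_bound \<Phi> G C) \<Longrightarrow> N G \<le> C"
    and separating: "\<And>a b. a \<in> A \<Longrightarrow> b \<in> A \<Longrightarrow> (\<And>\<phi>. \<phi> \<in> V \<Longrightarrow> \<phi> a = \<phi> b) \<Longrightarrow> a = b"
    and surj: "\<And>\<psi>. \<psi> \<in> opdual V dual_norm \<Longrightarrow> \<exists>a\<in>A. \<forall>\<phi>\<in>V. \<psi> \<phi> = \<phi> a"
  shows "dual_operator_space A N"
proof -
  have "clinear_on A eval_map"
    unfolding clinear_on_def eval_map_def using V_clinear
    by (auto simp: fun_eq_iff clinear_on_def scaleC_fun_def scaleC_complex_def)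
  moreover have "bij_betw eval_map A (opdual V dual_norm)"
    unfolding bij_betw_def
  proof
    show "inj_on eval_map A"
    proof (rule inj_onI)
      fix a b assume ab: "a \<in> A" "b \<in> A" "eval_map a = eval_map b"
      have "\<phi> a = \<phi> b" if "\<phi> \<in> V" for \<phi> using fun_cong[OF ab(3), of \<phi>] that by (simp add: eval_map_def)
      then show "a = b" using separating ab by blast
    qed
    have "eval_map a \<in> opdual V dual_norm" if a: "a \<in> A" for a
      unfolding opdual_def using functional_bound[OF _ a] V_subspace
      by (auto simp: eval_map_def clinear_on_def csubspace_def scaleC_fun_def scaleC_complex_def)
    moreover have "\<psi> \<in> eval_map ` A" if \<psi>: "\<psi> \<in> opdual V dual_norm" for \<psi>
    proof -
      obtain a where a: "a \<in> A" "\<forall>\<phi>\<in>V. \<psi> \<phi> = \<phi> a" using surj[OF \<psi>] by blast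
      then have "\<psi> = eval_map a" using \<psi> by (auto simp: opdual_def eval_map_def fun_eq_iff)
      then show ?thesis using a by blast
    qed
    ultimately show "eval_map ` A = opdual V dual_norm" by blast
  qed
  moreover have "opdual_norm V dual_norm (map_mat eval_map G) = N G" if p: "p > 0" and G: "G \<in> matrices p A" for p G
  proof (rule antisym)
    show "N G \<le> opdual_norm V dual_norm (map_mat eval_map G)"
    proof (rule norming[OF p G])
      show "0 \<le> opdual_norm V dual_norm (map_mat eval_map G)"
        by (rule dual_norm_eval_map_nonneg[OF p G])
      then show "pairing_bound \<Phi> G (opdual_norm V dual_norm (map_mat eval_map G))"
        if "n > 0" "\<Phi> \<in> matrices n V" "dual_norm \<Phi> \<le> 1" for n \<Phi>
        using dual_norm_eval_map_le_iff[OF p G] that by blast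
    qed
  qed (rule dual_norm_eval_map_le[OF p G])
  ultimately have "complete_isometric_iso A N (opdual V dual_norm) (opdual_norm V dual_norm) eval_map"
    by (simp add: complete_isometric_iso_def)
  then show ?thesis unfolding dual_operator_space_def using operator_space_dual_norm by blast
qed

end

section \<open>Multipliers of a reproducing kernel Hilbert space\<close>

text \<open>\<open>eval_nonzero\<close> is the form in which a kernel that does not vanish on the
  diagonal is used.\<close>

locale rkhs_multipliers = hilbert \<L> ipL + H: inner_space "UNIV :: 'h set" ipH
  for \<L> :: "('x \<Rightarrow> 'h::complex_vector) set" and ipL :: "('x \<Rightarrow> 'h) \<Rightarrow> ('x \<Rightarrow> 'h) \<Rightarrow> complex"
    and ipH :: "'h \<Rightarrow> 'h \<Rightarrow> complex" +
  assumes eval_bounded: "\<exists>C. \<forall>g\<in>\<L>. hnorm ipH (g x) \<le> C * hnorm ipL g"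
    and eval_nonzero: "\<exists>g\<in>\<L>. g x \<noteq> 0"
begin

section \<open>Evaluations, kernel vectors and the density of their span\<close>

lemma eval_bound: obtains C where "C \<ge> 0" "\<And>g. g \<in> \<L> \<Longrightarrow> hnorm ipH (g x) \<le> C * nrm g"
proof -
  obtain C where C: "\<forall>g\<in>\<L>. hnorm ipH (g x) \<le> C * nrm g" using eval_bounded by blast
  have "hnorm ipH (g x) \<le> \<bar>C\<bar> * nrm g" if "g \<in> \<L>" for g
    using C that mult_right_mono[of C "\<bar>C\<bar>" "nrm g"] by fastforce
  then show ?thesis using that[of "\<bar>C\<bar>"] by simp
qed

lemma ip_eval_bound:
  obtains C where "C \<ge> 0" "\<And>g. g \<in> \<L> \<Longrightarrow> cmod (ipH (g x) e) \<le> C * nrm g"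
proof -
  obtain C where C: "C \<ge> 0" "\<And>g. g \<in> \<L> \<Longrightarrow> hnorm ipH (g x) \<le> C * nrm g" using eval_bound[where x = x] by blast
  have "cmod (ipH (g x) e) \<le> (C * hnorm ipH e) * nrm g" if "g \<in> \<L>" for g
    using H.cauchy_schwarz[of "g x" e] mult_right_mono[OF C(2)[OF that, of] H.nrm_nonneg[of e]]
    by (simp add: mult_ac)
  then show ?thesis using that[of "C * hnorm ipH e"] C by simp
qed

text \<open>Riesz on the whole space: the vector is the adjoint of evaluation at \<open>x\<close>,
  applied to \<open>e\<close>.\<close>

lemma kernel_vector_ex: "\<exists>k\<in>\<L>. \<forall>g\<in>\<L>. ipL g k = ipH (g x) e"
proof -
  obtain C where bd: "\<And>g. g \<in> \<L> \<Longrightarrow> cmod (ipH (g x) e) \<le> C * nrm g" using ip_eval_bound by blast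
  have lin: "clinear_on \<L> (\<lambda>g. ipH (g x) e)"
    by (simp add: clinear_on_def scaleC_fun_def H.ip_add_left H.ip_scale_left scaleC_complex_def)
  obtain k where "k \<in> \<L>" "\<And>g. g \<in> \<L> \<Longrightarrow> ipH (g x) e = ipL g k"
    by (rule riesz_subspace[OF subspace order_refl lin bd]) (assumption | rule that)+
  then show ?thesis by auto
qed

text \<open>\<open>xs\<close> describes \<open>w\<close> as a finite sum of kernel vectors through
  its inner products, with scalar coefficients absorbed into the vectors \<open>e\<close>. The list
  is not unique; it retains the finitely many points through which \<open>w\<close> sees a
  function.\<close>

definition represents :: "('x \<Rightarrow> 'h) \<Rightarrow> ('x \<times> 'h) list \<Rightarrow> bool" where
  "represents w xs \<longleftrightarrow> w \<in> \<L> \<and> (\<forall>g\<in>\<L>. ipL g w = (\<Sum>(x, e)\<leftarrow>xs. ipH (g x) e))"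

definition kernel_span :: "('x \<Rightarrow> 'h) set" where
  "kernel_span = {w. \<exists>xs. represents w xs}"

lemma kernel_span_subset: "kernel_span \<subseteq> \<L>"
  by (auto simp: kernel_span_def represents_def)

lemma kernel_span_mem [simp]: "w \<in> kernel_span \<Longrightarrow> w \<in> \<L>"
  using kernel_span_subset by blast

lemma kernel_vector: obtains k where "k \<in> kernel_span" "\<And>g. g \<in> \<L> \<Longrightarrow> ipL g k = ipH (g x) e"
proof -
  obtain k where k: "k \<in> \<L>" "\<forall>g\<in>\<L>. ipL g k = ipH (g x) e" using kernel_vector_ex by blast
  then have "represents k [(x, e)]" by (simp add: represents_def)
  then show ?thesis using that[of k] k by (auto simp: kernel_span_def)
qed

lemma csubspace_kernel_span: "csubspace kernel_span"
proof -
  have "represents 0 []" by (simp add: represents_def)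
  moreover have "represents (u + v) (xs @ ys)" if "represents u xs" "represents v ys" for u v xs ys
    using that by (simp add: represents_def ip_add_right)
  moreover have "represents (c *\<^sub>C u) (map (\<lambda>(x, e). (x, c *\<^sub>C e)) xs)" if "represents u xs" for c u xs
  proof -
    have "(\<Sum>(x, e)\<leftarrow>map (\<lambda>(x, e). (x, c *\<^sub>C e)) xs. ipH (g x) e) = cnj c * (\<Sum>(x, e)\<leftarrow>xs. ipH (g x) e)" for g
      by (induction xs) (auto simp: H.ip_scale_right distrib_left)
    then show ?thesis using that by (simp add: represents_def ip_scale_right)
  qed
  ultimately show ?thesis unfolding csubspace_def kernel_span_def by blast
qed

text \<open>Riesz on the span, applied to the inner product with \<open>g\<close>, gives
  \<open>h\<close> in the closure such that \<open>h - g\<close> is orthogonal to all kernel vectors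
  and hence vanishes at every point.\<close>

lemma kernel_span_dense:
  assumes g: "g \<in> \<L>" and e: "e > 0"
  shows "\<exists>w\<in>kernel_span. nrm (w - g) < e"
proof -
  have lin: "clinear_on kernel_span (\<lambda>w. ipL w g)"
    using g by (simp add: clinear_on_def ip_add_left ip_scale_left scaleC_complex_def)
  have bd: "cmod (ipL w g) \<le> nrm g * nrm w" if "w \<in> kernel_span" for w
    using cauchy_schwarz[of w g] that g by (simp add: mult.commute)
  obtain h where h: "h \<in> \<L>" "\<And>w. w \<in> kernel_span \<Longrightarrow> ipL w g = ipL w h"
      "\<And>e. e > 0 \<Longrightarrow> \<exists>w\<in>kernel_span. nrm (w - h) < e"
    by (rule riesz_subspace[OF csubspace_kernel_span kernel_span_subset lin bd]) (assumption | rule that)+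
  have "h x = g x" for x
  proof -
    \<comment> \<open>The kernel vector at x in the direction of the value itself turns
      orthogonality into \<open>ipH d d = 0\<close>.\<close>
    define d where "d = (h - g) x"
    obtain k where k: "k \<in> kernel_span" "\<And>u. u \<in> \<L> \<Longrightarrow> ipL u k = ipH (u x) d"
      using kernel_vector by blast
    have "ipL k (h - g) = 0" using h g k by (simp add: ip_diff_right)
    then have "ipL (h - g) k = 0" using ip_cnj[of k "h - g"] h g k by simp
    then have "ipH d d = 0" using k(2)[of "h - g"] h g by (simp add: d_def)
    then have "d = 0" using H.ip_pos[of d] by auto
    then show ?thesis by (simp add: d_def)
  qed
  then have "h = g" by auto
  then show ?thesis using h(3)[OF e] by simp
qed

text \<open>Density of the kernel vectors allows one to test norms against them.\<close>

lemma L2_nrm_le_kernel_span: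
  assumes u: "\<And>i. i < n \<Longrightarrow> u i \<in> \<L>" and C: "C \<ge> 0"
    and le: "\<And>w. (\<And>i. i < n \<Longrightarrow> w i \<in> kernel_span) \<Longrightarrow>
      cmod (\<Sum>i<n. ipL (u i) (w i)) \<le> C * L2_set (\<lambda>i. nrm (w i)) {..<n}"
  shows "L2_set (\<lambda>i. nrm (u i)) {..<n} \<le> C"
proof -
  let ?r = "L2_set (\<lambda>i. nrm (u i)) {..<n}"
  have "\<exists>w\<in>kernel_span. i < n \<longrightarrow> nrm (w - u i) < 1 / real (Suc m)" for i m
    using kernel_span_dense[OF u, of i "1 / real (Suc m)"] csubspace_0[OF csubspace_kernel_span]
    by (cases "i < n") auto
  then have ex: "\<exists>w. w \<in> kernel_span \<and> (i < n \<longrightarrow> nrm (w - u i) < 1 / real (Suc m))" for i m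
    by (simp add: Bex_def)
  define w where "w m i = (SOME w. w \<in> kernel_span \<and> (i < n \<longrightarrow> nrm (w - u i) < 1 / real (Suc m)))" for m i
  have w: "w m i \<in> kernel_span" "i < n \<Longrightarrow> nrm (w m i - u i) < 1 / real (Suc m)" for m i
    using someI_ex[OF ex[of i m]] unfolding w_def by blast+
  have lim0: "(\<lambda>m. 1 / real (Suc m)) \<longlonglongrightarrow> 0" using lim_inverse_n' LIMSEQ_Suc by fastforce
  have ipl: "(\<lambda>m. ipL (u i) (w m i)) \<longlonglongrightarrow> ipL (u i) (u i)" if i: "i < n" for i
  proof -
    have "(\<lambda>m. ipL (u i) (w m i - u i)) \<longlonglongrightarrow> 0"
    proof (rule tendsto_0_le[OF lim0])
      have "cmod (ipL (u i) (w m i - u i)) \<le> norm (1 / real (Suc m)) * nrm (u i)" for m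
      proof -
        have "cmod (ipL (u i) (w m i - u i)) \<le> nrm (u i) * nrm (w m i - u i)"
          using u[OF i] w(1) by (intro cauchy_schwarz) auto
        also have "\<dots> \<le> nrm (u i) * (1 / real (Suc m))"
          using w(2)[OF i, of m] u[OF i] by (intro mult_left_mono) auto
        finally show ?thesis by (simp add: mult.commute)
      qed
      then show "\<forall>\<^sub>F m in sequentially. norm (ipL (u i) (w m i - u i)) \<le> norm (1 / real (Suc m)) * nrm (u i)"
        by simp
    qed
    from tendsto_add[OF this tendsto_const[of "ipL (u i) (u i)"]] show ?thesis
      using u[OF i] w(1) by (simp add: ip_diff_right)
  qed
  have nl: "(\<lambda>m. nrm (w m i)) \<longlonglongrightarrow> nrm (u i)" if i: "i < n" for i
  proof -
    have "(\<lambda>m. nrm (w m i) - nrm (u i)) \<longlonglongrightarrow> 0"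
    proof (rule tendsto_0_le[OF lim0])
      have "norm (nrm (w m i) - nrm (u i)) \<le> norm (1 / real (Suc m)) * 1" for m
        using nrm_triangle[of "w m i - u i" "u i"] nrm_triangle[of "u i - w m i" "w m i"]
          nrm_minus[of "w m i - u i"] w(2)[OF i, of m] w(1)[of m i] u[OF i] by simp
      then show "\<forall>\<^sub>F m in sequentially. norm (nrm (w m i) - nrm (u i)) \<le> norm (1 / real (Suc m)) * 1"
        by simp
    qed
    from tendsto_add[OF this tendsto_const[of "nrm (u i)"]] show ?thesis by simp
  qed
  have "(\<lambda>m. \<Sum>i<n. ipL (u i) (w m i)) \<longlonglongrightarrow> (\<Sum>i<n. ipL (u i) (u i))"
    by (intro tendsto_sum ipl) simp
  also have "(\<Sum>i<n. ipL (u i) (u i)) = of_real (?r\<^sup>2)"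
    unfolding L2_set_power2 of_real_sum using u by (intro sum.cong refl ip_self) simp
  finally have "(\<lambda>m. cmod (\<Sum>i<n. ipL (u i) (w m i))) \<longlonglongrightarrow> cmod (of_real (?r\<^sup>2))"
    by (rule tendsto_norm)
  moreover have "(\<lambda>m. C * L2_set (\<lambda>i. nrm (w m i)) {..<n}) \<longlonglongrightarrow> C * ?r"
    unfolding L2_set_def by (intro tendsto_intros nl) simp
  \<comment> \<open>In the limit the test columns become \<open>u\<close> itself, so the hypothesis
    reads \<open>?r * ?r \<le> C * ?r\<close>.\<close>
  ultimately have "cmod (of_real (?r\<^sup>2)) \<le> C * ?r"
    using le w(1) by (intro LIMSEQ_le[of _ _ _ "C * ?r"]) blast+
  then have "?r * ?r \<le> C * ?r" unfolding norm_of_real by (simp add: power2_eq_square)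
  then show ?thesis using C L2_set_nonneg[of "\<lambda>i. nrm (u i)" "{..<n}"]
    by (cases "?r = 0") (auto dest: mult_right_le_imp_le)
qed

lemma nrm_le_kernel_span:
  assumes "u \<in> \<L>" "C \<ge> 0" "\<And>w. w \<in> kernel_span \<Longrightarrow> cmod (ipL u w) \<le> C * nrm w"
  shows "nrm u \<le> C"
  using L2_nrm_le_kernel_span[of "Suc 0" "\<lambda>_. u" C] assms by (simp add: L2_set_def lessThan_Suc)

section \<open>Boundedness and operator algebra structure of the multipliers\<close>

abbreviation mults :: "('x \<Rightarrow> complex) set" where "mults \<equiv> multipliers \<L>"

lemma mult_op_mem [simp]: "f \<in> mults \<Longrightarrow> g \<in> \<L> \<Longrightarrow> mult_op f g \<in> \<L>"
  by (simp add: multipliers_def)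

lemma mult_op_add_left: "mult_op (f + f') g = mult_op f g + mult_op f' g"
  and mult_op_scale_left: "mult_op (c *\<^sub>C f) g = c *\<^sub>C mult_op f g"
  and mult_op_add_right: "mult_op f (g + g') = mult_op f g + mult_op f g'"
  and mult_op_scale_right: "mult_op f (c *\<^sub>C g) = c *\<^sub>C mult_op f g"
  and mult_op_zero_left: "mult_op 0 g = 0"
  and mult_op_mult: "mult_op (f * f') g = mult_op f (mult_op f' g)"
  by (simp_all add: mult_op_def fun_eq_iff scaleC_add_left scaleC_add_right scaleC_fun_def
    scaleC_complex_def scaleC_scaleC mult.commute)

lemma mult_op_const: "mult_op (\<lambda>_. c) g = c *\<^sub>C g"
  by (simp add: mult_op_def scaleC_fun_def)

lemma csubspace_mults: "csubspace mults"
  unfolding csubspace_def multipliers_def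
  by (auto simp: mult_op_add_left mult_op_scale_left mult_op_zero_left simp del: mult_op_mem)

lemma const_mults: "(\<lambda>_. c) \<in> mults"
  unfolding multipliers_def by (simp add: mult_op_const del: mult_op_mem)

lemma times_mults: "f \<in> mults \<Longrightarrow> f' \<in> mults \<Longrightarrow> f * f' \<in> mults"
  unfolding multipliers_def by (simp add: mult_op_mult del: mult_op_mem)

lemma ip_mult_op_represents:
  "represents w xs \<Longrightarrow> mult_op f g \<in> \<L> \<Longrightarrow>
    ipL (mult_op f g) w = (\<Sum>(x, e)\<leftarrow>xs. f x * ipH (g x) e)"
  by (auto simp: represents_def mult_op_def H.ip_scale_left)

text \<open>Multipliers come without continuity. For w in the unit ball of the kernel span the
  seminorm |<f g, w>| of g is bounded, since <f g, w> is a finite combination of evaluations of g;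
  at a fixed g these seminorms stay below the norm of f g. Uniform boundedness gives one constant,
  and density turns it into a bound on the norm of f g.\<close>

lemma mult_op_bounded:
  assumes f: "f \<in> mults"
  shows "\<exists>C\<ge>0. \<forall>g\<in>\<L>. nrm (mult_op f g) \<le> C * nrm g"
proof -
  let ?Q = "(\<lambda>w g. cmod (ipL (mult_op f g) w)) ` {w \<in> kernel_span. nrm w \<le> 1}"
  have "\<exists>C. \<forall>q\<in>?Q. \<forall>v\<in>\<L>. q v \<le> C * nrm v"
  proof (rule uniform_boundedness)
    fix q assume "q \<in> ?Q"
    then obtain w where w: "w \<in> kernel_span" "nrm w \<le> 1" "q = (\<lambda>g. cmod (ipL (mult_op f g) w))" by blast
    show "q (u + v) \<le> q u + q v" if "u \<in> \<L>" "v \<in> \<L>" for u v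
      using that f w by (simp add: mult_op_add_right ip_add_left norm_triangle_ineq)
    show "q (c *\<^sub>C v) = cmod c * q v" if "v \<in> \<L>" for c v
      using that f w by (simp add: mult_op_scale_right ip_scale_left norm_mult)
    obtain xs where xs: "represents w xs" using w by (auto simp: kernel_span_def)
    have "\<exists>C. \<forall>g\<in>\<L>. cmod (\<Sum>(x, e)\<leftarrow>xs. f x * ipH (g x) e) \<le> C * nrm g" for xs
    proof (induction xs)
      case Nil
      then show ?case by (auto intro!: exI[of _ 0])
    next
      case (Cons a xs)
      then obtain C where C: "\<forall>g\<in>\<L>. cmod (\<Sum>(x, e)\<leftarrow>xs. f x * ipH (g x) e) \<le> C * nrm g" by blast
      obtain x e where a: "a = (x, e)" by (cases a)
      obtain D where D: "\<And>g. g \<in> \<L> \<Longrightarrow> cmod (ipH (g x) e) \<le> D * nrm g" using ip_eval_bound by blast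
      have "cmod (\<Sum>(x, e)\<leftarrow>a # xs. f x * ipH (g x) e) \<le> (cmod (f x) * D + C) * nrm g" if g: "g \<in> \<L>" for g
      proof -
        have "cmod (\<Sum>(x, e)\<leftarrow>a # xs. f x * ipH (g x) e)
            \<le> cmod (f x) * cmod (ipH (g x) e) + cmod (\<Sum>(x, e)\<leftarrow>xs. f x * ipH (g x) e)"
          unfolding a by (simp add: norm_triangle_ineq flip: norm_mult)
        also have "\<dots> \<le> cmod (f x) * (D * nrm g) + C * nrm g"
          using C D g by (intro add_mono mult_left_mono) auto
        finally show ?thesis by (simp add: algebra_simps)
      qed
      then show ?case by blast
    qed
    then show "\<exists>C. \<forall>v\<in>\<L>. q v \<le> C * nrm v"
      using f by (simp add: w(3) ip_mult_op_represents[OF xs])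
  next
    fix g assume g: "g \<in> \<L>"
    have "cmod (ipL (mult_op f g) w) \<le> nrm (mult_op f g)" if "w \<in> kernel_span" "nrm w \<le> 1" for w
    proof -
      have "cmod (ipL (mult_op f g) w) \<le> nrm (mult_op f g) * nrm w"
        using f g that by (intro cauchy_schwarz) auto
      also have "\<dots> \<le> nrm (mult_op f g) * 1" using f g that by (intro mult_left_mono) auto
      finally show ?thesis by simp
    qed
    then show "\<exists>C. \<forall>q\<in>?Q. q g \<le> C" by blast
  qed
  then obtain C where "\<forall>q\<in>?Q. \<forall>v\<in>\<L>. q v \<le> C * nrm v" ..
  then have C: "cmod (ipL (mult_op f g) w) \<le> C * nrm g"
    if "w \<in> kernel_span" "nrm w \<le> 1" "g \<in> \<L>" for w g using that by simp
  have "nrm (mult_op f g) \<le> \<bar>C\<bar> * nrm g" if g: "g \<in> \<L>" for g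
  proof (rule nrm_le_kernel_span)
    fix w assume w: "w \<in> kernel_span"
    show "cmod (ipL (mult_op f g) w) \<le> \<bar>C\<bar> * nrm g * nrm w"
    proof (cases "w = 0")
      case False
      then have p: "nrm w > 0" using nrm_eq_0[of w] nrm_nonneg[of w] w by (simp add: less_le)
      let ?c = "complex_of_real (1 / nrm w)"
      have c: "cmod ?c = 1 / nrm w" using p by (simp only: norm_of_real) simp
      have "cmod (ipL (mult_op f g) (?c *\<^sub>C w)) \<le> C * nrm g"
      proof (rule C[OF _ _ g])
        show "?c *\<^sub>C w \<in> kernel_span" using csubspace_scale[OF csubspace_kernel_span w] .
        show "nrm (?c *\<^sub>C w) \<le> 1" using w p by (simp only: nrm_scale[OF kernel_span_mem[OF w]] c) simp
      qed
      also have "C * nrm g \<le> \<bar>C\<bar> * nrm g" using g by (intro mult_right_mono) auto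
      finally have "cmod (ipL (mult_op f g) w) / nrm w \<le> \<bar>C\<bar> * nrm g"
        using f g w by (simp add: ip_scale_right norm_mult norm_divide)
      then show ?thesis using p by (simp add: pos_divide_le_eq)
    qed (use f g in simp)
  qed (use f g in auto)
  then show ?thesis by (intro exI[of _ "\<bar>C\<bar>"]) auto
qed

sublocale action \<L> ipL mults mult_op
  by (intro action.intro inner_space_axioms action_axioms.intro csubspace_mults)
    (auto simp: acts_linearly_def clinear_on_def mult_op_add_left mult_op_scale_left
      mult_op_add_right mult_op_scale_right)

abbreviation N :: "('x \<Rightarrow> complex) mat \<Rightarrow> real" where "N \<equiv> multiplier_norm \<L> ipL"

lemma mults_bnd_ex: assumes G: "G \<in> matrices n mults" shows "\<exists>D. bnd G D"
proof -
  obtain c where c: "\<And>f. f \<in> mults \<Longrightarrow> c f \<ge> 0" "\<And>f g. f \<in> mults \<Longrightarrow> g \<in> \<L> \<Longrightarrow> nrm (mult_op f g) \<le> c f * nrm g"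
    using bchoice[of mults "\<lambda>f C. C \<ge> 0 \<and> (\<forall>g\<in>\<L>. nrm (mult_op f g) \<le> C * nrm g)"] mult_op_bounded by blast
  have "bnd G (\<Sum>i<n. \<Sum>j<n. if i < n \<and> j < n then c (G $$ (i, j)) else 0)"
    using c matrices_entry[OF G] by (intro bnd_entrywise[OF G]) auto
  then show ?thesis ..
qed

lemma matrices_elements: "G \<in> matrices n B \<Longrightarrow> elements_mat G \<subseteq> B"
  by (simp add: matrices_def)

lemma N_le_iff: "G \<in> matrices n mults \<Longrightarrow> C \<ge> 0 \<Longrightarrow> N G \<le> C \<longleftrightarrow> bnd G C"
  using mults_bnd_ex[of G n] opmat_norm_le_iff[OF matrices_elements] unfolding multiplier_norm_def by blast

lemma N_nonneg: "G \<in> matrices n mults \<Longrightarrow> N G \<ge> 0"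
  using mults_bnd_ex[of G n] opmat_norm_nonneg unfolding multiplier_norm_def by blast

lemma bnd_N: "G \<in> matrices n mults \<Longrightarrow> bnd G (N G)"
  using N_le_iff N_nonneg by blast

lemma operator_space_mults: "operator_space mults N"
proof (rule operator_space_of_actions[where I = "{()}" and W = "\<lambda>_. \<L>" and ip = "\<lambda>_. ipL" and \<rho> = "\<lambda>_. mult_op"])
  fix f assume f: "f \<in> mults" and z: "\<And>i v. i \<in> {()} \<Longrightarrow> v \<in> \<L> \<Longrightarrow> mult_op f v = 0"
  have "f x = 0" for x
  proof -
    obtain g where g: "g \<in> \<L>" "g x \<noteq> 0" using eval_nonzero by blast
    have s: "f x *\<^sub>C g x = 0" using z[OF _ g(1)] by (simp add: mult_op_def fun_eq_iff)
    show "f x = 0"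
    proof (rule ccontr)
      assume nz: "f x \<noteq> 0"
      have "g x = (1 / f x) *\<^sub>C f x *\<^sub>C g x" using nz by (simp add: scaleC_scaleC scaleC_one)
      then show False using s g by simp
    qed
  qed
  then show "f = 0" by (simp add: fun_eq_iff)
qed (use csubspace_mults N_le_iff N_nonneg action_axioms in auto)

text \<open>The product matrix acts as a composition in which \<open>H\<close> comes first.\<close>

lemma bnd_times:
  assumes G: "G \<in> matrices n mults" "bnd G C" and H: "H \<in> matrices n mults" "bnd H D" and C: "C \<ge> 0"
  shows "bnd (G * H) (C * D)"
  unfolding op_bound_def
proof (intro allI impI)
  note c = matrices_carrier[OF G(1)] matrices_carrier[OF H(1)]
  note GA = matrices_entry[OF G(1)] and HA = matrices_entry[OF H(1)]
  fix v assume "\<forall>j<dim_col (G * H). v j \<in> \<L>"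
  then have v: "v j \<in> \<L>" if "j < n" for j using that c by auto
  define w where "w k = (\<Sum>j<n. mult_op (H $$ (k, j)) (v j))" for k
  have w: "w k \<in> \<L>" if "k < n" for k unfolding w_def using v HA that by (intro sum_mem) auto
  have "(\<Sum>j<n. mult_op ((G * H) $$ (i, j)) (v j)) = (\<Sum>k<n. mult_op (G $$ (i, k)) (w k))" if i: "i < n" for i
  proof -
    have "(\<Sum>j<n. mult_op ((G * H) $$ (i, j)) (v j)) = (\<Sum>j<n. \<Sum>k<n. mult_op (G $$ (i, k)) (mult_op (H $$ (k, j)) (v j)))"
    proof (intro sum.cong refl)
      fix j assume "j \<in> {..<n}"
      then have j: "j < n" by simp
      have "(G * H) $$ (i, j) = (\<Sum>k<n. G $$ (i, k) * H $$ (k, j))"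
        using i j c by (simp add: scalar_prod_def atLeast0LessThan)
      then have "mult_op ((G * H) $$ (i, j)) (v j) = (\<Sum>k<n. mult_op (G $$ (i, k) * H $$ (k, j)) (v j))"
        using GA HA i j v by (simp only:) (intro act_sum_left; simp add: times_mults)
      then show "mult_op ((G * H) $$ (i, j)) (v j) = (\<Sum>k<n. mult_op (G $$ (i, k)) (mult_op (H $$ (k, j)) (v j)))"
        by (simp only: mult_op_mult)
    qed
    also have "\<dots> = (\<Sum>k<n. \<Sum>j<n. mult_op (G $$ (i, k)) (mult_op (H $$ (k, j)) (v j)))" by (rule sum.swap)
    also have "\<dots> = (\<Sum>k<n. mult_op (G $$ (i, k)) (w k))"
      unfolding w_def using GA HA v i by (intro sum.cong refl act_sum_right[symmetric]) auto
    finally show ?thesis .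
  qed
  then have "L2_set (\<lambda>i. nrm (\<Sum>j<n. mult_op ((G * H) $$ (i, j)) (v j))) {..<n} =
      L2_set (\<lambda>i. nrm (\<Sum>k<n. mult_op (G $$ (i, k)) (w k))) {..<n}" by (intro L2_set_cong) auto
  also have "\<dots> \<le> C * L2_set (\<lambda>k. nrm (w k)) {..<n}" using op_boundD[OF G(2), of w] c w by simp
  also have "\<dots> \<le> C * (D * L2_set (\<lambda>j. nrm (v j)) {..<n})"
    using op_boundD[OF H(2), of v] c v C unfolding w_def by (intro mult_left_mono) auto
  finally show "L2_set (\<lambda>i. nrm (\<Sum>j<dim_col (G * H). mult_op ((G * H) $$ (i, j)) (v j))) {..<dim_row (G * H)}
      \<le> C * D * L2_set (\<lambda>j. nrm (v j)) {..<dim_col (G * H)}"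
    using c by (simp add: mult.assoc)
qed

lemma matrices_times:
  assumes "G \<in> matrices n mults" "H \<in> matrices n mults"
  shows "G * H \<in> matrices n mults"
proof (rule matricesI)
  note c = matrices_carrier[OF assms(1)] matrices_carrier[OF assms(2)]
  show "G * H \<in> carrier_mat n n" using c by simp
  fix i j assume ij: "i < n" "j < n"
  have "(G * H) $$ (i, j) = (\<Sum>k<n. G $$ (i, k) * H $$ (k, j))"
    using ij c by (simp add: scalar_prod_def atLeast0LessThan)
  then show "(G * H) $$ (i, j) \<in> mults"
    using ij matrices_entry[OF assms(1)] matrices_entry[OF assms(2)]
    by (simp only:) (intro csubspace_sum csubspace_mults times_mults; simp)
qed

lemma mat1_mults: "f \<in> mults \<Longrightarrow> mat1 f \<in> matrices 1 mults"
  by (intro matricesI) (auto simp: mat1_def)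

lemma N_mat1: "f \<in> mults \<Longrightarrow> g \<in> \<L> \<Longrightarrow> nrm (mult_op f g) \<le> N (mat1 f) * nrm g"
  using bnd_entry[OF mat1_mults bnd_N[OF mat1_mults], of f 0 0 g] by (simp add: mat1_def)

lemma N_mat1_le:
  "f \<in> mults \<Longrightarrow> C \<ge> 0 \<Longrightarrow> (\<And>g. g \<in> \<L> \<Longrightarrow> nrm (mult_op f g) \<le> C * nrm g) \<Longrightarrow> N (mat1 f) \<le> C"
  unfolding N_le_iff[OF mat1_mults] op_bound_def by (simp add: mat1_def L2_set_def)

lemma one_mults: "1 \<in> mults"
  using const_mults[of 1] by (simp add: one_fun_def)

lemma mult_op_one: "mult_op 1 g = g"
  by (simp add: mult_op_def scaleC_one)

lemma operator_algebra_mults: "operator_algebra mults N"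
  unfolding operator_algebra_def
proof (intro conjI ballI allI impI)
  show "N (G * H) \<le> N G * N H" if "G \<in> matrices n mults" "H \<in> matrices n mults" for n G H
    using N_le_iff[OF matrices_times[OF that], of "N G * N H"]
      bnd_times[OF that(1) bnd_N[OF that(1)] that(2) bnd_N[OF that(2)]] N_nonneg[OF that(1)] N_nonneg[OF that(2)]
    by simp
  show "N (mat1 1) = 1"
  proof (rule antisym)
    show "N (mat1 1) \<le> 1" by (rule N_mat1_le[OF one_mults]) (auto simp: mult_op_one)
    \<comment> \<open>Types are nonempty, so there is a point, and \<open>\<L>\<close> contains a
      nonzero function; on the zero space the identity would have norm 0.\<close>
    obtain g where g: "g \<in> \<L>" "g undefined \<noteq> 0" using eval_nonzero by blast
    then have "g \<noteq> 0" by auto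
    then have "nrm g > 0" using g(1) nrm_eq_0[of g] nrm_nonneg[of g] by (simp add: less_le)
    then show "1 \<le> N (mat1 1)" using N_mat1[OF one_mults g(1)] by (simp add: mult_op_one)
  qed
qed (auto simp: operator_space_mults one_mults times_mults)

text \<open>For g with g(x) nonzero, f(x) is read off from f(x) g(x), the value of f g at x.\<close>

lemma eval_mults_bounded: "\<exists>C. \<forall>f\<in>mults. cmod (f x) \<le> C * N (mat1 f)"
proof -
  obtain g where g: "g \<in> \<L>" "g x \<noteq> 0" using eval_nonzero by blast
  then have p: "hnorm ipH (g x) > 0" using H.nrm_eq_0[of "g x"] H.nrm_nonneg[of "g x"] by (simp add: less_le)
  obtain C where C: "C \<ge> 0" "\<And>g. g \<in> \<L> \<Longrightarrow> hnorm ipH (g x) \<le> C * nrm g" using eval_bound[where x = x] by blast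
  have "cmod (f x) \<le> C * nrm g / hnorm ipH (g x) * N (mat1 f)" if f: "f \<in> mults" for f
  proof -
    have "cmod (f x) * hnorm ipH (g x) = hnorm ipH (mult_op f g x)"
      by (simp add: mult_op_def H.nrm_scale)
    also have "\<dots> \<le> C * nrm (mult_op f g)" using C f g by simp
    also have "\<dots> \<le> C * (N (mat1 f) * nrm g)" using C N_mat1[OF f g(1)] by (intro mult_left_mono) auto
    finally show ?thesis using p by (simp add: pos_le_divide_eq mult_ac)
  qed
  then show ?thesis by blast
qed

lemma operator_algebra_of_functions_mults:
  "separates_points mults \<Longrightarrow> operator_algebra_of_functions mults N"
  unfolding operator_algebra_of_functions_def
  using operator_algebra_mults const_mults eval_mults_bounded by blast

end

section \<open>Locality, BPW completeness and the predual\<close>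

context rkhs_multipliers
begin

text \<open>Density is spent on the range side only: one factor from the kernel span suffices for
  the pairing to depend on finitely many points, so the columns \<open>v\<close> stay
  arbitrary.\<close>

lemma bnd_kernel_spanI:
  assumes G: "G \<in> matrices n mults" and C: "C \<ge> 0"
    and le: "\<And>v w. (\<And>j. j < n \<Longrightarrow> v j \<in> \<L>) \<Longrightarrow> (\<And>i. i < n \<Longrightarrow> w i \<in> kernel_span) \<Longrightarrow>
      cmod (\<Sum>i<n. ipL (\<Sum>j<n. mult_op (G $$ (i, j)) (v j)) (w i))
        \<le> C * L2_set (\<lambda>j. nrm (v j)) {..<n} * L2_set (\<lambda>i. nrm (w i)) {..<n}"
  shows "bnd G C"
  unfolding op_bound_def
proof (intro allI impI)
  note c = matrices_carrier[OF G]
  fix v assume "\<forall>j<dim_col G. v j \<in> \<L>"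
  then have v: "\<And>j. j < n \<Longrightarrow> v j \<in> \<L>" using c by auto
  have "L2_set (\<lambda>i. nrm (\<Sum>j<n. mult_op (G $$ (i, j)) (v j))) {..<n} \<le> C * L2_set (\<lambda>j. nrm (v j)) {..<n}"
  proof (rule L2_nrm_le_kernel_span)
    show "(\<Sum>j<n. mult_op (G $$ (i, j)) (v j)) \<in> \<L>" if "i < n" for i
      using that v matrices_entry[OF G] by (intro sum_mem) auto
  qed (use C v le in auto)
  then show "L2_set (\<lambda>i. nrm (\<Sum>j<dim_col G. mult_op (G $$ (i, j)) (v j))) {..<dim_row G}
      \<le> C * L2_set (\<lambda>j. nrm (v j)) {..<dim_col G}" using c by simp
qed

lemma L2_ip_le:
  assumes "\<And>i. i < n \<Longrightarrow> u i \<in> \<L>" "\<And>i. i < n \<Longrightarrow> w i \<in> \<L>"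
  shows "cmod (\<Sum>i<n. ipL (u i) (w i)) \<le> L2_set (\<lambda>i. nrm (u i)) {..<n} * L2_set (\<lambda>i. nrm (w i)) {..<n}"
proof -
  have "cmod (\<Sum>i<n. ipL (u i) (w i)) \<le> (\<Sum>i<n. \<bar>nrm (u i)\<bar> * \<bar>nrm (w i)\<bar>)"
    using assms cauchy_schwarz by (intro sum_norm_le) simp
  also have "\<dots> \<le> L2_set (\<lambda>i. nrm (u i)) {..<n} * L2_set (\<lambda>i. nrm (w i)) {..<n}"
    by (rule L2_set_mult_ineq)
  finally show ?thesis .
qed

text \<open>P = 0 shows that quotient norms are at most \<open>N G\<close>. Conversely, a pairing
  with a column \<open>w\<close> of the kernel span does not change when a matrix vanishing at the
  points of \<open>w\<close> is added to \<open>G\<close>, so the quotient norm for these points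
  bounds it.\<close>

lemma local_algebra_mults: "local_algebra mults N"
  unfolding local_algebra_def
proof (intro allI impI ballI)
  fix n :: nat and G assume n: "n > 0" and G: "G \<in> matrices n mults"
  note c = matrices_carrier[OF G]
  let ?I = "vanishing_ideal mults" and ?q = "\<lambda>F. quotient_norm N (vanishing_ideal mults F) G"
  let ?X = "{?q F | F. finite F}"
  have I: "csubspace (?I F)" for F
    using csubspace_mults by (auto simp: csubspace_def vanishing_ideal_def scaleC_fun_def scaleC_complex_def)
  have IA: "P \<in> matrices n mults" if "P \<in> matrices n (?I F)" for P F
    using that by (auto simp: matrices_def vanishing_ideal_def)
  have GP: "G + P \<in> matrices n mults" if "P \<in> matrices n (?I F)" for P F
    using matrices_add[OF csubspace_mults G IA[OF that]] .
  have q: "?q F = Inf {N (G + P) | P. P \<in> matrices n (?I F)}" for F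
    using c by (simp add: quotient_norm_def)
  have ne: "N (G + 0\<^sub>m n n) \<in> {N (G + P) | P. P \<in> matrices n (?I F)}" for F
    using matrices_zero[OF I] by blast
  have bdd: "bdd_below {N (G + P) | P. P \<in> matrices n (?I F)}" for F
    using N_nonneg[OF GP] by (auto intro!: bdd_belowI[of _ 0])
  have G0: "G + 0\<^sub>m n n = G" using c by simp
  have q_le: "?q F \<le> N G" for F
    unfolding q using cInf_lower[OF ne bdd] by (simp only: G0)
  have X_bdd: "bdd_above ?X" using q_le by (auto intro!: bdd_aboveI[of _ "N G"])
  have X_ne: "?X \<noteq> {}" by blast
  have q0: "?q F \<ge> 0" for F
    unfolding q using ne N_nonneg[OF GP] by (intro cInf_greatest) blast+
  have S0: "Sup ?X \<ge> 0" using order_trans[OF q0 cSup_upper[OF _ X_bdd]] by blast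
  have "N G \<le> Sup ?X"
    unfolding N_le_iff[OF G S0]
  proof (rule bnd_kernel_spanI[OF G S0])
    fix v w assume v: "\<And>j. j < n \<Longrightarrow> v j \<in> \<L>" and w: "\<And>i. i < n \<Longrightarrow> w i \<in> kernel_span"
    let ?a = "L2_set (\<lambda>j. nrm (v j)) {..<n}" and ?b = "L2_set (\<lambda>i. nrm (w i)) {..<n}"
    let ?T = "\<lambda>H i. \<Sum>j<n. mult_op (H $$ (i, j)) (v j)"
    have "\<exists>xs. i < n \<longrightarrow> represents (w i) xs" for i using w by (auto simp: kernel_span_def)
    then obtain xs where xs: "\<And>i. i < n \<Longrightarrow> represents (w i) (xs i)" by metis
    define F where "F = (\<Union>i<n. fst ` set (xs i))"
    have F: "finite F" by (simp add: F_def)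
    have le: "cmod (\<Sum>i<n. ipL (?T G i) (w i)) \<le> N (G + P) * (?a * ?b)" if P: "P \<in> matrices n (?I F)" for P
    proof -
      have PF: "P $$ (i, j) \<in> mults" "\<And>x. x \<in> F \<Longrightarrow> (P $$ (i, j)) x = 0" if "i < n" "j < n" for i j
        using matrices_entry[OF P that] by (auto simp: vanishing_ideal_def)
      have "ipL (?T (G + P) i) (w i) = ipL (?T G i) (w i)" if i: "i < n" for i
      proof -
        have "ipL (mult_op ((G + P) $$ (i, j)) (v j)) (w i) = ipL (mult_op (G $$ (i, j)) (v j)) (w i)"
          if j: "j < n" for j
        proof -
          have "ipL (mult_op (P $$ (i, j)) (v j)) (w i) =
              (\<Sum>(x, e)\<leftarrow>xs i. (P $$ (i, j)) x * ipH (v j x) e)"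
            by (rule ip_mult_op_represents[OF xs[OF i]]) (use PF i j v in simp)
          also have "\<dots> = (\<Sum>(x, e)\<leftarrow>xs i. 0)"
            using i PF(2)[OF i j] by (intro arg_cong[of _ _ sum_list] map_cong refl) (force simp: F_def)
          also have "\<dots> = 0" by (simp add: sum_list_0 split_def)
          finally have "ipL (mult_op (P $$ (i, j)) (v j)) (w i) = 0" .
          then show ?thesis using i j c matrices_carrier[OF P] matrices_entry[OF G i j] PF(1)[OF i j] v w
            by (simp add: mult_op_add_left ip_add_left)
        qed
        moreover have "ipL (?T H i) (w i) = (\<Sum>j<n. ipL (mult_op (H $$ (i, j)) (v j)) (w i))"
          if "H \<in> matrices n mults" for H
          using i w v matrices_entry[OF that] by (intro ip_sum_left) auto
        ultimately show ?thesis using G GP[OF P] by simp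
      qed
      then have "cmod (\<Sum>i<n. ipL (?T G i) (w i)) = cmod (\<Sum>i<n. ipL (?T (G + P) i) (w i))" by simp
      also have "\<dots> \<le> L2_set (\<lambda>i. nrm (?T (G + P) i)) {..<n} * ?b"
        using v w matrices_entry[OF GP[OF P]] by (intro L2_ip_le sum_mem) auto
      also have "\<dots> \<le> N (G + P) * ?a * ?b"
        using op_boundD[OF bnd_N[OF GP[OF P]], of v] matrices_carrier[OF GP[OF P]] matrices_carrier[OF P] v
        by (intro mult_right_mono) auto
      finally show ?thesis by (simp add: mult.assoc)
    qed
    have "cmod (\<Sum>i<n. ipL (?T G i) (w i)) \<le> ?q F * (?a * ?b)"
    \<comment> \<open>The infimum is compared after division by the test norms; if their product
      vanishes, P = 0 already makes the pairing 0.\<close>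
    proof (cases "?a * ?b = 0")
      case True
      then show ?thesis using le[OF matrices_zero[OF I]] unfolding True by simp
    next
      case False
      then have p: "?a * ?b > 0" by (simp add: less_le)
      have "cmod (\<Sum>i<n. ipL (?T G i) (w i)) / (?a * ?b) \<le> ?q F"
        unfolding q using ne le p by (intro cInf_greatest) (auto simp: pos_divide_le_eq)
      then show ?thesis using p by (simp add: pos_divide_le_eq)
    qed
    also have "\<dots> \<le> Sup ?X * (?a * ?b)"
      using F by (intro mult_right_mono cSup_upper[OF _ X_bdd]) auto
    finally show "cmod (\<Sum>i<n. ipL (?T G i) (w i)) \<le> Sup ?X * ?a * ?b" by (simp add: mult.assoc)
  qed
  moreover have "Sup ?X \<le> N G" using q_le X_ne by (intro cSup_least) auto
  ultimately show "N G = Sup ?X" by simp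
qed

text \<open>Functions of \<^term>\<open>\<L>\<close> are obtained by the Riesz lemma from their inner products with kernel
  vectors.\<close>

lemma mult_op_mem_riesz:
  assumes g: "g \<in> \<L>"
    and add: "\<And>u w. u \<in> kernel_span \<Longrightarrow> w \<in> kernel_span \<Longrightarrow> \<Lambda> (u + w) = \<Lambda> u + \<Lambda> w"
    and scale: "\<And>c w. w \<in> kernel_span \<Longrightarrow> \<Lambda> (c *\<^sub>C w) = cnj c * \<Lambda> w"
    and bd: "\<And>w. w \<in> kernel_span \<Longrightarrow> cmod (\<Lambda> w) \<le> C * nrm w"
    and eval: "\<And>w x e. represents w [(x, e)] \<Longrightarrow> \<Lambda> w = f x * ipH (g x) e"
  shows "mult_op f g \<in> \<L>"
proof -
  have lin: "clinear_on kernel_span (\<lambda>w. cnj (\<Lambda> w))"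
    by (simp add: clinear_on_def add scale scaleC_complex_def)
  have bd': "cmod (cnj (\<Lambda> w)) \<le> C * nrm w" if "w \<in> kernel_span" for w using bd[OF that] by simp
  obtain h where h: "h \<in> \<L>" "\<And>w. w \<in> kernel_span \<Longrightarrow> cnj (\<Lambda> w) = ipL w h"
    by (rule riesz_subspace[OF csubspace_kernel_span kernel_span_subset lin bd']) (assumption | rule that)+
  have "mult_op f g x = h x" for x
  proof -
    define d where "d = h x - f x *\<^sub>C g x"
    obtain k where k: "k \<in> \<L>" "\<forall>u\<in>\<L>. ipL u k = ipH (u x) d" using kernel_vector_ex by blast
    then have r: "represents k [(x, d)]" by (simp add: represents_def)
    then have "k \<in> kernel_span" by (auto simp: kernel_span_def)
    from h(2)[OF this] have "ipL h k = \<Lambda> k" using ip_cnj[OF k(1) h(1)] by (metis complex_cnj_cnj)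
    then have "ipH (h x) d = f x * ipH (g x) d" using eval[OF r] k(2) h(1) by simp
    then have "ipH d d = 0" by (simp add: d_def H.ip_diff_left H.ip_scale_left)
    then have "d = 0" using H.ip_pos[of d] by auto
    then show ?thesis by (simp add: d_def mult_op_def)
  qed
  then have "mult_op f g = h" by (rule ext)
  then show ?thesis using h(1) by simp
qed

lemma BPW_complete_mults: "BPW_complete mults N"
  unfolding BPW_complete_def
proof (intro allI impI)
  fix f assume "\<exists>\<F> C. \<F> \<noteq> bot \<and> (\<forall>\<^sub>F g in \<F>. g \<in> mults \<and> N (mat1 g) \<le> C) \<and>
    (\<forall>x. ((\<lambda>g. g x) \<longlongrightarrow> f x) \<F>)"
  then obtain \<F> C where \<F>: "\<F> \<noteq> bot" and ev: "\<forall>\<^sub>F h in \<F>. h \<in> mults \<and> N (mat1 h) \<le> C"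
    and lim: "\<And>x. ((\<lambda>h. h x) \<longlongrightarrow> f x) \<F>" by blast
  have "mult_op f g \<in> \<L>" if g: "g \<in> \<L>" for g
  proof -
    \<comment> \<open>On the kernel span the limit exists, because the pairings are finite sums of
      values of \<open>h\<close>. Taking a limit of inner products makes \<Lambda> independent of a
      representing list, and conjugate linearity in \<open>w\<close> is inherited.\<close>
    define \<Lambda> where "\<Lambda> w = Lim \<F> (\<lambda>h. ipL (mult_op h g) w)" for w
    have tend: "((\<lambda>h. ipL (mult_op h g) w) \<longlongrightarrow> (\<Sum>(x, e)\<leftarrow>xs. f x * ipH (g x) e)) \<F>"
      if xs: "represents w xs" for w xs
    proof -
      have "((\<lambda>h. \<Sum>(x, e)\<leftarrow>xs. h x * ipH (g x) e) \<longlongrightarrow> (\<Sum>(x, e)\<leftarrow>xs. f x * ipH (g x) e)) \<F>"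
        by (induction xs) (auto intro!: tendsto_intros lim)
      moreover have "\<forall>\<^sub>F h in \<F>. (\<Sum>(x, e)\<leftarrow>xs. h x * ipH (g x) e) = ipL (mult_op h g) w"
        using ev by eventually_elim (simp add: ip_mult_op_represents[OF xs] g)
      ultimately show ?thesis by (rule Lim_transform_eventually)
    qed
    then have \<Lambda>: "\<Lambda> w = (\<Sum>(x, e)\<leftarrow>xs. f x * ipH (g x) e)" if "represents w xs" for w xs
      unfolding \<Lambda>_def using tendsto_Lim[OF \<F>] that by blast
    have t\<Lambda>: "((\<lambda>h. ipL (mult_op h g) w) \<longlongrightarrow> \<Lambda> w) \<F>" if "w \<in> kernel_span" for w
      using that tend \<Lambda> by (auto simp: kernel_span_def)
    show ?thesis
    proof (rule mult_op_mem_riesz[OF g])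
      fix u w assume uw: "u \<in> kernel_span" "w \<in> kernel_span"
      have "((\<lambda>h. ipL (mult_op h g) u + ipL (mult_op h g) w) \<longlongrightarrow> \<Lambda> u + \<Lambda> w) \<F>"
        using uw by (intro tendsto_add t\<Lambda>)
      moreover have "\<forall>\<^sub>F h in \<F>. ipL (mult_op h g) u + ipL (mult_op h g) w = ipL (mult_op h g) (u + w)"
        using ev by eventually_elim (use g uw in \<open>simp add: ip_add_right\<close>)
      ultimately have "((\<lambda>h. ipL (mult_op h g) (u + w)) \<longlongrightarrow> \<Lambda> u + \<Lambda> w) \<F>" by (rule Lim_transform_eventually)
      then show "\<Lambda> (u + w) = \<Lambda> u + \<Lambda> w" unfolding \<Lambda>_def[of "u + w"] by (rule tendsto_Lim[OF \<F>])
    next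
      fix c w assume w: "w \<in> kernel_span"
      have "((\<lambda>h. cnj c * ipL (mult_op h g) w) \<longlongrightarrow> cnj c * \<Lambda> w) \<F>"
        using w by (intro tendsto_mult tendsto_const t\<Lambda>)
      moreover have "\<forall>\<^sub>F h in \<F>. cnj c * ipL (mult_op h g) w = ipL (mult_op h g) (c *\<^sub>C w)"
        using ev by eventually_elim (use g w in \<open>simp add: ip_scale_right\<close>)
      ultimately have "((\<lambda>h. ipL (mult_op h g) (c *\<^sub>C w)) \<longlongrightarrow> cnj c * \<Lambda> w) \<F>" by (rule Lim_transform_eventually)
      then show "\<Lambda> (c *\<^sub>C w) = cnj c * \<Lambda> w" unfolding \<Lambda>_def[of "c *\<^sub>C w"] by (rule tendsto_Lim[OF \<F>])
    next
      fix w assume w: "w \<in> kernel_span"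
      \<comment> \<open>The norm bound of the net passes to the limit and gives the estimate that
        Riesz requires.\<close>
      have "\<forall>\<^sub>F h in \<F>. norm (ipL (mult_op h g) w) \<le> C * nrm g * nrm w"
        using ev
      proof eventually_elim
        fix h assume h: "h \<in> mults \<and> N (mat1 h) \<le> C"
        then have "cmod (ipL (mult_op h g) w) \<le> nrm (mult_op h g) * nrm w"
          using g w by (intro cauchy_schwarz) auto
        also have "\<dots> \<le> (N (mat1 h) * nrm g) * nrm w"
          using h g w by (intro mult_right_mono N_mat1) auto
        also have "\<dots> \<le> (C * nrm g) * nrm w" using h g w by (intro mult_right_mono) auto
        finally show "norm (ipL (mult_op h g) w) \<le> C * nrm g * nrm w" .
      qed
      then show "cmod (\<Lambda> w) \<le> C * nrm g * nrm w"
        using tendsto_upperbound[OF tendsto_norm[OF t\<Lambda>[OF w]] _ \<F>] by simp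
    qed (simp add: \<Lambda>)
  qed
  then show "f \<in> mults" unfolding multipliers_def by blast
qed

section \<open>The predual spanned by point evaluations\<close>

definition eval_comb :: "('x \<times> complex) list \<Rightarrow> ('x \<Rightarrow> complex) \<Rightarrow> complex" where
  "eval_comb xs = (\<lambda>f. if f \<in> mults then \<Sum>(x, c)\<leftarrow>xs. c * f x else 0)"

definition predual :: "(('x \<Rightarrow> complex) \<Rightarrow> complex) set" where
  "predual = range eval_comb"

text \<open>Matrix coefficients of multiplication operators. With \<open>w\<close> in the kernel
  span they belong to the predual, and they are what determines the norms of multipliers.\<close>

definition vec_functional :: "('x \<Rightarrow> 'h) \<Rightarrow> ('x \<Rightarrow> 'h) \<Rightarrow> ('x \<Rightarrow> complex) \<Rightarrow> complex" where
  "vec_functional g w = (\<lambda>f. if f \<in> mults then ipL (mult_op f g) w else 0)"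

lemma csubspace_predual: "csubspace predual"
proof -
  have z: "eval_comb [] = 0" by (simp add: eval_comb_def fun_eq_iff)
  have a: "eval_comb xs + eval_comb ys = eval_comb (xs @ ys)" for xs ys
    by (simp add: eval_comb_def fun_eq_iff)
  have m: "d *\<^sub>C eval_comb xs = eval_comb (map (\<lambda>(x, c). (x, d * c)) xs)" for d xs
  proof -
    have "d * (\<Sum>(x, c)\<leftarrow>xs. c * f x) = (\<Sum>(x, c)\<leftarrow>map (\<lambda>(x, c). (x, d * c)) xs. c * f x)" for f
      by (induction xs) (auto simp: distrib_left)
    then show ?thesis by (simp add: eval_comb_def fun_eq_iff scaleC_fun_def scaleC_complex_def)
  qed
  show ?thesis unfolding csubspace_def predual_def
    by (auto simp: a m z[symmetric])
qed

lemma eval_comb_predual: "eval_comb xs \<in> predual"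
  by (simp add: predual_def)

lemma vec_functional_eq:
  assumes g: "g \<in> \<L>" and xs: "represents w xs"
  shows "vec_functional g w = eval_comb (map (\<lambda>(x, e). (x, ipH (g x) e)) xs)"
  unfolding vec_functional_def eval_comb_def using g
  by (simp add: fun_eq_iff ip_mult_op_represents[OF xs] split_def o_def mult.commute)

lemma vec_functional_predual: "g \<in> \<L> \<Longrightarrow> w \<in> kernel_span \<Longrightarrow> vec_functional g w \<in> predual"
  using vec_functional_eq by (auto simp: kernel_span_def eval_comb_predual)

text \<open>Fix g with g(x) nonzero and apply \<open>G\<close> to the column of the
  \<open>z l *\<^sub>C g\<close>: at x each entry is the scalar sum times g(x). So \<open>D\<close>
  is the constant of evaluation on \<open>\<L>\<close> times the norm of g divided by the norm of
  g(x).\<close>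

lemma eval_cb:
  obtains D where "D \<ge> 0" "\<And>p G z. G \<in> matrices p mults \<Longrightarrow> N G \<le> 1 \<Longrightarrow>
    L2_set (\<lambda>k. cmod (\<Sum>l<p. (G $$ (k, l)) x * z l)) {..<p} \<le> D * L2_set (\<lambda>l. cmod (z l)) {..<p}"
proof -
  obtain g where g: "g \<in> \<L>" "g x \<noteq> 0" using eval_nonzero by blast
  let ?r = "hnorm ipH (g x)"
  have r: "?r > 0" using g H.nrm_eq_0[of "g x"] H.nrm_nonneg[of "g x"] by (simp add: less_le)
  obtain C where C: "C \<ge> 0" "\<And>g. g \<in> \<L> \<Longrightarrow> hnorm ipH (g x) \<le> C * nrm g" using eval_bound[where x = x] by blast
  have "L2_set (\<lambda>k. cmod (\<Sum>l<p. (G $$ (k, l)) x * z l)) {..<p} \<le> C * nrm g / ?r * L2_set (\<lambda>l. cmod (z l)) {..<p}"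
    if G: "G \<in> matrices p mults" "N G \<le> 1" for p G z
  proof -
    note c = matrices_carrier[OF G(1)]
    define u where "u k = (\<Sum>l<p. mult_op (G $$ (k, l)) (z l *\<^sub>C g))" for k
    have u: "u k \<in> \<L>" if "k < p" for k
      unfolding u_def using that g matrices_entry[OF G(1)] by (intro sum_mem) auto
    have ux: "u k x = (\<Sum>l<p. (G $$ (k, l)) x * z l) *\<^sub>C g x" for k
      by (simp add: u_def sum_fun_apply mult_op_def scaleC_fun_def scaleC_scaleC scaleC_sum_left)
    have "?r * L2_set (\<lambda>k. cmod (\<Sum>l<p. (G $$ (k, l)) x * z l)) {..<p} = L2_set (\<lambda>k. hnorm ipH (u k x)) {..<p}"
      by (simp add: L2_set_right_distrib H.nrm_scale ux mult.commute less_imp_le[OF r])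
    also have "\<dots> \<le> L2_set (\<lambda>k. C * nrm (u k)) {..<p}" using C u by (intro L2_set_mono) auto
    also have "\<dots> = C * L2_set (\<lambda>k. nrm (u k)) {..<p}" using C by (simp add: L2_set_scale)
    also have "\<dots> \<le> C * (1 * L2_set (\<lambda>l. nrm (z l *\<^sub>C g)) {..<p})"
      using op_boundD[OF op_bound_mono[OF bnd_N[OF G(1)] G(2)], of "\<lambda>l. z l *\<^sub>C g"] c g C
      unfolding u_def by (intro mult_left_mono) auto
    also have "\<dots> = C * nrm g * L2_set (\<lambda>l. cmod (z l)) {..<p}"
      using g by (simp add: nrm_scale L2_set_scale mult.commute[of _ "nrm g"])
    finally show ?thesis using r by (simp add: pos_le_divide_eq mult_ac)
  qed
  then show ?thesis using that[of "C * nrm g / ?r"] C r g by simp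
qed

lemma predual_cb:
  "\<exists>c\<ge>0. \<forall>p>0. \<forall>G\<in>matrices p mults. N G \<le> 1 \<longrightarrow> (\<forall>z.
    L2_set (\<lambda>k. cmod (\<Sum>l<p. (\<Sum>(x, c)\<leftarrow>xs. c * (G $$ (k, l)) x) * z l)) {..<p} \<le> c * L2_set (\<lambda>l. cmod (z l)) {..<p})"
proof (induction xs)
  case Nil
  then show ?case by (auto intro!: exI[of _ 0])
next
  case (Cons a xs)
  obtain x d where a: "a = (x, d)" by (cases a)
  from Cons obtain c where c: "c \<ge> 0" "\<And>p G z. p > 0 \<Longrightarrow> G \<in> matrices p mults \<Longrightarrow> N G \<le> 1 \<Longrightarrow>
    L2_set (\<lambda>k. cmod (\<Sum>l<p. (\<Sum>(x, c)\<leftarrow>xs. c * (G $$ (k, l)) x) * z l)) {..<p} \<le> c * L2_set (\<lambda>l. cmod (z l)) {..<p}"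
    by blast
  obtain D where D: "D \<ge> 0" "\<And>p G z. G \<in> matrices p mults \<Longrightarrow> N G \<le> 1 \<Longrightarrow>
    L2_set (\<lambda>k. cmod (\<Sum>l<p. (G $$ (k, l)) x * z l)) {..<p} \<le> D * L2_set (\<lambda>l. cmod (z l)) {..<p}"
    using eval_cb[where x = x] by blast
  have "L2_set (\<lambda>k. cmod (\<Sum>l<p. (\<Sum>(x, c)\<leftarrow>a # xs. c * (G $$ (k, l)) x) * z l)) {..<p}
      \<le> (cmod d * D + c) * L2_set (\<lambda>l. cmod (z l)) {..<p}" (is "?lhs \<le> _ * ?r")
    if G: "p > 0" "G \<in> matrices p mults" "N G \<le> 1" for p G z
  proof -
    let ?A = "\<lambda>k. \<Sum>l<p. (G $$ (k, l)) x * z l" and ?B = "\<lambda>k. \<Sum>l<p. (\<Sum>(x, c)\<leftarrow>xs. c * (G $$ (k, l)) x) * z l"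
    have "(\<Sum>l<p. (\<Sum>(x, c)\<leftarrow>a # xs. c * (G $$ (k, l)) x) * z l) = d * ?A k + ?B k" for k
      by (simp add: a sum.distrib distrib_right sum_distrib_left mult.assoc)
    then have "?lhs \<le> L2_set (\<lambda>k. cmod d * cmod (?A k) + cmod (?B k)) {..<p}"
      by (intro L2_set_mono) (simp_all add: norm_triangle_ineq flip: norm_mult)
    also have "\<dots> \<le> L2_set (\<lambda>k. cmod d * cmod (?A k)) {..<p} + L2_set (\<lambda>k. cmod (?B k)) {..<p}"
      by (rule L2_set_triangle_ineq)
    also have "\<dots> \<le> cmod d * (D * ?r) + c * ?r"
      using D(2)[OF G(2,3), of z] c(2)[OF G, of z] by (intro add_mono) (auto simp: L2_set_scale intro!: mult_left_mono)
    finally show ?thesis by (simp add: algebra_simps)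
  qed
  moreover have "cmod d * D + c \<ge> 0" using D c by simp
  ultimately show ?case by blast
qed

sublocale F: functional_space mults N predual
proof
  fix \<phi> assume "\<phi> \<in> predual"
  then obtain xs where xs: "\<phi> = (\<lambda>f. if f \<in> mults then \<Sum>(x, c)\<leftarrow>xs. c * f x else 0)"
    by (auto simp: predual_def eval_comb_def)
  have "(\<Sum>(x, c)\<leftarrow>xs. c * (f x + g x)) = (\<Sum>(x, c)\<leftarrow>xs. c * f x) + (\<Sum>(x, c)\<leftarrow>xs. c * g x)"
    "(\<Sum>(x, c)\<leftarrow>xs. c * (d * f x)) = d * (\<Sum>(x, c)\<leftarrow>xs. c * f x)" for f g d
    by (induction xs) (auto simp: algebra_simps)
  then show "clinear_on mults \<phi>"
    using csubspace_mults by (simp add: xs clinear_on_def csubspace_def scaleC_fun_def scaleC_complex_def)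
  show "\<phi> a = 0" if "a \<notin> mults" for a using that by (simp add: xs)
  obtain c where c: "c \<ge> 0" "\<And>p G z. p > 0 \<Longrightarrow> G \<in> matrices p mults \<Longrightarrow> N G \<le> 1 \<Longrightarrow>
    L2_set (\<lambda>k. cmod (\<Sum>l<p. (\<Sum>(x, c)\<leftarrow>xs. c * (G $$ (k, l)) x) * z l)) {..<p} \<le> c * L2_set (\<lambda>l. cmod (z l)) {..<p}"
    using predual_cb[of xs] by blast
  have "L2_set (\<lambda>k. cmod (\<Sum>l<p. \<phi> (G $$ (k, l)) * z l)) {..<p} \<le> c * L2_set (\<lambda>l. cmod (z l)) {..<p}"
    if G: "p > 0" "G \<in> matrices p mults" "N G \<le> 1" for p G z
  proof -
    have "L2_set (\<lambda>k. cmod (\<Sum>l<p. \<phi> (G $$ (k, l)) * z l)) {..<p} =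
        L2_set (\<lambda>k. cmod (\<Sum>l<p. (\<Sum>(x, c)\<leftarrow>xs. c * (G $$ (k, l)) x) * z l)) {..<p}"
      using matrices_entry[OF G(2)] by (intro L2_set_cong refl arg_cong[of _ _ cmod] sum.cong) (simp add: xs)
    then show ?thesis using c(2)[OF G, of z] by simp
  qed
  then show "\<exists>c\<ge>0. \<forall>p>0. \<forall>G\<in>matrices p mults. N G \<le> 1 \<longrightarrow> (\<forall>z.
      L2_set (\<lambda>k. cmod (\<Sum>l<p. \<phi> (G $$ (k, l)) * z l)) {..<p} \<le> c * L2_set (\<lambda>l. cmod (z l)) {..<p})"
    using c(1) by blast
qed (rule operator_space_mults csubspace_predual)+

text \<open>A matrix of vector functionals of two Gram--Schmidt families is a compression, so it is
  completely contractive by Bessel's inequality.\<close>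

lemma dual_norm_compression:
  assumes q: "ortho_family n q" and q': "ortho_family n q'" "\<And>k. k < n \<Longrightarrow> q' k \<in> kernel_span"
  defines "\<Phi> \<equiv> mat n n (\<lambda>(k, l). vec_functional (q l) (q' k))"
  shows "\<Phi> \<in> matrices n predual" and "F.dual_norm \<Phi> \<le> 1"
proof -
  have qL: "q l \<in> \<L>" if "l < n" for l using q that by (simp add: ortho_family_def)
  show \<Phi>: "\<Phi> \<in> matrices n predual"
    unfolding \<Phi>_def using qL q' by (intro matricesI) (auto intro: vec_functional_predual)
  have "pairing_bound \<Phi> G 1" if G: "G \<in> matrices r mults" "N G \<le> 1" for r G
  proof -
    note c = matrices_carrier[OF G(1)]
    have d: "dim_row \<Phi> = n" "dim_col \<Phi> = n" "dim_row G = r" "dim_col G = r"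
      using c by (auto simp: \<Phi>_def)
    show ?thesis unfolding pairing_bound_def d
    proof
      fix z :: "nat \<Rightarrow> nat \<Rightarrow> complex"
      \<comment> \<open>For each \<open>b\<close> the numbers \<open>z l b\<close> are taken as
        coefficients with respect to \<open>q\<close>; \<open>s\<close> is the resulting input
        column and \<open>u\<close> its image under \<open>G\<close>.\<close>
      define s where "s b = (\<Sum>l<n. z l b *\<^sub>C q l)" for b
      define u where "u a = (\<Sum>b<r. mult_op (G $$ (a, b)) (s b))" for a
      have s: "s b \<in> \<L>" for b unfolding s_def using qL by (intro sum_mem) auto
      have u: "u a \<in> \<L>" if "a < r" for a
        unfolding u_def using that s matrices_entry[OF G(1)] by (intro sum_mem) auto
      have eq: "(\<Sum>l<n. \<Sum>b<r. (\<Phi> $$ (k, l)) (G $$ (a, b)) * z l b) = ipL (u a) (q' k)"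
        if k: "k < n" and a: "a < r" for k a
      proof -
        have "ipL (u a) (q' k) = (\<Sum>b<r. ipL (mult_op (G $$ (a, b)) (s b)) (q' k))"
          unfolding u_def using k a s q' matrices_entry[OF G(1)] by (intro ip_sum_left) auto
        also have "\<dots> = (\<Sum>b<r. \<Sum>l<n. (\<Phi> $$ (k, l)) (G $$ (a, b)) * z l b)"
        proof (intro sum.cong refl)
          fix b assume "b \<in> {..<r}"
          then have m: "G $$ (a, b) \<in> mults" using matrices_entry[OF G(1) a] by simp
          have "ipL (mult_op (G $$ (a, b)) (s b)) (q' k) = ipL (\<Sum>l<n. z l b *\<^sub>C mult_op (G $$ (a, b)) (q l)) (q' k)"
            unfolding s_def using qL m by (subst act_sum_right) (auto simp: mult_op_scale_right)
          also have "\<dots> = (\<Sum>l<n. ipL (z l b *\<^sub>C mult_op (G $$ (a, b)) (q l)) (q' k))"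
            using qL m q' k by (intro ip_sum_left) auto
          also have "\<dots> = (\<Sum>l<n. (\<Phi> $$ (k, l)) (G $$ (a, b)) * z l b)"
            using qL m q' k by (intro sum.cong refl) (simp add: \<Phi>_def vec_functional_def ip_scale_left)
          finally show "ipL (mult_op (G $$ (a, b)) (s b)) (q' k) = (\<Sum>l<n. (\<Phi> $$ (k, l)) (G $$ (a, b)) * z l b)" .
        qed
        also have "\<dots> = (\<Sum>l<n. \<Sum>b<r. (\<Phi> $$ (k, l)) (G $$ (a, b)) * z l b)" by (rule sum.swap)
        finally show ?thesis by simp
      qed
      have "L2_set (\<lambda>k. L2_set (\<lambda>a. cmod (\<Sum>l<n. \<Sum>b<r. (\<Phi> $$ (k, l)) (G $$ (a, b)) * z l b)) {..<r}) {..<n} =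
          L2_set (\<lambda>k. L2_set (\<lambda>a. cmod (ipL (u a) (q' k))) {..<r}) {..<n}"
        by (intro L2_set_cong refl) (simp add: eq)
      also have "\<dots> = L2_set (\<lambda>a. L2_set (\<lambda>k. cmod (ipL (u a) (q' k))) {..<n}) {..<r}" by (rule L2_set_swap)
      \<comment> \<open>Bessel for \<open>q'\<close> handles the range side; on the domain side,
        expanding in \<open>q\<close> does not increase norms.\<close>
      also have "\<dots> \<le> L2_set (\<lambda>a. nrm (u a)) {..<r}" using u by (intro L2_set_mono bessel[OF q'(1)]) auto
      also have "\<dots> \<le> 1 * L2_set (\<lambda>b. nrm (s b)) {..<r}"
        using op_boundD[OF op_bound_mono[OF bnd_N[OF G(1)] G(2)], of s] d s by (simp add: u_def)
      also have "\<dots> \<le> 1 * L2_set (\<lambda>b. L2_set (\<lambda>l. cmod (z l b)) {..<n}) {..<r}"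
        unfolding s_def using s by (intro mult_left_mono L2_set_mono ortho_family_nrm_sum_le[OF q]) (auto simp: s_def)
      also have "\<dots> = 1 * L2_set (\<lambda>l. L2_set (\<lambda>b. cmod (z l b)) {..<r}) {..<n}"
        by (rule arg_cong[OF L2_set_swap])
      finally show "L2_set (\<lambda>k. L2_set (\<lambda>a. cmod (\<Sum>l<n. \<Sum>b<r. (\<Phi> $$ (k, l)) (G $$ (a, b)) * z l b)) {..<r}) {..<n}
          \<le> 1 * L2_set (\<lambda>l. L2_set (\<lambda>b. cmod (z l b)) {..<r}) {..<n}" .
    qed
  qed
  then show "F.dual_norm \<Phi> \<le> 1" using F.dual_norm_le_iff[OF \<Phi>, of 1] by simp
qed

text \<open>Compressions are norming, and point evaluations separate functions. A bounded functional
  on the predual is turned into a multiplier by feeding it the matrix coefficients with a fixed g,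
  which gives the inner products of the product function with kernel vectors.\<close>

lemma dual_operator_space_mults: "dual_operator_space mults N"
proof (rule F.dual_operator_spaceI)
  fix p G C assume p: "p > 0" and G: "G \<in> matrices p mults" and C: "C \<ge> 0"
    and le: "\<And>n \<Phi>. n > 0 \<Longrightarrow> \<Phi> \<in> matrices n predual \<Longrightarrow> F.dual_norm \<Phi> \<le> 1 \<Longrightarrow> pairing_bound \<Phi> G C"
  note c = matrices_carrier[OF G]
  show "N G \<le> C" unfolding N_le_iff[OF G C]
  proof (rule bnd_kernel_spanI[OF G C])
    fix v w assume v: "\<And>j. j < p \<Longrightarrow> v j \<in> \<L>" and w: "\<And>i. i < p \<Longrightarrow> w i \<in> kernel_span"
    \<comment> \<open>On the domain side any family will do; the range family \<open>q'\<close>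
      below has to stay in the kernel span, so that the compression has entries in the
      predual.\<close>
    obtain q where q: "ortho_family p q" "\<And>j. j < p \<Longrightarrow> v j = (\<Sum>l<p. ipL (v j) (q l) *\<^sub>C q l)"
      using gram_schmidt[OF subspace order_refl, of p v] v by blast
    obtain q' where q': "ortho_family p q'" "\<And>k. k < p \<Longrightarrow> q' k \<in> kernel_span"
      "\<And>i. i < p \<Longrightarrow> w i = (\<Sum>k<p. ipL (w i) (q' k) *\<^sub>C q' k)"
      using gram_schmidt[OF csubspace_kernel_span kernel_span_subset, of p w] w by blast
    define \<Phi> where "\<Phi> = mat p p (\<lambda>(k, l). vec_functional (q l) (q' k))"
    \<comment> \<open>\<open>R\<close> is the vector on which the pairing of \<open>\<Phi>\<close>
      with \<open>G\<close> is tested, \<open>S\<close> is the outcome, and \<open>R'\<close> holds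
      the coordinates of \<open>w\<close> against which \<open>S\<close> is summed.\<close>
    define R where "R l j = ipL (v j) (q l)" for l j
    define R' where "R' k i = ipL (w i) (q' k)" for k i
    define S where "S k i = (\<Sum>l<p. \<Sum>j<p. (\<Phi> $$ (k, l)) (G $$ (i, j)) * R l j)" for k i
    have qL: "q l \<in> \<L>" if "l < p" for l using q that by (simp add: ortho_family_def)
    have pb: "pairing_bound \<Phi> G C"
      unfolding \<Phi>_def by (rule le[OF p dual_norm_compression[OF q(1) q'(1,2)]])
    have nv: "nrm (v j) = L2_set (\<lambda>l. cmod (R l j)) {..<p}" if "j < p" for j
      unfolding R_def by (rule gram_schmidt_nrm[OF q(1) q(2)[OF that]])
    have nw: "nrm (w i) = L2_set (\<lambda>k. cmod (R' k i)) {..<p}" if "i < p" for i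
      unfolding R'_def by (rule gram_schmidt_nrm[OF q'(1) q'(3)[OF that]])
    have entry: "ipL (mult_op (G $$ (i, j)) (v j)) (q' k) = (\<Sum>l<p. (\<Phi> $$ (k, l)) (G $$ (i, j)) * R l j)"
      if "i < p" "j < p" "k < p" for i j k
    proof -
      have m: "G $$ (i, j) \<in> mults" using matrices_entry[OF G] that by simp
      have "mult_op (G $$ (i, j)) (v j) = mult_op (G $$ (i, j)) (\<Sum>l<p. R l j *\<^sub>C q l)"
        unfolding R_def by (rule arg_cong[OF q(2)[OF that(2)]])
      also have "\<dots> = (\<Sum>l<p. R l j *\<^sub>C mult_op (G $$ (i, j)) (q l))"
        using qL m by (subst act_sum_right) (auto simp: mult_op_scale_right)
      finally have "ipL (mult_op (G $$ (i, j)) (v j)) (q' k) = ipL (\<Sum>l<p. R l j *\<^sub>C mult_op (G $$ (i, j)) (q l)) (q' k)"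
        by simp
      also have "\<dots> = (\<Sum>l<p. ipL (R l j *\<^sub>C mult_op (G $$ (i, j)) (q l)) (q' k))"
        using qL m q' that by (intro ip_sum_left) auto
      also have "\<dots> = (\<Sum>l<p. (\<Phi> $$ (k, l)) (G $$ (i, j)) * R l j)"
        using qL m q' that by (intro sum.cong refl) (simp add: \<Phi>_def vec_functional_def ip_scale_left)
      finally show ?thesis .
    qed
    have "ipL (\<Sum>j<p. mult_op (G $$ (i, j)) (v j)) (w i) = (\<Sum>k<p. cnj (R' k i) * S k i)" if i: "i < p" for i
    proof -
      let ?t = "\<Sum>j<p. mult_op (G $$ (i, j)) (v j)"
      have m: "mult_op (G $$ (i, j)) (v j) \<in> \<L>" if "j < p" for j using matrices_entry[OF G i that] v that by simp
      have t: "?t \<in> \<L>" using m by (intro sum_mem) auto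
      have "ipL ?t (w i) = ipL ?t (\<Sum>k<p. R' k i *\<^sub>C q' k)"
        unfolding R'_def by (rule arg_cong[OF q'(3)[OF i]])
      also have "\<dots> = (\<Sum>k<p. ipL ?t (R' k i *\<^sub>C q' k))" using t q' by (intro ip_sum_right) auto
      also have "\<dots> = (\<Sum>k<p. cnj (R' k i) * S k i)"
      proof (intro sum.cong refl)
        fix k assume "k \<in> {..<p}"
        then have k: "k < p" by simp
        have "ipL ?t (q' k) = (\<Sum>j<p. ipL (mult_op (G $$ (i, j)) (v j)) (q' k))"
          using m q' k by (intro ip_sum_left) auto
        also have "\<dots> = (\<Sum>j<p. \<Sum>l<p. (\<Phi> $$ (k, l)) (G $$ (i, j)) * R l j)"
          using i k by (intro sum.cong refl entry) auto
        also have "\<dots> = S k i" unfolding S_def by (rule sum.swap)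
        finally show "ipL ?t (R' k i *\<^sub>C q' k) = cnj (R' k i) * S k i"
          using t q' k by (simp add: ip_scale_right)
      qed
      finally show ?thesis .
    qed
    then have "cmod (\<Sum>i<p. ipL (\<Sum>j<p. mult_op (G $$ (i, j)) (v j)) (w i)) =
        cmod (\<Sum>(i, k)\<in>{..<p} \<times> {..<p}. cnj (R' k i) * S k i)"
      by (simp add: sum.cartesian_product)
    also have "\<dots> \<le> (\<Sum>(i, k)\<in>{..<p} \<times> {..<p}. \<bar>cmod (R' k i)\<bar> * \<bar>cmod (S k i)\<bar>)"
      by (intro sum_norm_le) (auto simp: norm_mult)
    also have "\<dots> \<le> L2_set (\<lambda>(i, k). cmod (R' k i)) ({..<p} \<times> {..<p}) * L2_set (\<lambda>(i, k). cmod (S k i)) ({..<p} \<times> {..<p})"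
      using L2_set_mult_ineq[of "\<lambda>(i, k). cmod (R' k i)" "\<lambda>(i, k). cmod (S k i)" "{..<p} \<times> {..<p}"]
      by (simp add: split_def)
    also have "L2_set (\<lambda>(i, k). cmod (R' k i)) ({..<p} \<times> {..<p}) = L2_set (\<lambda>i. nrm (w i)) {..<p}"
      unfolding L2_set_prod by (intro L2_set_cong refl) (simp add: nw)
    also have "L2_set (\<lambda>(i, k). cmod (S k i)) ({..<p} \<times> {..<p}) = L2_set (\<lambda>k. L2_set (\<lambda>i. cmod (S k i)) {..<p}) {..<p}"
      unfolding L2_set_prod prod.case by (rule L2_set_swap)
    also have "L2_set (\<lambda>i. nrm (w i)) {..<p} * L2_set (\<lambda>k. L2_set (\<lambda>i. cmod (S k i)) {..<p}) {..<p}
      \<le> L2_set (\<lambda>i. nrm (w i)) {..<p} * (C * L2_set (\<lambda>l. L2_set (\<lambda>j. cmod (R l j)) {..<p}) {..<p})"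
      \<comment> \<open>\<open>R\<close> has the total norm of the column \<open>v\<close>, since
        Gram-Schmidt coordinates preserve norms; so the pairing bound becomes a bound on the action
        of \<open>G\<close>.\<close>
      using pb[unfolded pairing_bound_def, rule_format, of R] c
      by (intro mult_left_mono) (auto simp: \<Phi>_def S_def)
    also have "L2_set (\<lambda>l. L2_set (\<lambda>j. cmod (R l j)) {..<p}) {..<p} = L2_set (\<lambda>j. nrm (v j)) {..<p}"
      by (subst L2_set_swap) (intro L2_set_cong refl, simp add: nv)
    finally show "cmod (\<Sum>i<p. ipL (\<Sum>j<p. mult_op (G $$ (i, j)) (v j)) (w i))
        \<le> C * L2_set (\<lambda>j. nrm (v j)) {..<p} * L2_set (\<lambda>i. nrm (w i)) {..<p}"
      by (simp add: mult_ac)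
  qed
next
  fix f g assume fg: "f \<in> mults" "g \<in> mults" and eq: "\<And>\<phi>. \<phi> \<in> predual \<Longrightarrow> \<phi> f = \<phi> g"
  have "f x = g x" for x using eq[OF eval_comb_predual[of "[(x, 1)]"]] fg by (simp add: eval_comb_def)
  then show "f = g" by (rule ext)
next
  fix \<psi> assume \<psi>: "\<psi> \<in> opdual predual F.dual_norm"
  then have add: "\<And>\<phi> \<phi>'. \<phi> \<in> predual \<Longrightarrow> \<phi>' \<in> predual \<Longrightarrow> \<psi> (\<phi> + \<phi>') = \<psi> \<phi> + \<psi> \<phi>'"
    and scale: "\<And>c \<phi>. \<phi> \<in> predual \<Longrightarrow> \<psi> (c *\<^sub>C \<phi>) = c * \<psi> \<phi>"
    by (auto simp: opdual_def clinear_on_def scaleC_complex_def)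
  obtain C0 where C0: "\<forall>\<phi>\<in>predual. cmod (\<psi> \<phi>) \<le> C0 * F.dual_norm (mat1 \<phi>)" using \<psi> by (auto simp: opdual_def)
  define C where "C = \<bar>C0\<bar>"
  have m1: "mat1 \<phi> \<in> matrices 1 predual" if "\<phi> \<in> predual" for \<phi> using that by (intro matricesI) (auto simp: mat1_def)
  have C: "cmod (\<psi> \<phi>) \<le> C * F.dual_norm (mat1 \<phi>)" if "\<phi> \<in> predual" for \<phi>
    using C0 that mult_right_mono[of C0 C "F.dual_norm (mat1 \<phi>)"] F.dual_norm_nonneg[OF m1[OF that]]
    by (fastforce simp: C_def)
  \<comment> \<open>The only candidate: evaluation at a multiplier sends the evaluation at x to its
    value there.\<close>
  define f where "f x = \<psi> (eval_comb [(x, 1)])" for x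
  \<comment> \<open>Cauchy-Schwarz against \<open>w\<close> at every matrix level. Together with the
    bound on \<psi> it makes the conjugate linear form in \<open>w\<close> below bounded, as Riesz
    demands.\<close>
  have vf: "F.dual_norm (mat1 (vec_functional g w)) \<le> nrm g * nrm w" if g: "g \<in> \<L>" and w: "w \<in> kernel_span" for g w
  proof -
    have "pairing_bound (mat1 (vec_functional g w)) G (nrm g * nrm w)" if G: "G \<in> matrices r mults" "N G \<le> 1" for r G
    proof -
      note c = matrices_carrier[OF G(1)]
      have "L2_set (\<lambda>a. cmod (\<Sum>b<r. vec_functional g w (G $$ (a, b)) * z b)) {..<r} \<le> nrm g * nrm w * L2_set (\<lambda>b. cmod (z b)) {..<r}" for z
      proof -
        define u where "u a = (\<Sum>b<r. mult_op (G $$ (a, b)) (z b *\<^sub>C g))" for a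
        have u: "u a \<in> \<L>" if "a < r" for a
          unfolding u_def using that g matrices_entry[OF G(1)] by (intro sum_mem) auto
        have "(\<Sum>b<r. vec_functional g w (G $$ (a, b)) * z b) = ipL (u a) w" if "a < r" for a
          unfolding u_def using that g w matrices_entry[OF G(1)]
          by (subst ip_sum_left) (auto simp: vec_functional_def mult_op_scale_right ip_scale_left mult.commute)
        then have "L2_set (\<lambda>a. cmod (\<Sum>b<r. vec_functional g w (G $$ (a, b)) * z b)) {..<r} \<le> L2_set (\<lambda>a. nrm w * nrm (u a)) {..<r}"
          using u w cauchy_schwarz by (intro L2_set_mono) (auto simp: mult.commute[of "nrm w"])
        also have "\<dots> = nrm w * L2_set (\<lambda>a. nrm (u a)) {..<r}" using w by (simp add: L2_set_scale)
        also have "\<dots> \<le> nrm w * (1 * L2_set (\<lambda>b. nrm (z b *\<^sub>C g)) {..<r})"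
          using op_boundD[OF op_bound_mono[OF bnd_N[OF G(1)] G(2)], of "\<lambda>l. z l *\<^sub>C g"] c g w
          unfolding u_def by (intro mult_left_mono) auto
        also have "\<dots> = nrm g * nrm w * L2_set (\<lambda>b. cmod (z b)) {..<r}"
          using g by (simp add: nrm_scale L2_set_scale mult.commute[of _ "nrm g"])
        finally show ?thesis .
      qed
      then show ?thesis using c unfolding pairing_bound_def by (simp add: mat1_def L2_set_def sum_nonneg)
    qed
    then show ?thesis
      using F.dual_norm_le_iff[OF m1[OF vec_functional_predual[OF that]], of "nrm g * nrm w"] g w by simp
  qed
  have fm: "f \<in> mults"
  proof -
    have "mult_op f g \<in> \<L>" if g: "g \<in> \<L>" for g
    proof (rule mult_op_mem_riesz[OF g])
      fix u w assume uw: "u \<in> kernel_span" "w \<in> kernel_span"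
      have "vec_functional g (u + w) = vec_functional g u + vec_functional g w"
        using g uw by (auto simp: vec_functional_def fun_eq_iff ip_add_right)
      then show "\<psi> (vec_functional g (u + w)) = \<psi> (vec_functional g u) + \<psi> (vec_functional g w)"
        using add vec_functional_predual g uw by simp
    next
      fix c w assume w: "w \<in> kernel_span"
      have "vec_functional g (c *\<^sub>C w) = cnj c *\<^sub>C vec_functional g w"
      proof
        fix f
        show "vec_functional g (c *\<^sub>C w) f = (cnj c *\<^sub>C vec_functional g w) f"
          unfolding scaleC_fun_def[of "cnj c"] using g w
          by (simp add: vec_functional_def ip_scale_right scaleC_complex_def)
      qed
      then show "\<psi> (vec_functional g (c *\<^sub>C w)) = cnj c * \<psi> (vec_functional g w)"
        using scale vec_functional_predual g w by simp
    next
      fix w assume w: "w \<in> kernel_span"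
      have "cmod (\<psi> (vec_functional g w)) \<le> C * F.dual_norm (mat1 (vec_functional g w))"
        by (rule C[OF vec_functional_predual[OF g w]])
      also have "\<dots> \<le> C * (nrm g * nrm w)" using vf[OF g w] by (intro mult_left_mono) (auto simp: C_def)
      finally show "cmod (\<psi> (vec_functional g w)) \<le> C * nrm g * nrm w" by (simp add: mult.assoc)
    next
      fix w x e assume r: "represents w [(x, e)]"
      have "vec_functional g w = ipH (g x) e *\<^sub>C eval_comb [(x, 1)]"
        unfolding vec_functional_eq[OF g r]
        by (simp add: eval_comb_def fun_eq_iff scaleC_fun_def scaleC_complex_def)
      then show "\<psi> (vec_functional g w) = f x * ipH (g x) e"
        using scale[OF eval_comb_predual] by (simp add: f_def mult.commute)
    qed
    then show ?thesis unfolding multipliers_def by blast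
  qed
  have "\<psi> (eval_comb xs) = (\<Sum>(x, c)\<leftarrow>xs. c * f x)" for xs
  proof (induction xs)
    case Nil
    \<comment> \<open>The empty combination is zero times itself, so homogeneity of \<psi> forces
      the value 0.\<close>
    have "eval_comb [] = 0 *\<^sub>C eval_comb []" by (simp add: eval_comb_def fun_eq_iff)
    then have "\<psi> (eval_comb []) = 0" using scale[OF eval_comb_predual, of 0 "[]"] by (metis mult_zero_left)
    then show ?case by (simp only: list.map sum_list.Nil)
  next
    case (Cons a xs)
    obtain x d where a: "a = (x, d)" by (cases a)
    have "eval_comb (a # xs) = d *\<^sub>C eval_comb [(x, 1)] + eval_comb xs"
      by (simp add: a eval_comb_def fun_eq_iff scaleC_fun_def scaleC_complex_def)
    then have "\<psi> (eval_comb (a # xs)) = d * \<psi> (eval_comb [(x, 1)]) + \<psi> (eval_comb xs)"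
      using add csubspace_scale[OF csubspace_predual eval_comb_predual] scale[OF eval_comb_predual] eval_comb_predual
      by simp
    then show ?case using Cons by (simp add: a f_def)
  qed
  then show "\<exists>a\<in>mults. \<forall>\<phi>\<in>predual. \<psi> \<phi> = \<phi> a"
    using fm by (intro bexI[of _ f]) (auto simp: predual_def eval_comb_def)
qed

end

text \<open>If all functions vanish at x, then 0 satisfies the defining equation of the adjoint, and
  positivity makes it the only solution, so the description in \<open>hadjoint\<close> denotes
  0.\<close>

lemma reproducing_kernel_zero:
  assumes "inner_space \<L> ipL" "inner_space UNIV ipH" "\<And>g. g \<in> \<L> \<Longrightarrow> g x = 0"
  shows "reproducing_kernel ipH \<L> ipL x x = 0"
proof -
  interpret inner_space \<L> ipL by fact
  interpret H: inner_space UNIV ipH by fact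
  have "hadjoint \<L> ipL ipH (\<lambda>g. g x) e = 0" for e
    unfolding hadjoint_def
  proof (rule the_equality)
    show "0 \<in> \<L> \<and> (\<forall>v\<in>\<L>. ipH (v x) e = ipL v 0)"
    proof (intro conjI ballI)
      fix v assume v: "v \<in> \<L>"
      show "ipH (v x) e = ipL v 0" unfolding assms(3)[OF v] using v by simp
    qed simp
    fix u assume u: "u \<in> \<L> \<and> (\<forall>v\<in>\<L>. ipH (v x) e = ipL v u)"
    then have "ipL u u = 0" using assms(3)[of u] by (metis H.ip_zero_left UNIV_I)
    then show "u = 0" using u ip_pos[of u] by auto
  qed
  then show ?thesis by (simp add: reproducing_kernel_def fun_eq_iff)
qed

theorem theorem2p2:
  fixes ipH :: "'h::complex_vector \<Rightarrow> 'h \<Rightarrow> complex"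
    and \<L> :: "('x \<Rightarrow> 'h) set"
    and ipL :: "('x \<Rightarrow> 'h) \<Rightarrow> ('x \<Rightarrow> 'h) \<Rightarrow> complex"
    and K :: "'x \<Rightarrow> 'x \<Rightarrow> 'h \<Rightarrow> 'h"
  assumes "hilbert_space (UNIV :: 'h set) ipH"
    and "rkhs ipH \<L> ipL"
    and "K = reproducing_kernel ipH \<L> ipL"
    and "\<And>x. K x x \<noteq> 0"
    and "separates_points (multipliers \<L>)"
  shows "operator_algebra_of_functions (multipliers \<L>) (multiplier_norm \<L> ipL) \<and>
    dual_operator_algebra (multipliers \<L>) (multiplier_norm \<L> ipL) \<and>
    local_algebra (multipliers \<L>) (multiplier_norm \<L> ipL) \<and>
    BPW_complete (multipliers \<L>) (multiplier_norm \<L> ipL)"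
proof -
  have L: "hilbert_space \<L> ipL" using assms(2) by (simp add: rkhs_def)
  have "\<exists>g\<in>\<L>. g x \<noteq> 0" for x
    using reproducing_kernel_zero[OF hilbert_space_imp_inner_space[OF L] hilbert_space_imp_inner_space[OF assms(1)]]
      assms(3,4) by metis
  then interpret rkhs_multipliers \<L> ipL ipH
    using assms(2) unfolding rkhs_def
    by (intro rkhs_multipliers.intro rkhs_multipliers_axioms.intro hilbert_space_imp_hilbert
      hilbert_space_imp_inner_space L assms(1)) blast+
  show ?thesis
    using operator_algebra_of_functions_mults[OF assms(5)] operator_algebra_mults
      dual_operator_space_mults local_algebra_mults BPW_complete_mults
    by (simp add: dual_operator_algebra_def)
qed

end
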